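(* Let $p\ge 5$ be a prime. For each positive integer $t$, let $\mathrm{b}(p^t)$ be the number of (isomorphism classes of) Beauville groups of order $p^t$, and let $\mathrm{nb}(p^t)$ be the number of (isomorphism classes of) groups of order $p^t$ that can be generated by $2$ elements and are not Beauville groups. Then, as $t\to\infty$ (with $p$ fixed), \[ \mathrm{b}(p^t) \ge p^{\frac14 t^2+o(t^2)} \qquad\text{and}\qquad \mathrm{nb}(p^t) \ge p^{\frac14 t^2+o(t^2)} . \]
   Context: A spherical triple of generators of a group $G$ is a tuple $T=(x,y,z)$ of elements of $G$ with $G=\langle x,y,z\rangle$ and $xyz=1$. A finite group $G$ is a Beauville group if it admits two spherical triples of generators $T_1,T_2$ such that $\langle t_1\rangle^g\cap\langle t_2\rangle=1$ for all components $t_1$ of $T_1$, all components $t_2$ of $T_2$, and all $g\in G$ (then $(T_1,T_2)$ is called a Beauville structure of $G$). Beauville groups are in particular $2$-generator finite groups. The inequality $f(t)\ge p^{\frac14t^2+o(t^2)}$ means that there is a function $\varepsilon(t)$ with $\varepsilon(t)/t^2\to 0$ as $t\to\infty$ such that $f(t)\ge p^{\frac14 t^2+\varepsilon(t)}$ for all sufficiently large $t$. *)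

theory Defs
  imports Complex_Main "HOL-Algebra.Generated_Groups" "HOL-Computational_Algebra.Primes"
begin

definition spherical_triple :: "('a, 'b) monoid_scheme \<Rightarrow> 'a \<times> 'a \<times> 'a \<Rightarrow> bool" where
  "spherical_triple G T = (case T of (x, y, z) \<Rightarrow>
     x \<in> carrier G \<and> y \<in> carrier G \<and> z \<in> carrier G \<and>
     generate G {x, y, z} = carrier G \<and> x \<otimes>\<^bsub>G\<^esub> y \<otimes>\<^bsub>G\<^esub> z = \<one>\<^bsub>G\<^esub>)"

definition triple_components :: "'a \<times> 'a \<times> 'a \<Rightarrow> 'a set" where
  "triple_components T = (case T of (x, y, z) \<Rightarrow> {x, y, z})"

definition conjugate_set :: "('a, 'b) monoid_scheme \<Rightarrow> 'a set \<Rightarrow> 'a \<Rightarrow> 'a set" where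
  "conjugate_set G A g = (\<lambda>a. inv\<^bsub>G\<^esub> g \<otimes>\<^bsub>G\<^esub> a \<otimes>\<^bsub>G\<^esub> g) ` A"

definition beauville_structure ::
    "('a, 'b) monoid_scheme \<Rightarrow> 'a \<times> 'a \<times> 'a \<Rightarrow> 'a \<times> 'a \<times> 'a \<Rightarrow> bool" where
  "beauville_structure G T\<^sub>1 T\<^sub>2 \<longleftrightarrow>
     spherical_triple G T\<^sub>1 \<and> spherical_triple G T\<^sub>2 \<and>
     (\<forall>t\<^sub>1 \<in> triple_components T\<^sub>1. \<forall>t\<^sub>2 \<in> triple_components T\<^sub>2. \<forall>g \<in> carrier G.
        conjugate_set G (generate G {t\<^sub>1}) g \<inter> generate G {t\<^sub>2} = {\<one>\<^bsub>G\<^esub>})"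

definition beauville_group :: "('a, 'b) monoid_scheme \<Rightarrow> bool" where
  "beauville_group G \<longleftrightarrow>
     group G \<and> finite (carrier G) \<and> (\<exists>T\<^sub>1 T\<^sub>2. beauville_structure G T\<^sub>1 T\<^sub>2)"

definition two_generated :: "('a, 'b) monoid_scheme \<Rightarrow> bool" where
  "two_generated G \<longleftrightarrow> (\<exists>x \<in> carrier G. \<exists>y \<in> carrier G. generate G {x, y} = carrier G)"

text \<open>Every finite group is isomorphic to one whose carrier is a set of natural numbers
  (\<open>finite_group_nat_copy\<close> below), so isomorphism classes of finite groups are counted
  as classes of groups of type \<^typ>\<open>nat monoid\<close>.\<close>

definition num_groups_up_to_iso :: "(nat monoid \<Rightarrow> bool) \<Rightarrow> nat \<Rightarrow> nat" where
  "num_groups_up_to_iso P n =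
     (let \<G> = {G. group G \<and> order G = n \<and> P G}
      in card (\<G> // {(G, H). G \<in> \<G> \<and> H \<in> \<G> \<and> G \<cong> H}))"

definition num_beauville :: "nat \<Rightarrow> nat" where
  "num_beauville = num_groups_up_to_iso beauville_group"

definition num_non_beauville :: "nat \<Rightarrow> nat" where
  "num_non_beauville = num_groups_up_to_iso (\<lambda>G. two_generated G \<and> \<not> beauville_group G)"

lemma finite_group_nat_copy:
  fixes G :: "('a, 'b) monoid_scheme"
  assumes "group G" "finite (carrier G)"
  shows "\<exists>H :: nat monoid. group H \<and> G \<cong> H"
proof -
  interpret group G by fact
  obtain f :: "'a \<Rightarrow> nat" where f: "inj_on f (carrier G)"
    using finite_imp_inj_to_nat_seg[OF assms(2)] by blast
  define g where "g = the_inv_into (carrier G) f"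
  define H :: "nat monoid" where
    "H = \<lparr>carrier = f ` carrier G, monoid.mult = (\<lambda>a b. f (g a \<otimes>\<^bsub>G\<^esub> g b)), one = f \<one>\<^bsub>G\<^esub>\<rparr>"
  have g: "g (f a) = a" if "a \<in> carrier G" for a
    unfolding g_def using the_inv_into_f_f[OF f that] .
  have "f \<in> iso G H"
    using f by (auto simp: iso_def hom_def bij_betw_def H_def g)
  moreover have "group H"
  proof (rule groupI)
    fix x assume "x \<in> carrier H"
    then obtain a where a: "a \<in> carrier G" "x = f a" by (auto simp: H_def)
    have "f (inv\<^bsub>G\<^esub> a) \<otimes>\<^bsub>H\<^esub> x = \<one>\<^bsub>H\<^esub>" using a by (simp add: H_def g)
    moreover have "f (inv\<^bsub>G\<^esub> a) \<in> carrier H" using a by (simp add: H_def)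
    ultimately show "\<exists>y \<in> carrier H. y \<otimes>\<^bsub>H\<^esub> x = \<one>\<^bsub>H\<^esub>" by blast
  qed (auto simp: H_def g m_assoc)
  ultimately show ?thesis unfolding is_iso_def by blast
qed

lemma equiv_iso_on:
  assumes "\<And>G. G \<in> \<G> \<Longrightarrow> group G"
  shows "equiv \<G> {(G, H). G \<in> \<G> \<and> H \<in> \<G> \<and> G \<cong> H}"
proof (rule equivI)
  show "sym {(G, H). G \<in> \<G> \<and> H \<in> \<G> \<and> G \<cong> H}"
    using assms by (auto intro!: symI intro: group.iso_sym)
  show "trans {(G, H). G \<in> \<G> \<and> H \<in> \<G> \<and> G \<cong> H}"
    by (auto intro!: transI intro: iso_trans)
qed (auto simp: refl_on_def)

text \<open>The sets of classes counted above are finite, so \<^const>\<open>card\<close> does not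
  collapse to \<open>0\<close>.\<close>

lemma finite_iso_classes:
  fixes P :: "nat monoid \<Rightarrow> bool"
  assumes "n > 0" and \<G>: "\<G> = {G. group G \<and> order G = n \<and> P G}"
  shows "finite (\<G> // {(G, H). G \<in> \<G> \<and> H \<in> \<G> \<and> G \<cong> H})"
proof -
  let ?R = "{(G, H). G \<in> \<G> \<and> H \<in> \<G> \<and> G \<cong> H}"
  define e :: "nat monoid \<Rightarrow> nat \<Rightarrow> nat"
    where "e G = (SOME h. bij_betw h {..<n} (carrier G))" for G
  define tab where "tab G = (\<lambda>(i, j) \<in> {..<n} \<times> {..<n}.
    the_inv_into {..<n} (e G) (e G i \<otimes>\<^bsub>G\<^esub> e G j))" for G :: "nat monoid"
  have e: "bij_betw (e G) {..<n} (carrier G)" if "G \<in> \<G>" for G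
  proof -
    have c: "card (carrier G) = n" using that by (simp add: \<G> order_def)
    then have "finite (carrier G)" using assms(1) card.infinite by fastforce
    then have "\<exists>h. bij_betw h {..<n} (carrier G)"
      using c by (intro finite_same_card_bij) auto
    then show ?thesis unfolding e_def by (rule someI_ex)
  qed
  have closed: "e G i \<otimes>\<^bsub>G\<^esub> e G j \<in> carrier G" if "G \<in> \<G>" "i < n" "j < n" for G i j
  proof -
    have "group G" using that(1) by (simp add: \<G>)
    moreover have "e G i \<in> carrier G" "e G j \<in> carrier G"
      using bij_betwE[OF e[OF that(1)]] that by auto
    ultimately show ?thesis by (simp add: group.is_monoid monoid.m_closed)
  qed
  have tab_in: "tab ` \<G> \<subseteq> ({..<n} \<times> {..<n}) \<rightarrow>\<^sub>E {..<n}"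
  proof (rule image_subsetI)
    fix G assume G: "G \<in> \<G>"
    then show "tab G \<in> ({..<n} \<times> {..<n}) \<rightarrow>\<^sub>E {..<n}"
      unfolding tab_def
      using bij_betwE[OF bij_betw_the_inv_into[OF e[OF G]]] closed[OF G] by auto
  qed
  have e_tab: "e G (tab G (i, j)) = e G i \<otimes>\<^bsub>G\<^esub> e G j"
    if "G \<in> \<G>" "i < n" "j < n" for G i j
    using f_the_inv_into_f_bij_betw[OF e[OF that(1)]] closed[OF that] that
    by (simp add: tab_def)
  have iso: "G \<cong> H" if GH: "G \<in> \<G>" "H \<in> \<G>" "tab G = tab H" for G H
  proof -
    let ?g = "the_inv_into {..<n} (e G)"
    let ?f = "e H \<circ> ?g"
    have b: "bij_betw ?f (carrier G) (carrier H)"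
      by (rule bij_betw_trans[OF bij_betw_the_inv_into[OF e[OF GH(1)]] e[OF GH(2)]])
    have g: "?g (e G i) = i" if "i < n" for i
      using the_inv_into_f_f[of "e G" "{..<n}" i] e[OF GH(1)] that by (simp add: bij_betw_def)
    have "?f (x \<otimes>\<^bsub>G\<^esub> y) = ?f x \<otimes>\<^bsub>H\<^esub> ?f y"
      if xy: "x \<in> carrier G" "y \<in> carrier G" for x y
    proof -
      have "x \<in> e G ` {..<n}" "y \<in> e G ` {..<n}"
        using bij_betw_imp_surj_on[OF e[OF GH(1)]] xy by auto
      then obtain i j where ij: "i < n" "x = e G i" "j < n" "y = e G j" by auto
      have t: "tab G (i, j) < n" using tab_in GH(1) ij by (auto simp: PiE_iff image_subset_iff)
      have "?f (x \<otimes>\<^bsub>G\<^esub> y) = e H (?g (e G (tab G (i, j))))"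
        using e_tab[OF GH(1)] ij by simp
      also have "\<dots> = e H (tab H (i, j))" using g[OF t] GH(3) by simp
      also have "\<dots> = ?f x \<otimes>\<^bsub>H\<^esub> ?f y" using e_tab[OF GH(2)] ij g by simp
      finally show ?thesis .
    qed
    then have "?f \<in> iso G H"
      using b bij_betwE[OF b] by (auto simp: iso_def hom_def)
    then show ?thesis by (rule is_isoI)
  qed
  have eq: "equiv \<G> ?R" by (rule equiv_iso_on) (simp add: \<G>)
  have "finite (tab ` \<G>)" by (rule finite_subset[OF tab_in]) (auto intro: finite_PiE)
  moreover have "\<G> // ?R \<subseteq> (\<lambda>t. ?R `` {SOME G. G \<in> \<G> \<and> tab G = t}) ` (tab ` \<G>)"
  proof
    fix C assume "C \<in> \<G> // ?R"
    then obtain G where G: "G \<in> \<G>" "C = ?R `` {G}" by (auto elim: quotientE)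
    define G' where "G' = (SOME K. K \<in> \<G> \<and> tab K = tab G)"
    have G': "G' \<in> \<G> \<and> tab G' = tab G"
      unfolding G'_def by (rule someI[of _ G]) (use G in simp)
    then have "(G, G') \<in> ?R" using G iso[of G G'] by simp
    then have "C = ?R `` {G'}" using equiv_class_eq[OF eq] G(2) by simp
    then show "C \<in> (\<lambda>t. ?R `` {SOME G. G \<in> \<G> \<and> tab G = t}) ` (tab ` \<G>)"
      using G(1) unfolding G'_def by blast
  qed
  ultimately show ?thesis by (meson finite_imageI finite_subset)
qed

end

theory Submission
  imports Defs "HOL-Algebra.Elementary_Groups" "HOL-Algebra.Multiplicative_Group" "HOL-Number_Theory.Cong"
begin

text \<open>
  The groups are found as quotients of one finite \<open>p\<close>-group \<open>gen_group\<close> with two generators by many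
  normal subgroups \<open>J\<close> of the same index.  By \<open>card_le_num_groups\<close>, \<open>p ^ E\<close> normal subgroups of index
  \<open>p ^ t\<close> yield at least \<open>p ^ (E - 2 * t)\<close> isomorphism classes, so it suffices to have \<open>E\<close> close to
  \<open>t\<^sup>2 / 4\<close>.  If \<open>J\<close> lies in an elementary abelian normal subgroup \<open>top_layer\<close> of index about
  \<open>p ^ (t / 2)\<close> and rank much larger than \<open>t\<close>, then \<open>J\<close> has index about \<open>p ^ (t / 2)\<close> in it.
  Without any group action one could take all subspaces of codimension \<open>t / 2\<close>; with the action only
  the invariant ones count, and the aim is that they are still numerous enough.

  To this end \<open>q = p ^ e\<close> letters are permuted cyclically by a rotation of order \<open>q\<close>.  One generator
  is the rotation, the other is the unit \<open>1 + X\<close> for one letter \<open>X\<close> in a free algebra over the field with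
  \<open>p\<close> elements, truncated so that a basis is given by words of length at most \<open>c + 1\<close> without
  repeated letters.  On the terms of top degree, conjugation acts only through the rotation, so that
  part is a module over the group ring of the cyclic group of order \<open>q\<close>.  A submodule with a
  free quotient of rank \<open>r\<close> over this ring has codimension \<open>r * q\<close>, and with \<open>R\<close> free orbits there are about
  \<open>p ^ (r * q * (R - r))\<close> of them (\<open>many_normal_subgroups\<close>).  With \<open>r * q \<approx> t / 2\<close> and \<open>r\<close> small,
  the exponent is \<open>t / 2\<close> times \<open>R\<close>, so \<open>R \<approx> t / 2\<close> orbits are wanted while the index of the top
  layer has an exponent of at most about \<open>t / 2\<close>.

  Both estimates are matters of free Lie algebras, used here in a form that avoids them.  Let \<open>B\<close> be
  the number of words of length \<open>c\<close>.  The coefficients of group elements satisfy shuffle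
  relations, and these show that only \<open>B / c\<close> of the coefficients of degree \<open>c\<close> are free
  (\<open>coef_determined\<close>, \<open>card_gen_set_le\<close>); the lower degrees contribute terms of smaller order.
  Conversely, iterated commutators are triangular with respect to the words with a given first letter
  (\<open>lie_element\<close>), and so the top layer has a rank of nearly \<open>q * B / c\<close>, in
  nearly \<open>B / c\<close> free orbits (\<open>ex_leads\<close>).  If \<open>B / c\<close> is close to \<open>t / 2\<close>, then the
  exponent is \<open>t\<^sup>2 / 4\<close> times a factor \<open>(c - 2) / (c + 1)\<close>, which tends to \<open>1\<close> as \<open>c\<close> grows.  To
  bring \<open>B\<close> to the wanted value, only words with a mark are admitted in degrees \<open>c\<close> and \<open>c + 1\<close>, and the
  condition to be marked contains a parameter \<open>d\<close> that changes \<open>B\<close> in small steps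
  (\<open>tune_marked_words\<close>).

  Finally, cyclic groups of orders \<open>m1\<close> and \<open>m2\<close> are attached to the two generators.  This changes the
  order only by \<open>p ^ O(e + c)\<close> but decides the kind of the quotients.  If \<open>m1\<close> and \<open>m2\<close> are equal and
  a multiple of the exponent of the rest of the group, then cyclic subgroups whose directions in the
  abelianisation are independent modulo \<open>p\<close> intersect trivially, and for \<open>p \<ge> 5\<close> there are six suitable directions
  (\<open>beauville_criterion\<close>).  If only \<open>m1\<close> is nontrivial and \<open>p\<close> times as large as such a multiple, then all
  elements outside a maximal subgroup have a common nontrivial power
  (\<open>not_beauville_criterion\<close>).\<close>

section \<open>Normal subgroups and isomorphism classes of quotients\<close>

lemma hom_eq_on_generate:
  assumes "group G" "group H" "f \<in> hom G H" "g \<in> hom G H" "A \<subseteq> carrier G"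
    and "\<And>a. a \<in> A \<Longrightarrow> f a = g a" and "w \<in> generate G A"
  shows "f w = g w"
  using assms(7)
proof (induction rule: generate.induct)
  case one
  then show ?case using hom_one[OF assms(3,1,2)] hom_one[OF assms(4,1,2)] by simp
next
  case (incl h)
  then show ?case using assms(6) by simp
next
  case (inv h)
  then have h: "h \<in> carrier G" using assms(5) by blast
  interpret f: group_hom G H f using assms by (simp add: group_hom_def group_hom_axioms_def)
  interpret g: group_hom G H g using assms by (simp add: group_hom_def group_hom_axioms_def)
  show ?case using inv assms(6) h f.hom_inv g.hom_inv by simp
next
  case (eng h1 h2)
  have "h1 \<in> carrier G" "h2 \<in> carrier G"
    using eng group.generate_in_carrier[OF assms(1,5)] by auto
  then show ?case using eng hom_mult[OF assms(3)] hom_mult[OF assms(4)] by simp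
qed

text \<open>A normal subgroup is the kernel of a homomorphism onto a representative of the isomorphism class
  of its quotient, and this homomorphism is fixed by the images of two generators.  So at most
  \<open>n\<^sup>2\<close> normal subgroups have isomorphic quotients of order \<open>n\<close>.  For \<open>n = p ^ t\<close> the loss is a
  factor \<open>p ^ (2 * t)\<close>, which is invisible next to \<open>p\<close> to the power \<open>t\<^sup>2 / 4\<close>.\<close>

lemma card_le_num_groups:
  fixes G :: "('a, 'b) monoid_scheme"
  assumes G: "group G" and xy: "x \<in> carrier G" "y \<in> carrier G" "generate G {x, y} = carrier G"
    and n: "n > 0"
    and ord: "\<And>J. J \<in> \<J> \<Longrightarrow> J \<lhd> G \<and> order (G Mod J) = n"
    and Q: "\<And>J (H :: nat monoid) \<theta>. \<lbrakk>J \<in> \<J>; group H; order H = n; \<theta> \<in> hom G H;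
              \<theta> ` carrier G = carrier H; kernel G H \<theta> = J\<rbrakk> \<Longrightarrow> Q H"
  shows "card \<J> \<le> num_groups_up_to_iso Q n * n\<^sup>2"
proof -
  define \<G> where "\<G> = {H :: nat monoid. group H \<and> order H = n \<and> Q H}"
  define R where "R = {(H, K). H \<in> \<G> \<and> K \<in> \<G> \<and> H \<cong> K}"
  have fin: "finite (\<G> // R)"
    unfolding R_def by (rule finite_iso_classes[OF n]) (simp add: \<G>_def)
  have eq: "equiv \<G> R"
    unfolding R_def by (rule equiv_iso_on) (simp add: \<G>_def)
  define rep where "rep C = (SOME H. H \<in> C)" for C :: "nat monoid set"
  have rep: "rep C \<in> C \<and> C \<subseteq> \<G> \<and> (\<forall>H \<in> C. H \<cong> rep C)" if C: "C \<in> \<G> // R" for C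
  proof -
    have "C \<noteq> {}" using in_quotient_imp_non_empty[OF eq C] .
    then have r: "rep C \<in> C" unfolding rep_def by (auto intro: someI)
    moreover have "C \<subseteq> \<G>" using in_quotient_imp_subset[OF eq C] .
    moreover have "H \<cong> rep C" if "H \<in> C" for H
      using in_quotient_imp_in_rel[OF eq C, of H "rep C"] that r by (simp add: R_def)
    ultimately show ?thesis by blast
  qed
  have ex: "\<exists>C \<psi>. C \<in> \<G> // R \<and> \<psi> \<in> hom G (rep C) \<and> kernel G (rep C) \<psi> = J" if J: "J \<in> \<J>" for J
  proof -
    have nJ: "J \<lhd> G" and oJ: "order (G Mod J) = n" using ord[OF J] by auto
    interpret normal J G by (rule nJ)
    have gq: "group (G Mod J)" by (rule factorgroup_is_group)
    have fq: "finite (carrier (G Mod J))" using oJ n unfolding order_def using card_gt_0_iff by metis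
    obtain H :: "nat monoid" where H: "group H" "(G Mod J) \<cong> H"
      using finite_group_nat_copy[OF gq fq] by blast
    then obtain h where h: "h \<in> iso (G Mod J) H" unfolding is_iso_def by auto
    have oH: "order H = n" using iso_same_card[OF H(2)] oJ by (simp add: order_def)
    define \<theta> where "\<theta> = h \<circ> (\<lambda>a. J #>\<^bsub>G\<^esub> a)"
    have \<theta>: "\<theta> \<in> hom G H"
    proof -
      have "h \<in> hom (G Mod J) H" using h by (simp add: iso_def)
      then show ?thesis unfolding \<theta>_def by (rule Group.hom_compose[OF r_coset_hom_Mod])
    qed
    have surj: "\<theta> ` carrier G = carrier H"
    proof -
      have "carrier (G Mod J) = (\<lambda>a. J #>\<^bsub>G\<^esub> a) ` carrier G"
        by (auto simp: FactGroup_def RCOSETS_def)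
      then show ?thesis using h by (auto simp: \<theta>_def iso_def bij_betw_def image_comp[symmetric])
    qed
    have injh: "inj_on h (carrier (G Mod J))" using h by (simp add: iso_def bij_betw_def)
    have ker: "kernel G H \<theta> = J"
    proof -
      have "\<theta> a = \<one>\<^bsub>H\<^esub> \<longleftrightarrow> a \<in> J" if a: "a \<in> carrier G" for a
      proof -
        have "h (\<one>\<^bsub>G Mod J\<^esub>) = \<one>\<^bsub>H\<^esub>"
          using hom_one[OF _ gq H(1)] h by (simp add: iso_def)
        moreover have "J #>\<^bsub>G\<^esub> a \<in> carrier (G Mod J)" using a
          by (auto simp: FactGroup_def RCOSETS_def)
        moreover have "\<one>\<^bsub>G Mod J\<^esub> \<in> carrier (G Mod J)"
          by (rule monoid.one_closed[OF group.is_monoid[OF gq]])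
        ultimately have "\<theta> a = \<one>\<^bsub>H\<^esub> \<longleftrightarrow> J #>\<^bsub>G\<^esub> a = J"
          using inj_onD[OF injh, of "J #>\<^bsub>G\<^esub> a" "\<one>\<^bsub>G Mod J\<^esub>"]
          by (auto simp: \<theta>_def FactGroup_def)
        also have "\<dots> \<longleftrightarrow> a \<in> J"
          using coset_join1[OF _ a is_subgroup] coset_join2[OF a is_subgroup] by blast
        finally show ?thesis .
      qed
      then show ?thesis using subset by (auto simp: kernel_def)
    qed
    have HG: "H \<in> \<G>" using Q[OF J H(1) oH \<theta> surj ker] H oH by (simp add: \<G>_def)
    let ?C = "R `` {H}"
    have C: "?C \<in> \<G> // R" using HG by (rule quotientI)
    have "H \<in> ?C" using equiv_class_self[OF eq HG] .
    then obtain k where k: "k \<in> iso H (rep ?C)" using rep[OF C] unfolding is_iso_def by blast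
    have gr: "group (rep ?C)" using rep[OF C] by (auto simp: \<G>_def)
    have "k \<circ> \<theta> \<in> hom G (rep ?C)"
      by (rule Group.hom_compose[OF \<theta>]) (use k in \<open>simp add: iso_def\<close>)
    moreover have "kernel G (rep ?C) (k \<circ> \<theta>) = J"
    proof -
      have "k \<one>\<^bsub>H\<^esub> = \<one>\<^bsub>rep ?C\<^esub>" using hom_one[OF _ H(1) gr] k by (simp add: iso_def)
      moreover have "inj_on k (carrier H)" using k by (simp add: iso_def bij_betw_def)
      moreover have "\<one>\<^bsub>H\<^esub> \<in> carrier H" using H(1) by (simp add: group.is_monoid monoid.one_closed)
      ultimately have "k b = \<one>\<^bsub>rep ?C\<^esub> \<longleftrightarrow> b = \<one>\<^bsub>H\<^esub>" if "b \<in> carrier H" for b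
        using that by (metis inj_onD)
      then have "kernel G (rep ?C) (k \<circ> \<theta>) = kernel G H \<theta>"
        using surj by (auto simp: kernel_def)
      then show ?thesis using ker by simp
    qed
    ultimately show ?thesis using C by blast
  qed
  then obtain c \<psi> where c: "\<And>J. J \<in> \<J> \<Longrightarrow> c J \<in> \<G> // R \<and> \<psi> J \<in> hom G (rep (c J)) \<and> kernel G (rep (c J)) (\<psi> J) = J"
  proof -
    assume a: "\<And>c \<psi>. (\<And>J. J \<in> \<J> \<Longrightarrow> c J \<in> \<G> // R \<and> \<psi> J \<in> hom G (rep (c J)) \<and> kernel G (rep (c J)) (\<psi> J) = J) \<Longrightarrow> thesis"
    have "\<forall>J \<in> \<J>. \<exists>z. fst z \<in> \<G> // R \<and> snd z \<in> hom G (rep (fst z)) \<and> kernel G (rep (fst z)) (snd z) = J"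
      using ex by auto
    then obtain z where "\<forall>J \<in> \<J>. fst (z J) \<in> \<G> // R \<and> snd (z J) \<in> hom G (rep (fst (z J))) \<and> kernel G (rep (fst (z J))) (snd (z J)) = J"
      by (drule_tac bchoice) blast
    then show thesis by (intro a[of "\<lambda>J. fst (z J)" "\<lambda>J. snd (z J)"]) blast
  qed
  \<comment> \<open>The class of the quotient and the images of the two generators determine the subgroup.\<close>
  let ?S = "SIGMA C : \<G> // R. carrier (rep C) \<times> carrier (rep C)"
  let ?F = "\<lambda>J. (c J, \<psi> J x, \<psi> J y)"
  have rG: "group (rep C)" "card (carrier (rep C)) = n" if "C \<in> \<G> // R" for C
    using rep[OF that] by (auto simp: \<G>_def order_def)
  have finr: "finite (carrier (rep C))" if "C \<in> \<G> // R" for C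
    using rG[OF that] n card_gt_0_iff by metis
  have "inj_on ?F \<J>"
  proof (rule inj_onI)
    fix J J' assume J: "J \<in> \<J>" "J' \<in> \<J>" and e: "?F J = ?F J'"
    have "\<psi> J w = \<psi> J' w" if "w \<in> carrier G" for w
    proof (rule hom_eq_on_generate[OF G])
      show "group (rep (c J))" using rG c[OF J(1)] by blast
      show "\<psi> J \<in> hom G (rep (c J))" using c[OF J(1)] by blast
      show "\<psi> J' \<in> hom G (rep (c J))" using c[OF J(2)] e by simp
      show "{x, y} \<subseteq> carrier G" using xy by simp
      show "w \<in> generate G {x, y}" using xy that by simp
    qed (use e in auto)
    then have "kernel G (rep (c J)) (\<psi> J) = kernel G (rep (c J')) (\<psi> J')"
      using e by (auto simp: kernel_def)
    then show "J = J'" using c[OF J(1)] c[OF J(2)] by simp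
  qed
  moreover have "?F ` \<J> \<subseteq> ?S"
  proof
    fix w assume "w \<in> ?F ` \<J>"
    then obtain J where J: "J \<in> \<J>" "w = ?F J" by blast
    have "c J \<in> \<G> // R" "\<psi> J \<in> hom G (rep (c J))" using c[OF J(1)] by blast+
    then show "w \<in> ?S" using J(2) xy hom_in_carrier by fast
  qed
  moreover have fS: "finite ?S" using fin finr by (intro finite_SigmaI) auto
  ultimately have "card \<J> \<le> card ?S" by (rule card_inj_on_le)
  also have "card ?S = (\<Sum>C \<in> \<G> // R. n * n)"
    using fin finr rG by (subst card_SigmaI) (auto simp: card_cartesian_product)
  also have "\<dots> = num_groups_up_to_iso Q n * n\<^sup>2"
    by (simp add: num_groups_up_to_iso_def Let_def \<G>_def R_def power2_eq_square)
  finally show ?thesis .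
qed

section \<open>Quotients that are Beauville groups and quotients that are not\<close>

text \<open>Suppose that a conjugate of \<open>\<theta> a [^] i\<close> equals \<open>\<theta> b [^] j\<close>.  The two characters factor through
  \<open>\<theta>\<close> and do not see the conjugation, so \<open>i\<close> times the vector of \<open>a\<close> equals \<open>j\<close> times the vector
  of \<open>b\<close> modulo \<open>N\<close>.  If the determinant of these vectors is a unit, then \<open>N\<close> divides \<open>i\<close>, and
  \<open>N\<close> is an exponent of \<open>H\<close>.\<close>

lemma beauville_disjoint:
  fixes P :: "('a, 'b) monoid_scheme" and H :: "('c, 'd) monoid_scheme"
  assumes \<theta>: "group_hom P H \<theta>" and surj: "\<theta> ` carrier P = carrier H" and N: "N > 0"
    and \<chi>x: "\<chi>x \<in> hom P (integer_mod_group N)" and \<chi>y: "\<chi>y \<in> hom P (integer_mod_group N)"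
    and ker: "\<And>g. g \<in> carrier P \<Longrightarrow> \<theta> g = \<one>\<^bsub>H\<^esub> \<Longrightarrow> \<chi>x g = 0 \<and> \<chi>y g = 0"
    and exp: "\<And>g. g \<in> carrier P \<Longrightarrow> \<theta> g [^]\<^bsub>H\<^esub> N = \<one>\<^bsub>H\<^esub>"
    and ab: "a \<in> carrier P" "b \<in> carrier P"
    and cop: "coprime (\<chi>x a * \<chi>y b - \<chi>y a * \<chi>x b) (int N)"
    and h: "h \<in> carrier H"
  shows "conjugate_set H (generate H {\<theta> a}) h \<inter> generate H {\<theta> b} = {\<one>\<^bsub>H\<^esub>}"
proof -
  interpret group_hom P H \<theta> by (rule \<theta>)
  obtain g where g: "g \<in> carrier P" "h = \<theta> g" using h surj by blast
  have ta: "\<theta> a \<in> carrier H" "\<theta> b \<in> carrier H" using ab by auto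
  have "z = \<one>\<^bsub>H\<^esub>" if z: "z \<in> conjugate_set H (generate H {\<theta> a}) h \<inter> generate H {\<theta> b}" for z
  proof -
    obtain i :: int where i: "z = inv\<^bsub>H\<^esub> h \<otimes>\<^bsub>H\<^esub> (\<theta> a [^]\<^bsub>H\<^esub> i) \<otimes>\<^bsub>H\<^esub> h"
      using z ta by (auto simp: conjugate_set_def H.generate_pow)
    obtain j :: int where j: "z = \<theta> b [^]\<^bsub>H\<^esub> j" using z ta by (auto simp: H.generate_pow)
    define w where "w = inv\<^bsub>P\<^esub> g \<otimes>\<^bsub>P\<^esub> (a [^]\<^bsub>P\<^esub> i) \<otimes>\<^bsub>P\<^esub> g"
    have wP: "w \<in> carrier P" using g ab by (simp add: w_def)
    have tw: "\<theta> w = z" using i g ab by (simp add: w_def hom_int_pow)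
    have bj: "b [^]\<^bsub>P\<^esub> j \<in> carrier P" using ab by simp
    have "\<theta> (w \<otimes>\<^bsub>P\<^esub> inv\<^bsub>P\<^esub> (b [^]\<^bsub>P\<^esub> j)) = z \<otimes>\<^bsub>H\<^esub> inv\<^bsub>H\<^esub> z"
      using wP bj tw j ab by (simp add: hom_int_pow)
    also have "\<dots> = \<one>\<^bsub>H\<^esub>" using tw wP using H.r_inv[of z] hom_closed[OF wP] by simp
    finally have k: "\<theta> (w \<otimes>\<^bsub>P\<^esub> inv\<^bsub>P\<^esub> (b [^]\<^bsub>P\<^esub> j)) = \<one>\<^bsub>H\<^esub>" .
    have val: "int N dvd i * \<chi> a - j * \<chi> b"
      if \<chi>: "\<chi> \<in> hom P (integer_mod_group N)" and 0: "\<chi> (w \<otimes>\<^bsub>P\<^esub> inv\<^bsub>P\<^esub> (b [^]\<^bsub>P\<^esub> j)) = 0" for \<chi>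
    proof -
      interpret c: group_hom P "integer_mod_group N" \<chi>
        using \<chi> by (simp add: group_hom_def group_hom_axioms_def)
      have pw: "\<chi> (u [^]\<^bsub>P\<^esub> m) = (m * \<chi> u) mod int N" if "u \<in> carrier P" for u and m :: int
        using that by (simp add: c.hom_int_pow int_pow_integer_mod_group)
      have iv: "\<chi> (inv\<^bsub>P\<^esub> u) = (- \<chi> u) mod int N" if "u \<in> carrier P" for u
        using that c.hom_closed[OF that] by (simp add: c.hom_inv)
      have "\<chi> w = (i * \<chi> a) mod int N"
        unfolding w_def using g ab by (simp add: pw iv mod_simps del: c.hom_inv)
      then have "(i * \<chi> a - j * \<chi> b) mod int N = 0"
        using 0 wP ab by (simp add: iv pw mod_simps del: c.hom_inv)
      then show ?thesis by (simp add: mod_eq_0_iff_dvd)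
    qed
    have d1: "int N dvd i * \<chi>x a - j * \<chi>x b" and d2: "int N dvd i * \<chi>y a - j * \<chi>y b"
      using val[OF \<chi>x] val[OF \<chi>y] ker[OF _ k] wP bj by auto
    have "i * (\<chi>x a * \<chi>y b - \<chi>y a * \<chi>x b)
        = (i * \<chi>x a - j * \<chi>x b) * \<chi>y b - (i * \<chi>y a - j * \<chi>y b) * \<chi>x b"
      by (simp add: algebra_simps)
    then have "int N dvd i * (\<chi>x a * \<chi>y b - \<chi>y a * \<chi>x b)"
      using dvd_diff[OF dvd_mult2[OF d1] dvd_mult2[OF d2]] by metis
    then have "int N dvd i" using cop by (simp add: coprime_commute coprime_dvd_mult_left_iff)
    then obtain m where m: "i = int N * m" by (auto elim: dvdE)
    have "\<theta> a [^]\<^bsub>H\<^esub> i = (\<theta> a [^]\<^bsub>H\<^esub> int N) [^]\<^bsub>H\<^esub> m"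
      using ta by (simp add: m H.int_pow_pow mult.commute)
    also have "\<dots> = \<one>\<^bsub>H\<^esub>" using exp[OF ab(1)] by (simp add: int_pow_int)
    finally show "z = \<one>\<^bsub>H\<^esub>" using i h by simp
  qed
  moreover have "\<one>\<^bsub>H\<^esub> \<in> conjugate_set H (generate H {\<theta> a}) h \<inter> generate H {\<theta> b}"
    using h by (auto simp: conjugate_set_def generate.one intro!: rev_image_eqI[OF generate.one])
  ultimately show ?thesis by blast
qed

text \<open>The two triples begin with \<open>x, y\<close> and with \<open>u = x y\<inverse>, v = x y\<^sup>2\<close>.  Their components point in the
  directions \<open>(1, 0), (0, 1), (-1, -1)\<close> and \<open>(1, -1), (1, 2), (-2, -1)\<close>, and each determinant of a
  direction of the first kind with one of the second kind is \<open>1\<close>, \<open>-1\<close>, \<open>2\<close> or \<open>-2\<close>, hence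
  prime to \<open>N\<close>.  The elements \<open>u\<close> and \<open>v\<close> generate because \<open>u\<inverse> v = y\<^sup>3\<close> and \<open>3\<close> is prime to the
  exponent.\<close>

lemma beauville_criterion:
  fixes P :: "('a, 'b) monoid_scheme" and H :: "('c, 'd) monoid_scheme"
  assumes \<theta>: "group_hom P H \<theta>" and surj: "\<theta> ` carrier P = carrier H" and fin: "finite (carrier H)"
    and N: "N > 1" "coprime 6 N"
    and \<chi>x: "\<chi>x \<in> hom P (integer_mod_group N)" and \<chi>y: "\<chi>y \<in> hom P (integer_mod_group N)"
    and ker: "\<And>g. g \<in> carrier P \<Longrightarrow> \<theta> g = \<one>\<^bsub>H\<^esub> \<Longrightarrow> \<chi>x g = 0 \<and> \<chi>y g = 0"
    and exp: "\<And>g. g \<in> carrier P \<Longrightarrow> \<theta> g [^]\<^bsub>H\<^esub> N = \<one>\<^bsub>H\<^esub>"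
    and xy: "x \<in> carrier P" "y \<in> carrier P" "generate P {x, y} = carrier P"
    and vals: "\<chi>x x = 1" "\<chi>y x = 0" "\<chi>x y = 0" "\<chi>y y = 1"
  shows "beauville_group H"
proof -
  interpret group_hom P H \<theta> by (rule \<theta>)
  define u where "u = x \<otimes>\<^bsub>P\<^esub> inv\<^bsub>P\<^esub> y"
  define v where "v = x \<otimes>\<^bsub>P\<^esub> (y [^]\<^bsub>P\<^esub> (2::nat))"
  define T where "T a b = (\<theta> a, \<theta> b, \<theta> (inv\<^bsub>P\<^esub> (a \<otimes>\<^bsub>P\<^esub> b)))" for a b
  have uv: "u \<in> carrier P" "v \<in> carrier P" using xy by (auto simp: u_def v_def)
  have N2: "coprime (2::int) (int N)" and N3: "coprime 3 N"
  proof -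
    have "coprime (2 * 3) N" using N(2) by simp
    then have "coprime 2 N" "coprime 3 N" by (simp_all only: coprime_mult_left_iff)
    then show "coprime (2::int) (int N)" "coprime 3 N"
      using coprime_int_iff[of 2 N] by simp_all
  qed
  have gxy: "generate H {\<theta> x, \<theta> y} = carrier H"
    using generate_img[of "{x, y}"] xy surj by simp
  have gen: "spherical_triple H (T a b)"
    if ab: "a \<in> carrier P" "b \<in> carrier P" and
       g: "\<theta> x \<in> generate H {\<theta> a, \<theta> b}" "\<theta> y \<in> generate H {\<theta> a, \<theta> b}" for a b
  proof -
    let ?S = "{\<theta> a, \<theta> b, \<theta> (inv\<^bsub>P\<^esub> (a \<otimes>\<^bsub>P\<^esub> b))}"
    have S: "?S \<subseteq> carrier H" using ab by auto
    have "generate H {\<theta> a, \<theta> b} \<subseteq> generate H ?S" by (rule H.mono_generate) auto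
    then have "generate H {\<theta> x, \<theta> y} \<subseteq> generate H ?S"
      using g by (intro H.generate_subgroup_incl H.generate_is_subgroup S) auto
    then have "generate H ?S = carrier H" using gxy H.generate_incl[OF S] by auto
    moreover have "\<theta> a \<otimes>\<^bsub>H\<^esub> \<theta> b \<otimes>\<^bsub>H\<^esub> \<theta> (inv\<^bsub>P\<^esub> (a \<otimes>\<^bsub>P\<^esub> b)) = \<one>\<^bsub>H\<^esub>"
      using ab by (simp add: H.r_inv flip: hom_mult)
    ultimately show ?thesis using S by (simp add: spherical_triple_def T_def)
  qed
  have s1: "spherical_triple H (T x y)"
    by (rule gen) (use xy in \<open>auto intro: generate.incl\<close>)
  have s2: "spherical_triple H (T u v)"
  proof (rule gen)
    let ?S = "{\<theta> u, \<theta> v}"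
    have S: "?S \<subseteq> carrier H" using uv by auto
    have sg: "subgroup (generate H ?S) H" by (rule H.generate_is_subgroup[OF S])
    have "inv\<^bsub>P\<^esub> u \<otimes>\<^bsub>P\<^esub> v = y [^]\<^bsub>P\<^esub> (3::nat)"
    proof -
      have "inv\<^bsub>P\<^esub> u \<otimes>\<^bsub>P\<^esub> v = y \<otimes>\<^bsub>P\<^esub> inv\<^bsub>P\<^esub> x \<otimes>\<^bsub>P\<^esub> (x \<otimes>\<^bsub>P\<^esub> (y [^]\<^bsub>P\<^esub> (2::nat)))"
        using xy by (simp add: u_def v_def G.inv_mult_group)
      also have "\<dots> = y \<otimes>\<^bsub>P\<^esub> (y [^]\<^bsub>P\<^esub> (2::nat))"
        using xy G.m_assoc[of "inv\<^bsub>P\<^esub> x" x "y [^]\<^bsub>P\<^esub> (2::nat)"] by (simp add: G.m_assoc)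
      also have "\<dots> = y [^]\<^bsub>P\<^esub> (3::nat)"
        using xy G.nat_pow_Suc2[of y 2] by (simp add: numeral_3_eq_3 numeral_2_eq_2)
      finally show ?thesis .
    qed
    then have "inv\<^bsub>H\<^esub> \<theta> u \<otimes>\<^bsub>H\<^esub> \<theta> v = \<theta> y [^]\<^bsub>H\<^esub> (3::nat)"
      using uv xy by (simp flip: hom_inv hom_mult hom_nat_pow)
    then have y3: "\<theta> y [^]\<^bsub>H\<^esub> (3::nat) \<in> generate H ?S"
      using generate.eng[OF generate.inv[of "\<theta> u" ?S H] generate.incl[of "\<theta> v" ?S H]] by simp
    obtain k where k: "[3 * k = 1] (mod N)"
      using cong_solve_coprime_nat[OF N3] by auto
    have ex: "\<exists>m. 3 * k = 1 + m * N"
      using k N by (simp only: cong_to_1'_nat) auto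
    then obtain m where m: "3 * k = 1 + m * N" by blast
    have "(\<theta> y [^]\<^bsub>H\<^esub> (3::nat)) [^]\<^bsub>H\<^esub> k = \<theta> y [^]\<^bsub>H\<^esub> (1 + m * N)"
      using xy by (simp add: H.nat_pow_pow m)
    also have "\<dots> = \<theta> y \<otimes>\<^bsub>H\<^esub> (\<theta> y [^]\<^bsub>H\<^esub> N) [^]\<^bsub>H\<^esub> m"
      using xy H.nat_pow_mult[of "\<theta> y" 1 "m * N"] by (simp add: H.nat_pow_pow mult.commute)
    also have "\<dots> = \<theta> y" using exp[OF xy(2)] xy by simp
    finally have "\<theta> y = (\<theta> y [^]\<^bsub>H\<^esub> (3::nat)) [^]\<^bsub>H\<^esub> int k" by (simp add: int_pow_int)
    then show yS: "\<theta> y \<in> generate H ?S"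
      using H.subgroup_int_pow_closed[OF sg y3, of "int k"] by simp
    have "x = u \<otimes>\<^bsub>P\<^esub> y" using xy by (simp add: u_def G.m_assoc)
    then have "\<theta> x = \<theta> u \<otimes>\<^bsub>H\<^esub> \<theta> y" using uv xy by simp
    then show "\<theta> x \<in> generate H ?S" using yS by (simp add: generate.eng generate.incl)
  qed (use uv in auto)
  have c1: "group_hom P (integer_mod_group N) \<chi>x" and c2: "group_hom P (integer_mod_group N) \<chi>y"
    using \<chi>x \<chi>y by (simp_all add: group_hom_def group_hom_axioms_def)
  interpret c1: group_hom P "integer_mod_group N" \<chi>x by (rule c1)
  interpret c2: group_hom P "integer_mod_group N" \<chi>y by (rule c2)
  have iv1: "\<chi>x (inv\<^bsub>P\<^esub> w) = (- \<chi>x w) mod int N" if "w \<in> carrier P" for w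
    using that c1.hom_closed[OF that] by (simp add: c1.hom_inv)
  have iv2: "\<chi>y (inv\<^bsub>P\<^esub> w) = (- \<chi>y w) mod int N" if "w \<in> carrier P" for w
    using that c2.hom_closed[OF that] by (simp add: c2.hom_inv)
  \<comment> \<open>The integers listed with an element are the coordinates of its direction modulo \<open>N\<close>.\<close>
  have cop: "coprime (\<chi>x a * \<chi>y b - \<chi>y a * \<chi>x b) (int N)"
    if a: "(a, a1, a2) \<in> {(x, 1, 0), (y, 0, 1), (inv\<^bsub>P\<^esub> (x \<otimes>\<^bsub>P\<^esub> y), -1, -1)}"
     and b: "(b, b1, b2) \<in> {(u, 1, -1), (v, 1, 2), (inv\<^bsub>P\<^esub> (u \<otimes>\<^bsub>P\<^esub> v), -2, -1)}" for a b and a1 a2 b1 b2 :: int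
  proof -
    have ra: "\<chi>x a mod int N = a1 mod int N \<and> \<chi>y a mod int N = a2 mod int N"
      using a xy vals N by (auto simp: iv1 iv2 mod_simps simp del: c1.hom_inv c2.hom_inv)
    have 2: "\<chi>x u mod int N = 1 mod int N" "\<chi>y u mod int N = (-1) mod int N"
         "\<chi>x v mod int N = 1 mod int N" "\<chi>y v mod int N = 2 mod int N"
      using xy vals by (auto simp: u_def v_def iv1 iv2 mod_simps simp del: c1.hom_inv c2.hom_inv simp: c1.hom_nat_pow c2.hom_nat_pow)
    have 3: "(- (\<chi>x u + \<chi>x v)) mod int N = (-2) mod int N" "(- (\<chi>y u + \<chi>y v)) mod int N = (-1) mod int N"
      using mod_minus_cong[OF mod_add_cong[OF 2(1) 2(3)]] mod_minus_cong[OF mod_add_cong[OF 2(2) 2(4)]] by simp_all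
    have rb: "\<chi>x b mod int N = b1 mod int N \<and> \<chi>y b mod int N = b2 mod int N"
      using b uv 2 3 by (auto simp: iv1 iv2 mod_simps simp del: c1.hom_inv c2.hom_inv)
    have "(\<chi>x a * \<chi>y b - \<chi>y a * \<chi>x b) mod int N = (a1 * b2 - a2 * b1) mod int N"
      using ra rb by (intro mod_diff_cong mod_mult_cong) auto
    moreover have "a1 * b2 - a2 * b1 \<in> {1, -1, 2, -2}" using a b by auto
    then have "coprime (a1 * b2 - a2 * b1) (int N)" using N2 by auto
    ultimately show ?thesis by (metis coprime_mod_left_iff N(1) of_nat_0_eq_iff not_one_less_zero)
  qed
  have "beauville_structure H (T x y) (T u v)"
    unfolding beauville_structure_def
  proof (intro conjI ballI)
    fix t1 t2 h assume t: "t1 \<in> triple_components (T x y)" "t2 \<in> triple_components (T u v)" and h: "h \<in> carrier H"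
    obtain a a1 a2 where a: "t1 = \<theta> a" "a \<in> carrier P"
      "(a, a1 :: int, a2 :: int) \<in> {(x, 1, 0), (y, 0, 1), (inv\<^bsub>P\<^esub> (x \<otimes>\<^bsub>P\<^esub> y), -1, -1)}"
    proof -
      have "t1 = \<theta> x \<or> t1 = \<theta> y \<or> t1 = \<theta> (inv\<^bsub>P\<^esub> (x \<otimes>\<^bsub>P\<^esub> y))"
        using t(1) unfolding triple_components_def T_def by blast
      then show thesis
        using that[of x 1 0] that[of y 0 1] that[of "inv\<^bsub>P\<^esub> (x \<otimes>\<^bsub>P\<^esub> y)" "-1" "-1"] xy by blast
    qed
    obtain b b1 b2 where b: "t2 = \<theta> b" "b \<in> carrier P"
      "(b, b1 :: int, b2 :: int) \<in> {(u, 1, -1), (v, 1, 2), (inv\<^bsub>P\<^esub> (u \<otimes>\<^bsub>P\<^esub> v), -2, -1)}"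
    proof -
      have "t2 = \<theta> u \<or> t2 = \<theta> v \<or> t2 = \<theta> (inv\<^bsub>P\<^esub> (u \<otimes>\<^bsub>P\<^esub> v))"
        using t(2) unfolding triple_components_def T_def by blast
      then show thesis
        using that[of u 1 "-1"] that[of v 1 2] that[of "inv\<^bsub>P\<^esub> (u \<otimes>\<^bsub>P\<^esub> v)" "-2" "-1"] uv by blast
    qed
    show "conjugate_set H (generate H {t1}) h \<inter> generate H {t2} = {\<one>\<^bsub>H\<^esub>}"
      unfolding a(1) b(1)
      by (rule beauville_disjoint[OF \<theta> surj _ \<chi>x \<chi>y ker exp a(2) b(2) cop[OF a(3) b(3)] h]) (use N in auto)
  qed (use s1 s2 in auto)
  then show ?thesis unfolding beauville_group_def using H.is_group fin by blast
qed

text \<open>If \<open>p\<close> does not divide \<open>\<chi> g\<close>, then \<open>w [^] \<chi> g\<close> generates the group of order \<open>p\<close> generated by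
  \<open>w\<close>, so \<open>w\<close> is a power of \<open>\<theta> g\<close>.  The components of a generating triple cannot all lie in the
  image of the proper subgroup on which \<open>p\<close> divides \<open>\<chi>\<close>.  Hence every spherical triple has a
  component whose powers include \<open>w\<close>, and two triples always meet in \<open>w\<close>.\<close>

lemma not_beauville_criterion:
  fixes P :: "('a, 'b) monoid_scheme" and H :: "('c, 'd) monoid_scheme" and N :: nat
  assumes \<theta>: "group_hom P H \<theta>" and surj: "\<theta> ` carrier P = carrier H"
    and p: "Factorial_Ring.prime p" "p dvd l"
    and \<chi>: "\<chi> \<in> hom P (integer_mod_group l)" and x: "x \<in> carrier P" "\<chi> x = 1"
    and w: "w \<in> carrier H" "w \<noteq> \<one>\<^bsub>H\<^esub>" "w [^]\<^bsub>H\<^esub> p = \<one>\<^bsub>H\<^esub>"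
    and pow: "\<And>g. g \<in> carrier P \<Longrightarrow> \<theta> g [^]\<^bsub>H\<^esub> N = w [^]\<^bsub>H\<^esub> \<chi> g"
  shows "\<not> beauville_group H"
proof
  interpret group_hom P H \<theta> by (rule \<theta>)
  interpret c: group_hom P "integer_mod_group l" \<chi>
    using \<chi> by (simp add: group_hom_def group_hom_axioms_def)
  have wk: "w [^]\<^bsub>H\<^esub> k = \<one>\<^bsub>H\<^esub>" if k: "int p dvd k" for k
  proof -
    obtain m where "k = int p * m" using k by (auto elim: dvdE)
    then have "w [^]\<^bsub>H\<^esub> k = (w [^]\<^bsub>H\<^esub> int p) [^]\<^bsub>H\<^esub> m" using w by (simp add: H.int_pow_pow mult.commute)
    then show ?thesis using w by (simp add: int_pow_int)
  qed
  have pM: "int p dvd int l" using p by (simp only: int_dvd_int_iff)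
  have in_gen: "w \<in> generate H {\<theta> g}" if g: "g \<in> carrier P" "\<not> int p dvd \<chi> g" for g
  proof -
    have pp: "Factorial_Ring.prime (int p)" using p by simp
    have "coprime (\<chi> g) (int p)" using prime_imp_coprime[OF pp g(2)] by (simp add: coprime_commute)
    then obtain s where "[\<chi> g * s = 1] (mod int p)"
      using cong_solve_coprime_int by blast
    then have "int p dvd \<chi> g * s - 1" by (simp add: cong_iff_dvd_diff)
    then have "w [^]\<^bsub>H\<^esub> (\<chi> g * s - 1) = \<one>\<^bsub>H\<^esub>" by (rule wk)
    then have "w [^]\<^bsub>H\<^esub> (\<chi> g * s) = w"
      using w H.int_pow_mult[of w "\<chi> g * s - 1" 1] by simp
    then have "w = (w [^]\<^bsub>H\<^esub> \<chi> g) [^]\<^bsub>H\<^esub> s" using w by (simp add: H.int_pow_pow)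
    also have "\<dots> = \<theta> g [^]\<^bsub>H\<^esub> (int N * s)"
      using pow[OF g(1)] g by (simp add: int_pow_int flip: H.int_pow_pow)
    finally show ?thesis using g H.generate_pow[of "\<theta> g"] by auto
  qed
  have ex: "\<exists>t \<in> triple_components T. w \<in> generate H {t}" if T: "spherical_triple H T" for T
  proof (rule ccontr)
    assume neg: "\<not> ?thesis"
    define S where "S = \<theta> ` {g \<in> carrier P. int p dvd \<chi> g}"
    have sub: "subgroup {g \<in> carrier P. int p dvd \<chi> g} P"
    proof (rule G.subgroupI)
      fix a assume a: "a \<in> {g \<in> carrier P. int p dvd \<chi> g}"
      then have "\<chi> (inv\<^bsub>P\<^esub> a) = (- \<chi> a) mod int l"
        using c.hom_closed[of a] by (simp add: c.hom_inv)
      then show "inv\<^bsub>P\<^esub> a \<in> {g \<in> carrier P. int p dvd \<chi> g}"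
        using a pM by (simp add: dvd_mod_iff)
    next
      fix a b assume "a \<in> {g \<in> carrier P. int p dvd \<chi> g}" "b \<in> {g \<in> carrier P. int p dvd \<chi> g}"
      then show "a \<otimes>\<^bsub>P\<^esub> b \<in> {g \<in> carrier P. int p dvd \<chi> g}"
        using pM by (simp add: dvd_mod_iff)
    next
      have "\<one>\<^bsub>P\<^esub> \<in> {g \<in> carrier P. int p dvd \<chi> g}" using c.hom_one by simp
      then show "{g \<in> carrier P. int p dvd \<chi> g} \<noteq> {}" by blast
    qed auto
    have sS: "subgroup S H" unfolding S_def by (rule subgroup_img_is_subgroup[OF sub])
    have "triple_components T \<subseteq> S"
    proof
      fix t assume t: "t \<in> triple_components T"
      then have "t \<in> carrier H" using T by (auto simp: triple_components_def spherical_triple_def split: prod.splits)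
      then obtain g where g: "g \<in> carrier P" "t = \<theta> g" using surj by blast
      then have "int p dvd \<chi> g" using neg in_gen t by blast
      then show "t \<in> S" using g by (auto simp: S_def)
    qed
    then have "generate H (triple_components T) \<subseteq> S" by (rule H.generate_subgroup_incl[OF _ sS])
    moreover have "generate H (triple_components T) = carrier H"
      using T by (auto simp: triple_components_def spherical_triple_def split: prod.splits)
    ultimately have "\<theta> x \<in> S" using x by auto
    then obtain g where g: "g \<in> carrier P" "int p dvd \<chi> g" "\<theta> x = \<theta> g" by (auto simp: S_def)
    have "w [^]\<^bsub>H\<^esub> \<chi> x = w [^]\<^bsub>H\<^esub> \<chi> g" using pow[OF x(1)] pow[OF g(1)] g(3) by simp
    then show False using wk[OF g(2)] x w by simp
  qed
  assume "beauville_group H"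
  then obtain T1 T2 where B: "beauville_structure H T1 T2" by (auto simp: beauville_group_def)
  then obtain t1 t2 where t: "t1 \<in> triple_components T1" "t2 \<in> triple_components T2"
      "w \<in> generate H {t1}" "w \<in> generate H {t2}"
    using ex[of T1] ex[of T2] by (auto simp: beauville_structure_def)
  have "conjugate_set H (generate H {t1}) \<one>\<^bsub>H\<^esub> \<inter> generate H {t2} = {\<one>\<^bsub>H\<^esub>}"
    using B t unfolding beauville_structure_def by blast
  moreover have "w \<in> conjugate_set H (generate H {t1}) \<one>\<^bsub>H\<^esub>"
    using t(3) w by (auto simp: conjugate_set_def intro!: rev_image_eqI[of w])
  ultimately show False using t w by blast
qed

section \<open>Noncommutative series and shuffles\<close>

text \<open>A function on words is the coefficient function of a power series in noncommuting variables, and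
  \<open>conv\<close> is the product of such series.  Coefficients are integers; identities over the field with
  \<open>p\<close> elements are stated as congruences.\<close>

fun conv :: "('a list \<Rightarrow> int) \<Rightarrow> ('a list \<Rightarrow> int) \<Rightarrow> 'a list \<Rightarrow> int" where
  "conv F G [] = F [] * G []"
| "conv F G (a # w) = F [] * G (a # w) + conv (\<lambda>v. F (a # v)) G w"

lemma conv_eq_sum: "conv F G w = (\<Sum>i\<le>length w. F (take i w) * G (drop i w))"
  by (induction w arbitrary: F) (simp_all add: sum.atMost_Suc_shift del: sum.atMost_Suc)

lemma conv_add_left: "conv (\<lambda>v. F v + F' v) G w = conv F G w + conv F' G w"
  by (simp add: conv_eq_sum sum.distrib algebra_simps)

lemma conv_scale_left: "conv (\<lambda>v. k * F v) G w = k * conv F G w"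
  by (simp add: conv_eq_sum sum_distrib_left algebra_simps)

lemma conv_assoc: "conv (conv F G) H w = conv F (conv G H) w"
proof (induction w arbitrary: F)
  case (Cons a w)
  have "conv (\<lambda>v. conv F G (a # v)) H w
      = F [] * conv (\<lambda>v. G (a # v)) H w + conv (conv (\<lambda>v. F (a # v)) G) H w"
    by (simp add: conv_add_left conv_scale_left)
  then show ?case using Cons.IH[of "\<lambda>v. F (a # v)"] by (simp add: algebra_simps)
qed simp

definition unit_word :: "'a list \<Rightarrow> int" where
  "unit_word w = (if w = [] then 1 else 0)"

lemma conv_unit_left: "conv unit_word G w = G w"
proof -
  have 0: "conv (\<lambda>v. 0) G w = 0" for w :: "'a list" by (simp add: conv_eq_sum)
  then show ?thesis by (cases w) (simp_all add: unit_word_def)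
qed

lemma conv_unit_right: "conv F unit_word w = F w"
  by (induction w arbitrary: F) (simp_all add: unit_word_def)

lemma conv_cong_mod:
  assumes "\<And>u v. u @ v = w \<Longrightarrow> [F u = F' u] (mod m) \<and> [G v = G' v] (mod m)"
  shows "[conv F G w = conv F' G' w] (mod m)"
  unfolding conv_eq_sum using assms[of "take i w" "drop i w" for i]
  by (intro cong_sum cong_mult) auto

lemma conv_map: "conv F G (map s w) = conv (\<lambda>v. F (map s v)) (\<lambda>v. G (map s v)) w"
  by (simp add: conv_eq_sum take_map drop_map)

text \<open>Only a right inverse is needed to obtain a group.\<close>

function conv_inv :: "('a list \<Rightarrow> int) \<Rightarrow> 'a list \<Rightarrow> int" where
  "conv_inv F [] = 1"
| "conv_inv F (a # w) = - (\<Sum>i\<le>length w. F (a # take i w) * conv_inv F (drop i w))"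
  by pat_completeness auto
termination by (relation "measure (\<lambda>(F, w). length w)") auto

lemma conv_conv_inv: "F [] = 1 \<Longrightarrow> conv F (conv_inv F) w = unit_word w"
  by (cases w) (simp_all add: unit_word_def, simp add: conv_eq_sum)

text \<open>The sum of \<open>g\<close> over all shuffles of the two words, that is, the value of \<open>g\<close> on their shuffle
  product.\<close>

fun shsum :: "('a list \<Rightarrow> int) \<Rightarrow> 'a list \<Rightarrow> 'a list \<Rightarrow> int" where
  "shsum g [] v = g v"
| "shsum g (a # u) [] = g (a # u)"
| "shsum g (a # u) (b # v) = shsum (\<lambda>w. g (a # w)) u (b # v) + shsum (\<lambda>w. g (b # w)) (a # u) v"

lemma shsum_Nil2 [simp]: "shsum g u [] = g u"
  by (cases u) auto

lemma shsum_add: "shsum (\<lambda>w. g w + h w) u v = shsum g u v + shsum h u v"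
  by (induction g u v arbitrary: h rule: shsum.induct) simp_all

lemma shsum_scale: "shsum (\<lambda>w. k * g w) u v = k * shsum g u v"
  by (induction g u v rule: shsum.induct) (simp_all add: algebra_simps)

lemma shsum_zero: "shsum (\<lambda>_. 0) u v = 0"
  by (induction "\<lambda>_ :: 'a list. 0 :: int" u v rule: shsum.induct) simp_all

lemma shsum_cong_mod:
  assumes "\<And>w. mset w = mset (u @ v) \<Longrightarrow> [g w = h w] (mod m)"
  shows "[shsum g u v = shsum h u v] (mod m)"
  using assms
proof (induction g u v arbitrary: h rule: shsum.induct)
  case (3 g a u b v)
  have "[shsum (\<lambda>w. g (a # w)) u (b # v) = shsum (\<lambda>w. h (a # w)) u (b # v)] (mod m)"
    by (rule 3(1)) (auto intro!: 3(3))
  moreover have "[shsum (\<lambda>w. g (b # w)) (a # u) v = shsum (\<lambda>w. h (b # w)) (a # u) v] (mod m)"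
    by (rule 3(2)) (auto intro!: 3(3))
  ultimately show ?case by (simp add: cong_add)
qed auto

lemma shsum_map: "shsum g (map s u) (map s v) = shsum (\<lambda>w. g (map s w)) u v"
  by (induction "\<lambda>w. g (map s w)" u v arbitrary: g rule: shsum.induct) simp_all

text \<open>The compatibility of the shuffle product with the splitting of words (the bialgebra axiom): to cut
  a shuffle of \<open>u\<close> and \<open>v\<close> at some place means to cut \<open>u\<close> and \<open>v\<close> and to shuffle the front parts
  and the rear parts separately.  This is why products of group-like series are group-like.\<close>

lemma shsum_conv:
  "shsum (conv g h) u v = (\<Sum>i\<le>length u. \<Sum>j\<le>length v.
     shsum g (take i u) (take j v) * shsum h (drop i u) (drop j v))"
proof (induction g u v rule: shsum.induct)
  case (1 g v)
  then show ?case by (simp add: conv_eq_sum)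
next
  case (2 g a u)
  then show ?case by (simp add: conv_eq_sum del: conv.simps sum.atMost_Suc)
next
  case (3 g a u b v)
  let ?ga = "\<lambda>w. g (a # w)" and ?gb = "\<lambda>w. g (b # w)"
  let ?n = "length u" and ?m = "length v"
  have "shsum (conv g h) (a # u) (b # v)
      = shsum (\<lambda>w. g [] * h (a # w) + conv ?ga h w) u (b # v)
        + shsum (\<lambda>w. g [] * h (b # w) + conv ?gb h w) (a # u) v"
    by simp
  also have "\<dots> = g [] * shsum h (a # u) (b # v) + shsum (conv ?ga h) u (b # v) + shsum (conv ?gb h) (a # u) v"
    by (simp add: shsum_add shsum_scale algebra_simps)
  also have "shsum (conv ?ga h) u (b # v)
     = (\<Sum>i\<le>?n. ?ga (take i u) * shsum h (drop i u) (b # v))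
     + (\<Sum>i\<le>?n. \<Sum>j\<le>?m. shsum ?ga (take i u) (b # take j v) * shsum h (drop i u) (drop j v))"
    by (simp add: 3(1) sum.atMost_Suc_shift sum.distrib del: sum.atMost_Suc)
  also have "shsum (conv ?gb h) (a # u) v
     = (\<Sum>j\<le>?m. ?gb (take j v) * shsum h (a # u) (drop j v))
     + (\<Sum>i\<le>?n. \<Sum>j\<le>?m. shsum ?gb (a # take i u) (take j v) * shsum h (drop i u) (drop j v))"
    by (simp add: 3(2) sum.atMost_Suc_shift del: sum.atMost_Suc)
  also have "g [] * shsum h (a # u) (b # v)
     + ((\<Sum>i\<le>?n. ?ga (take i u) * shsum h (drop i u) (b # v))
     + (\<Sum>i\<le>?n. \<Sum>j\<le>?m. shsum ?ga (take i u) (b # take j v) * shsum h (drop i u) (drop j v)))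
     + ((\<Sum>j\<le>?m. ?gb (take j v) * shsum h (a # u) (drop j v))
     + (\<Sum>i\<le>?n. \<Sum>j\<le>?m. shsum ?gb (a # take i u) (take j v) * shsum h (drop i u) (drop j v)))
     = (\<Sum>i\<le>length (a # u). \<Sum>j\<le>length (b # v).
         shsum g (take i (a # u)) (take j (b # v)) * shsum h (drop i (a # u)) (drop j (b # v)))"
    by (simp add: sum.atMost_Suc_shift sum.distrib algebra_simps del: sum.atMost_Suc)
  finally show ?case .
qed

text \<open>Among the shuffles of \<open>u\<close> and \<open>z # v\<close> the word \<open>u @ z # v\<close> is the only one in which all of \<open>u\<close>
  comes before \<open>z\<close>.  The other terms are controlled by the values of \<open>g\<close> at words in which \<open>z\<close>
  stands further left.\<close>

lemma shsum_last_letter: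
  assumes "\<And>x y. length x < length u \<Longrightarrow> mset (x @ z # y) = mset (u @ z # v) \<Longrightarrow> [g (x @ z # y) = h (x @ z # y)] (mod m)"
  shows "[shsum g u (z # v) - g (u @ z # v) = shsum h u (z # v) - h (u @ z # v)] (mod m)"
  using assms
proof (induction u arbitrary: g h)
  case (Cons a u)
  have "[shsum (\<lambda>w. g (a # w)) u (z # v) - g (a # u @ z # v) = shsum (\<lambda>w. h (a # w)) u (z # v) - h (a # u @ z # v)] (mod m)"
  proof (rule Cons.IH)
    fix x y assume "length x < length u" "mset (x @ z # y) = mset (u @ z # v)"
    then show "[g (a # x @ z # y) = h (a # x @ z # y)] (mod m)"
      using Cons.prems[of "a # x" y] by simp
  qed
  moreover have "[shsum (\<lambda>w. g (z # w)) (a # u) v = shsum (\<lambda>w. h (z # w)) (a # u) v] (mod m)"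
  proof (rule shsum_cong_mod)
    fix w assume "mset w = mset ((a # u) @ v)"
    then show "[g (z # w) = h (z # w)] (mod m)" using Cons.prems[of "[]" w] by simp
  qed
  ultimately show ?case by (auto dest: cong_add simp: algebra_simps)
qed simp

section \<open>Units of a truncated word algebra, extended by rotations\<close>

lemma group_if_right_inverses:
  assumes "monoid G" and r: "\<And>x. x \<in> carrier G \<Longrightarrow> \<exists>y \<in> carrier G. x \<otimes>\<^bsub>G\<^esub> y = \<one>\<^bsub>G\<^esub>"
  shows "group G"
proof -
  interpret monoid G by fact
  show ?thesis
  proof (rule groupI)
    fix x assume x: "x \<in> carrier G"
    obtain y where y: "y \<in> carrier G" "x \<otimes>\<^bsub>G\<^esub> y = \<one>\<^bsub>G\<^esub>" using r[OF x] by blast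
    obtain z where z: "z \<in> carrier G" "y \<otimes>\<^bsub>G\<^esub> z = \<one>\<^bsub>G\<^esub>" using r[OF y(1)] by blast
    have "x = x \<otimes>\<^bsub>G\<^esub> (y \<otimes>\<^bsub>G\<^esub> z)" using x z by simp
    also have "\<dots> = z" using x y z m_assoc[of x y z] by simp
    finally show "\<exists>y \<in> carrier G. y \<otimes>\<^bsub>G\<^esub> x = \<one>\<^bsub>G\<^esub>" using y z by auto
  qed (auto simp: m_assoc)
qed

text \<open>Since \<open>W\<close> is closed under factors, the words outside \<open>W\<close> span an ideal of the free algebra, and the
  quotient has \<open>W\<close> as a basis.  Adding a constant to all letters is an action of the integers
  modulo \<open>q\<close> on this quotient.\<close>

locale word_algebra =
  fixes p q :: nat and W :: "nat list set"
  assumes p: "p > 1" and q: "q > 0" and finW: "finite W" and NilW: "[] \<in> W"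
    and factor: "u @ v \<in> W \<Longrightarrow> u \<in> W \<and> v \<in> W"
    and letters: "w \<in> W \<Longrightarrow> set w \<subseteq> {..<q}"
    and shiftW: "w \<in> W \<Longrightarrow> map (\<lambda>i. (i + k) mod q) w \<in> W"
begin

definition shift :: "nat \<Rightarrow> nat list \<Rightarrow> nat list" where
  "shift k w = map (\<lambda>i. (i + k) mod q) w"

definition twist :: "nat \<Rightarrow> (nat list \<Rightarrow> int) \<Rightarrow> nat list \<Rightarrow> int" where
  "twist k F w = F (shift k w)"

text \<open>The canonical representative of a class of the quotient algebra modulo \<open>p\<close>, so that equality of
  classes becomes equality of functions.\<close>

definition red :: "(nat list \<Rightarrow> int) \<Rightarrow> nat list \<Rightarrow> int" where
  "red F w = (if w \<in> W then F w mod int p else 0)"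

definition units :: "(nat list \<Rightarrow> int) set" where
  "units = {F. red F = F \<and> F [] = 1}"

text \<open>The semidirect product of the rotation group with the units of constant term \<open>1\<close>.\<close>

definition core :: "(nat \<times> (nat list \<Rightarrow> int)) monoid" where
  "core = \<lparr>carrier = {..<q} \<times> units,
     monoid.mult = (\<lambda>(k, F) (l, G). ((k + l) mod q, red (conv (twist l F) G))),
     one = (0, unit_word)\<rparr>"

lemma shift_Nil [simp]: "shift k [] = []" and shift_Cons [simp]: "shift k (a # w) = (a + k) mod q # shift k w"
  and shift_append: "shift k (u @ v) = shift k u @ shift k v" and length_shift [simp]: "length (shift k w) = length w"
  by (simp_all add: shift_def)

lemma shift_in_W: "w \<in> W \<Longrightarrow> shift k w \<in> W"
  unfolding shift_def by (rule shiftW)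

lemma shift_shift: "shift k (shift l w) = shift (k + l) w"
  by (simp add: shift_def mod_simps ac_simps)

lemma shift_mod: "shift (k mod q) w = shift k w"
  by (simp add: shift_def mod_simps)

lemma shift_0: "set w \<subseteq> {..<q} \<Longrightarrow> shift 0 w = w"
  by (auto simp: shift_def intro!: map_idI)

lemma twist_twist: "twist k (twist l F) = twist (l + k) F"
  by (simp add: twist_def fun_eq_iff shift_shift)

lemma twist_mod: "twist (k mod q) F = twist k F"
  by (simp add: twist_def shift_mod fun_eq_iff)

lemma twist_conv: "twist k (conv F G) = conv (twist k F) (twist k G)"
  by (simp add: twist_def[abs_def] shift_def conv_map fun_eq_iff)

lemma twist_Nil [simp]: "twist k F [] = F []" by (simp add: twist_def)

lemma twist_unit_word [simp]: "twist k unit_word = unit_word"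
  by (simp add: twist_def unit_word_def shift_def fun_eq_iff)

lemma red_cong: "(\<And>w. w \<in> W \<Longrightarrow> [F w = G w] (mod int p)) \<Longrightarrow> red F = red G"
  by (auto simp: red_def fun_eq_iff cong_def)

lemma red_mod: "w \<in> W \<Longrightarrow> [red F w = F w] (mod int p)"
  by (simp add: red_def)

lemma red_red [simp]: "red (red F) = red F" by (simp add: red_def fun_eq_iff)

lemma red_conv_left: "red (conv (red F) G) = red (conv F G)"
proof (rule red_cong, rule conv_cong_mod)
  fix w u v assume "w \<in> W" "u @ v = w"
  then have "u \<in> W" "v \<in> W" using factor[of u v] by simp_all
  then show "[red F u = F u] (mod int p) \<and> [G v = G v] (mod int p)" using red_mod by simp
qed

lemma red_conv_right: "red (conv F (red G)) = red (conv F G)"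
proof (rule red_cong, rule conv_cong_mod)
  fix w u v assume "w \<in> W" "u @ v = w"
  then have "u \<in> W" "v \<in> W" using factor[of u v] by simp_all
  then show "[F u = F u] (mod int p) \<and> [red G v = G v] (mod int p)" using red_mod by simp
qed

lemma red_twist: "red (twist k (red F)) = red (twist k F)"
  by (rule red_cong) (simp add: twist_def red_mod shift_in_W)

lemma red_unit_word [simp]: "red unit_word = unit_word"
  using p NilW by (auto simp: red_def unit_word_def fun_eq_iff)

lemma red_in_units: "F [] = 1 \<Longrightarrow> red F \<in> units"
  using p NilW by (simp add: units_def) (simp add: red_def)

lemma units_twist_0: "F \<in> units \<Longrightarrow> red (twist 0 F) = F"
proof -
  assume "F \<in> units"
  then have "red F = F" by (simp add: units_def)
  moreover have "red (twist 0 F) = red F"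
    by (rule red_cong) (simp add: twist_def shift_0 letters)
  ultimately show ?thesis by simp
qed

lemma core_simps [simp]: "carrier core = {..<q} \<times> units" "\<one>\<^bsub>core\<^esub> = (0, unit_word)"
  "(k, F) \<otimes>\<^bsub>core\<^esub> (l, G) = ((k + l) mod q, red (conv (twist l F) G))"
  by (simp_all add: core_def)

lemma group_core: "group core"
proof (rule group_if_right_inverses)
  have cul: "conv unit_word G = G" and cur: "conv F unit_word = F" for F G :: "nat list \<Rightarrow> int"
    by (simp_all add: fun_eq_iff conv_unit_left conv_unit_right)
  show "monoid core"
  proof (rule monoidI, goal_cases)
    case (1 x y)
    obtain k F l G where e: "x = (k, F)" "y = (l, G)" by (metis prod.exhaust)
    have "red (conv (twist l F) G) \<in> units"
      using 1 by (intro red_in_units) (simp add: e units_def)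
    then show ?case using q by (simp add: e)
  next
    case 2
    then show ?case using q red_in_units[of unit_word] by (simp add: unit_word_def)
  next
    case (3 x y z)
    obtain k F l G m H where e: "x = (k, F)" "y = (l, G)" "z = (m, H)" by (metis prod.exhaust)
    have "red (conv (twist m (red (conv (twist l F) G))) H)
        = red (conv (red (twist m (red (conv (twist l F) G)))) H)"
      by (simp only: red_conv_left)
    also have "\<dots> = red (conv (conv (twist (l + m) F) (twist m G)) H)"
      by (simp only: red_conv_left red_twist twist_conv twist_twist)
    also have "conv (conv (twist (l + m) F) (twist m G)) H = conv (twist (l + m) F) (conv (twist m G) H)"
      by (simp add: fun_eq_iff conv_assoc)
    finally show ?case by (simp add: e red_conv_right twist_mod mod_simps add.assoc)
  next
    case (4 x)
    then show ?case by (cases x) (auto simp: cul units_def)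
  next
    case (5 x)
    then show ?case by (cases x) (auto simp: cur units_twist_0)
  qed
next
  fix x assume x: "x \<in> carrier core"
  obtain k F where e: "x = (k, F)" by (metis prod.exhaust)
  define l where "l = (q - k) mod q"
  have l: "(k + l) mod q = 0" "l < q" using x q e by (auto simp: l_def mod_simps)
  have 1: "twist l F [] = 1" using x e by (simp add: units_def)
  let ?G = "conv_inv (twist l F)"
  have "red (conv (twist l F) (red ?G)) = red unit_word"
    using conv_conv_inv[of "twist l F", OF 1] by (simp add: red_conv_right ext[of "conv (twist l F) ?G" unit_word])
  then have "x \<otimes>\<^bsub>core\<^esub> (l, red ?G) = \<one>\<^bsub>core\<^esub>" using l by (simp add: e)
  moreover have "(l, red ?G) \<in> carrier core" using l by (simp add: red_in_units)
  ultimately show "\<exists>y \<in> carrier core. x \<otimes>\<^bsub>core\<^esub> y = \<one>\<^bsub>core\<^esub>" by blast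
qed

lemma units_iff:
  "F \<in> units \<longleftrightarrow> F [] = 1 \<and> (\<forall>w. (w \<in> W \<longrightarrow> F w \<in> {0..<int p}) \<and> (w \<notin> W \<longrightarrow> F w = 0))"
proof -
  have e: "F w = F w mod int p \<longleftrightarrow> F w \<in> {0..<int p}" for w
  proof
    assume "F w = F w mod int p"
    moreover have "0 \<le> F w mod int p" "F w mod int p < int p" using p by simp_all
    ultimately show "F w \<in> {0..<int p}" by simp
  qed simp
  have "red F = F \<longleftrightarrow> F = red F" by (rule eq_commute)
  also have "\<dots> \<longleftrightarrow> (\<forall>w. F w = red F w)" by (simp only: fun_eq_iff)
  also have "\<dots> \<longleftrightarrow> (\<forall>w. (w \<in> W \<longrightarrow> F w = F w mod int p) \<and> (w \<notin> W \<longrightarrow> F w = 0))"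
    unfolding red_def by (intro iff_allI if_split)
  finally show ?thesis by (simp only: units_def mem_Collect_eq e) blast
qed

lemma bij_betw_units:
  "bij_betw (\<lambda>f w. if w = [] then 1 else if w \<in> W then f w else 0) ((W - {[]}) \<rightarrow>\<^sub>E {0..<int p}) units"
    (is "bij_betw ?F ?D units")
proof (rule bij_betw_byWitness[where f' = "\<lambda>F. restrict F (W - {[]})"])
  show "\<forall>f \<in> ?D. restrict (?F f) (W - {[]}) = f"
  proof (intro ballI ext)
    fix f w assume f: "f \<in> ?D"
    show "restrict (?F f) (W - {[]}) w = f w"
      using PiE_arb[OF f, of w] by (cases "w \<in> W - {[]}") simp_all
  qed
  show "\<forall>F \<in> units. ?F (restrict F (W - {[]})) = F"
  proof (intro ballI ext)
    fix F w assume "F \<in> units"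
    then show "?F (restrict F (W - {[]})) w = F w" unfolding units_iff by simp
  qed
  show "?F ` ?D \<subseteq> units"
  proof (rule image_subsetI)
    fix f assume f: "f \<in> ?D"
    have "f w \<in> {0..<int p}" if "w \<in> W" "w \<noteq> []" for w
      using PiE_mem[OF f, of w] that by simp
    then show "?F f \<in> units" using p NilW by (simp add: units_iff)
  qed
  show "(\<lambda>F. restrict F (W - {[]})) ` units \<subseteq> ?D"
  proof (rule image_subsetI)
    fix F assume "F \<in> units"
    then show "restrict F (W - {[]}) \<in> ?D" unfolding units_iff by (intro restrict_PiE_iff[THEN iffD2]) simp
  qed
qed

lemma finite_units: "finite units"
  using bij_betw_finite[OF bij_betw_units] finW by (simp add: finite_PiE)

lemma card_units: "card units = p ^ card (W - {[]})"
  using bij_betw_same_card[OF bij_betw_units] finW by (simp add: card_PiE)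

end

section \<open>A group with two generators\<close>

text \<open>In a finite group the inverse of an element is one of its powers.\<close>

lemma (in group) subgroup_of_finite:
  assumes "finite (carrier G)" "S \<subseteq> carrier G" "\<one> \<in> S" "\<And>a b. a \<in> S \<Longrightarrow> b \<in> S \<Longrightarrow> a \<otimes> b \<in> S"
  shows "subgroup S G"
proof (rule subgroupI)
  fix a assume a: "a \<in> S"
  then have aG: "a \<in> carrier G" using assms by blast
  have pw: "a [^] n \<in> S" for n :: nat by (induction n) (use assms a in auto)
  have o: "order G > 0" using assms(1) aG by (auto simp: order_def card_gt_0_iff)
  have "a [^] (order G - 1) \<otimes> a = a [^] order G"
    using aG o by (metis Suc_diff_1 nat_pow_Suc)
  also have "\<dots> = \<one>" using aG by (rule pow_order_eq_1)
  finally have "inv a = a [^] (order G - 1)" using aG by (simp add: inv_equality)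
  then show "inv a \<in> S" using pw by simp
qed (use assms in auto)

text \<open>The parameter \<open>d\<close> thins out the words of the two top degrees.  The only available values of \<open>q\<close>
  are powers of \<open>p\<close>, so \<open>q\<close> alone cannot adapt the number of words to the order that is aimed at;
  as \<open>d\<close> grows from \<open>0\<close> to \<open>q\<close>, the number of words of length \<open>c\<close> runs from none to all in
  small steps.  Depending only on the difference of two letters, the condition is invariant under
  rotation.\<close>

definition marked :: "nat \<Rightarrow> nat \<Rightarrow> nat set \<Rightarrow> bool" where
  "marked q d S \<longleftrightarrow> (\<exists>i \<in> S. \<exists>j \<in> S. (int j - int i) mod int q \<in> {1..int d})"

text \<open>In the top degree both factors of length \<open>c\<close> have to be marked in order that the set is closed
  under factors.  Letters never repeat; therefore the square of a letter is zero, and \<open>1 + X\<close> serves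
  as the exponential of \<open>X\<close> in every characteristic.\<close>

definition words :: "nat \<Rightarrow> nat \<Rightarrow> nat \<Rightarrow> nat list set" where
  "words q d c = {w. distinct w \<and> set w \<subseteq> {..<q} \<and>
     (length w < c \<or> length w = c \<and> marked q d (set w) \<or>
      length w = Suc c \<and> marked q d (set (tl w)) \<and> marked q d (set (butlast w)))}"

lemma marked_mono: "marked q d S \<Longrightarrow> S \<subseteq> T \<Longrightarrow> marked q d T"
  unfolding marked_def by blast

lemma marked_shift: "marked q d ((\<lambda>i. (i + k) mod q) ` S) \<longleftrightarrow> marked q d S"
proof -
  have "(int ((j + k) mod q) - int ((i + k) mod q)) mod int q = (int j - int i) mod int q" for i j
    by (simp add: zmod_int mod_simps)
  then show ?thesis unfolding marked_def by simp
qed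

lemma inj_on_shift: "inj_on (\<lambda>i. (i + k) mod q) {..<q :: nat}"
proof (rule inj_onI)
  fix i j assume ij: "i \<in> {..<q}" "j \<in> {..<q}" "(i + k) mod q = (j + k) mod q"
  then have "[i + k = j + k] (mod q)" by (simp add: cong_def)
  then have "[i = j] (mod q)" by (simp add: cong_add_rcancel_nat)
  then show "i = j" using ij by (simp add: cong_def)
qed

lemma word_algebra_words:
  assumes p: "p > 1" and q: "q > 0" and c: "c > 1"
  shows "word_algebra p q (words q d c)"
proof
  have "words q d c \<subseteq> {w. set w \<subseteq> {..<q} \<and> length w \<le> Suc c}"
    unfolding words_def by auto
  then show "finite (words q d c)" by (rule finite_subset) (rule finite_lists_length_le, simp)
  show "[] \<in> words q d c" using c by (simp add: words_def)
next
  fix u v assume uv: "u @ v \<in> words q d c"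
  then have d: "distinct (u @ v)" "set (u @ v) \<subseteq> {..<q}" by (auto simp: words_def)
  have u: "u \<in> words q d c"
  proof (cases "v = []")
    case False
    then have b: "butlast (u @ v) = u @ butlast v" by (simp add: butlast_append)
    have "length u + length v \<le> Suc c" "length v > 0" using uv False by (auto simp: words_def)
    then consider "length u < c" | "length u = c" "length v = Suc 0" "length (u @ v) = Suc c"
      by (cases "length u < c") simp_all
    then show ?thesis
    proof cases
      case 2
      then have "butlast v = []" by (cases v) auto
      then have "marked q d (set u)" using uv 2 b by (auto simp: words_def)
      then show ?thesis using 2 d by (auto simp: words_def)
    qed (use d in \<open>auto simp: words_def\<close>)
  qed (use uv in simp)
  have v: "v \<in> words q d c"
  proof (cases "u = []")
    case False
    have "length u + length v \<le> Suc c" "length u > 0" using uv False by (auto simp: words_def)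
    then consider "length v < c" | "length v = c" "length u = Suc 0" "length (u @ v) = Suc c"
      by (cases "length v < c") simp_all
    then show ?thesis
    proof cases
      case 2
      then have "tl (u @ v) = v" by (cases u) auto
      then have "marked q d (set v)" using uv 2 by (auto simp: words_def)
      then show ?thesis using 2 d by (auto simp: words_def)
    qed (use d in \<open>auto simp: words_def\<close>)
  qed (use uv in simp)
  show "u \<in> words q d c \<and> v \<in> words q d c" using u v by blast
next
  fix w k assume w: "w \<in> words q d c"
  let ?s = "\<lambda>i. (i + k) mod q"
  have "distinct (map ?s w)"
    using w inj_on_subset[OF inj_on_shift] by (auto simp: words_def distinct_map)
  moreover have "set (map ?s w) \<subseteq> {..<q}" using q by auto
  moreover have "marked q d (set (map ?s w)) = marked q d (set w)"
    "marked q d (set (tl (map ?s w))) = marked q d (set (tl w))"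
    "marked q d (set (butlast (map ?s w))) = marked q d (set (butlast w))"
    by (simp_all only: list.set_map marked_shift map_tl[symmetric] map_butlast[symmetric])
  ultimately show "map ?s w \<in> words q d c"
    using w unfolding words_def mem_Collect_eq length_map by simp
qed (use p q in \<open>auto simp: words_def\<close>)

text \<open>The cyclic factors of order \<open>m1\<close> and \<open>m2\<close> that are attached below control the orders of the
  elements that generate.  Their choice alone decides whether the quotients are Beauville groups.\<close>

locale marked_group =
  fixes p e c d m1 m2 :: nat and q :: nat
  assumes prime_p: "Factorial_Ring.prime p" and q_def: "q = p ^ e" and c: "c > 1"
    and m1: "m1 > 0" and m2: "m2 > 0"
begin

lemma p1: "p > 1" using prime_p by (rule prime_gt_1_nat)
lemma q0: "q > 0" using p1 by (simp add: q_def)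

sublocale word_algebra p q "words q d c"
  by (rule word_algebra_words[OF p1 q0 c])

abbreviation "W \<equiv> words q d c"

lemma length_W: "w \<in> W \<Longrightarrow> length w \<le> Suc c"
  unfolding words_def by auto

definition ambient where
  "ambient = core \<times>\<times> (integer_mod_group m1 \<times>\<times> integer_mod_group m2)"

definition letter :: "nat \<Rightarrow> nat list \<Rightarrow> int" where
  "letter i w = (if w = [] \<or> w = [i] then 1 else 0)"

text \<open>One letter and the rotation are enough: conjugating \<open>1 + X\<close> for the letter \<open>0\<close> by powers of
  \<open>gen_y\<close> gives all the other letters.\<close>

definition gen_x :: "(nat \<times> (nat list \<Rightarrow> int)) \<times> int \<times> int" where
  "gen_x = ((0, letter 0), (1 mod int m1, 0))"
definition gen_y :: "(nat \<times> (nat list \<Rightarrow> int)) \<times> int \<times> int" where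
  "gen_y = ((1 mod q, unit_word), (0, 1 mod int m2))"

definition gen_set where "gen_set = generate ambient {gen_x, gen_y}"

abbreviation rot where "rot g \<equiv> fst (fst g)"
abbreviation coef where "coef g \<equiv> snd (fst g)"

sublocale amb: group ambient
  unfolding ambient_def by (intro DirProd_group group_core group_integer_mod_group)

lemma carrier_ambient: "carrier ambient = ({..<q} \<times> units) \<times> ({0..<int m1} \<times> {0..<int m2})"
  using m1 m2 by (simp add: ambient_def carrier_integer_mod_group)

lemma one_ambient: "\<one>\<^bsub>ambient\<^esub> = ((0, unit_word), (0, 0))"
  by (simp add: ambient_def)

lemma mult_ambient: "((k, F), (i, j)) \<otimes>\<^bsub>ambient\<^esub> ((l, G), (i', j'))
   = (((k + l) mod q, red (conv (twist l F) G)), ((i + i') mod int m1, (j + j') mod int m2))"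
  by (simp add: ambient_def)

lemma finite_ambient: "finite (carrier ambient)"
  by (simp add: carrier_ambient finite_units)

lemma order_ambient: "order ambient = q * p ^ card (W - {[]}) * (m1 * m2)"
  by (simp add: order_def carrier_ambient card_cartesian_product card_units)

lemma letter_units: "i < q \<Longrightarrow> letter i \<in> units"
proof -
  assume i: "i < q"
  have "[i] \<in> W" using i c by (simp add: words_def)
  then show ?thesis using p1 NilW by (auto simp: units_iff letter_def)
qed

lemma unit_word_units: "unit_word \<in> units"
  using red_in_units[of unit_word] by (simp add: unit_word_def)

lemma gens: "gen_x \<in> carrier ambient" "gen_y \<in> carrier ambient"
  using q0 m1 m2 by (auto simp: gen_x_def gen_y_def carrier_ambient letter_units unit_word_units)

lemma gen_set_subgroup: "subgroup gen_set ambient"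
  unfolding gen_set_def by (rule amb.generate_is_subgroup) (use gens in auto)

lemma gen_set_carrier: "g \<in> gen_set \<Longrightarrow> g \<in> carrier ambient"
  using gen_set_subgroup subgroup.mem_carrier by metis

lemma gens_in_gen_set: "gen_x \<in> gen_set" "gen_y \<in> gen_set"
  unfolding gen_set_def by (auto intro: generate.incl)

lemma coefD: assumes "g \<in> carrier ambient"
  shows "coef g [] = 1" "w \<in> W \<Longrightarrow> coef g w \<in> {0..<int p}" "w \<notin> W \<Longrightarrow> coef g w = 0" "rot g < q" "coef g \<in> units"
proof -
  show u: "coef g \<in> units" "rot g < q" using assms by (auto simp: carrier_ambient)
  show "coef g [] = 1" "w \<in> W \<Longrightarrow> coef g w \<in> {0..<int p}" "w \<notin> W \<Longrightarrow> coef g w = 0"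
    using u(1) unfolding units_iff by blast+
qed

lemma rot_mult: "rot (g \<otimes>\<^bsub>ambient\<^esub> h) = (rot g + rot h) mod q"
  by (cases g; cases h; cases "fst g"; cases "fst h"; cases "snd g"; cases "snd h") (simp add: mult_ambient)

lemma snd_mult: "snd (g \<otimes>\<^bsub>ambient\<^esub> h) = ((fst (snd g) + fst (snd h)) mod int m1, (snd (snd g) + snd (snd h)) mod int m2)"
  by (cases g; cases h; cases "fst g"; cases "fst h"; cases "snd g"; cases "snd h") (simp add: mult_ambient)

lemma coef_mult: "w \<in> W \<Longrightarrow> [coef (g \<otimes>\<^bsub>ambient\<^esub> h) w = conv (twist (rot h) (coef g)) (coef h) w] (mod int p)"
  by (cases g; cases h; cases "fst g"; cases "fst h"; cases "snd g"; cases "snd h") (simp add: mult_ambient red_mod)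

lemma coef_eqI:
  assumes "g \<in> carrier ambient" "h \<in> carrier ambient" "w \<in> W" "[coef g w = coef h w] (mod int p)"
  shows "coef g w = coef h w"
  using coefD(2)[OF assms(1,3)] coefD(2)[OF assms(2,3)] assms(4) by (simp add: cong_def)

lemma ambient_eqI:
  assumes "g \<in> carrier ambient" "h \<in> carrier ambient" "rot g = rot h" "snd g = snd h"
    "\<And>w. w \<in> W \<Longrightarrow> w \<noteq> [] \<Longrightarrow> [coef g w = coef h w] (mod int p)"
  shows "g = h"
proof -
  have "coef g w = coef h w" for w
  proof (cases "w \<in> W \<and> w \<noteq> []")
    case True
    then show ?thesis using coef_eqI[OF assms(1,2)] assms(5) by blast
  next
    case False
    then show ?thesis using coefD(1,3)[OF assms(1)] coefD(1,3)[OF assms(2)] by (cases "w = []") auto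
  qed
  then show ?thesis using assms(3,4) by (simp add: prod_eq_iff fun_eq_iff)
qed

section \<open>The filtration by degree\<close>

text \<open>The series that are congruent to \<open>1\<close> modulo words of length \<open>n\<close>.  The lowest terms of such series
  add up when the series are multiplied, so degree by degree the group is elementary abelian.\<close>

definition flat :: "nat \<Rightarrow> (nat list \<Rightarrow> int) \<Rightarrow> bool" where
  "flat n F \<longleftrightarrow> F [] = 1 \<and> (\<forall>w. 0 < length w \<and> length w < n \<longrightarrow> F w = 0)"

lemma conv_flat_left:
  assumes F: "flat n F" and G: "G [] = 1" and w: "0 < length w" "length w \<le> n"
  shows "conv F G w = F w + G w"
proof -
  obtain m where m: "length w = Suc m" using w by (cases "length w") auto
  have "conv F G w = F (take 0 w) * G (drop 0 w) + (\<Sum>i<m. F (take (Suc i) w) * G (drop (Suc i) w)) + F (take (Suc m) w) * G (drop (Suc m) w)"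
    unfolding conv_eq_sum m sum.atMost_Suc sum.atMost_shift by simp
  also have "(\<Sum>i<m. F (take (Suc i) w) * G (drop (Suc i) w)) = 0"
  proof (intro sum.neutral ballI)
    fix i assume "i \<in> {..<m}"
    then have "0 < length (take (Suc i) w) \<and> length (take (Suc i) w) < n" using m w by simp
    then have "F (take (Suc i) w) = 0" using F unfolding flat_def by blast
    then show "F (take (Suc i) w) * G (drop (Suc i) w) = 0" by simp
  qed
  finally show ?thesis using F G m by (simp add: flat_def)
qed

lemma conv_flat_right:
  assumes G: "flat n G" and F: "F [] = 1" and w: "0 < length w" "length w \<le> n"
  shows "conv F G w = F w + G w"
proof -
  obtain m where m: "length w = Suc m" using w by (cases "length w") auto
  have "conv F G w = F (take 0 w) * G (drop 0 w) + (\<Sum>i<m. F (take (Suc i) w) * G (drop (Suc i) w)) + F (take (Suc m) w) * G (drop (Suc m) w)"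
    unfolding conv_eq_sum m sum.atMost_Suc sum.atMost_shift by simp
  also have "(\<Sum>i<m. F (take (Suc i) w) * G (drop (Suc i) w)) = 0"
  proof (intro sum.neutral ballI)
    fix i assume "i \<in> {..<m}"
    then have "0 < length (drop (Suc i) w) \<and> length (drop (Suc i) w) < n" using m w by simp
    then have "G (drop (Suc i) w) = 0" using G unfolding flat_def by blast
    then show "F (take (Suc i) w) * G (drop (Suc i) w) = 0" by simp
  qed
  finally show ?thesis using F G m by (simp add: flat_def)
qed

lemma twist_0_conv: "g \<in> carrier ambient \<Longrightarrow> w \<in> W \<Longrightarrow> [conv (twist 0 (coef g)) H w = conv (coef g) H w] (mod int p)"
proof (rule conv_cong_mod)
  fix u v assume g: "g \<in> carrier ambient" "w \<in> W" "u @ v = w"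
  then have "u \<in> W" using factor[of u v] by simp
  then show "[twist 0 (coef g) u = coef g u] (mod int p) \<and> [H v = H v] (mod int p)"
    by (simp add: twist_def shift_0 letters)
qed

lemma coef_mult0:
  assumes "g \<in> carrier ambient" "w \<in> W" "rot h = 0"
  shows "[coef (g \<otimes>\<^bsub>ambient\<^esub> h) w = conv (coef g) (coef h) w] (mod int p)"
  using cong_trans[OF coef_mult[OF assms(2)]] twist_0_conv[OF assms(1,2)] assms(3) by simp

lemma coef_mult_flat_right:
  assumes "g \<in> carrier ambient" "h \<in> carrier ambient" "rot h = 0" "flat n (coef h)"
    and "w \<in> W" "0 < length w" "length w \<le> n"
  shows "[coef (g \<otimes>\<^bsub>ambient\<^esub> h) w = coef g w + coef h w] (mod int p)"
  using coef_mult0[OF assms(1,5,3)] conv_flat_right[of n "coef h" "coef g" w, OF assms(4) coefD(1)[OF assms(1)] assms(6,7)] by simp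

lemma flat_pow:
  assumes g: "g \<in> carrier ambient" "rot g = 0" and n: "0 < n" and f: "flat n (coef g)"
  shows "rot (g [^]\<^bsub>ambient\<^esub> m) = 0 \<and> flat n (coef (g [^]\<^bsub>ambient\<^esub> m)) \<and>
    (\<forall>w \<in> W. length w = n \<longrightarrow> [coef (g [^]\<^bsub>ambient\<^esub> (m :: nat)) w = int m * coef g w] (mod int p))"
proof (induction m)
  case 0
  then show ?case using n by (auto simp: one_ambient flat_def unit_word_def)
next
  case (Suc m)
  let ?h = "g [^]\<^bsub>ambient\<^esub> m"
  have h: "?h \<in> carrier ambient" using g by simp
  have hg: "?h \<otimes>\<^bsub>ambient\<^esub> g \<in> carrier ambient" using g by simp
  have a: "[coef (?h \<otimes>\<^bsub>ambient\<^esub> g) w = coef ?h w + coef g w] (mod int p)"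
    if "w \<in> W" "0 < length w" "length w \<le> n" for w
    by (rule coef_mult_flat_right[OF h g f that])
  have "coef (?h \<otimes>\<^bsub>ambient\<^esub> g) w = 0" if w: "0 < length w" "length w < n" for w
  proof (cases "w \<in> W")
    case True
    have "coef ?h w = 0" "coef g w = 0" using Suc f w by (auto simp: flat_def)
    then have "[coef (?h \<otimes>\<^bsub>ambient\<^esub> g) w = 0] (mod int p)" using a[OF True] w by simp
    then show ?thesis using coefD(2)[OF hg True] by (simp add: cong_def)
  qed (use coefD(3)[OF hg] in simp)
  then have fl: "flat n (coef (?h \<otimes>\<^bsub>ambient\<^esub> g))" using coefD(1)[OF hg] by (simp add: flat_def)
  have "[coef (?h \<otimes>\<^bsub>ambient\<^esub> g) w = int (Suc m) * coef g w] (mod int p)" if w: "w \<in> W" "length w = n" for w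
  proof -
    have "[coef ?h w + coef g w = int m * coef g w + coef g w] (mod int p)"
      using Suc w by (intro cong_add) auto
    then show ?thesis using a[OF w(1)] w n by (auto intro: cong_trans simp: algebra_simps)
  qed
  then show ?case using fl Suc g by (simp add: rot_mult)
qed

text \<open>Raising to the power \<open>p\<close> multiplies the lowest terms by \<open>p\<close>, that is, kills one more degree.\<close>

lemma flat_pow_p:
  assumes g: "g \<in> carrier ambient" "rot g = 0"
  shows "rot (g [^]\<^bsub>ambient\<^esub> (p ^ n)) = 0 \<and> flat (Suc n) (coef (g [^]\<^bsub>ambient\<^esub> (p ^ n)))"
proof (induction n)
  case 0
  then show ?case using g coefD(1)[OF g(1)] by (simp add: flat_def)
next
  case (Suc n)
  let ?h = "g [^]\<^bsub>ambient\<^esub> (p ^ n)"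
  have h: "?h \<in> carrier ambient" using g by simp
  have e: "?h [^]\<^bsub>ambient\<^esub> p = g [^]\<^bsub>ambient\<^esub> (p ^ Suc n)"
    using g by (simp add: amb.nat_pow_pow mult.commute)
  have hp: "?h [^]\<^bsub>ambient\<^esub> p \<in> carrier ambient" using h by simp
  note P = flat_pow[OF h _ _ conjunct2[OF Suc], of p]
  have "coef (?h [^]\<^bsub>ambient\<^esub> p) w = 0" if "0 < length w" "length w < Suc (Suc n)" for w
  proof (cases "w \<in> W \<and> length w = Suc n")
    case True
    then have "[coef (?h [^]\<^bsub>ambient\<^esub> p) w = int p * coef ?h w] (mod int p)" using P Suc by simp
    moreover have "[int p * coef ?h w = 0] (mod int p)" by (simp add: cong_def)
    ultimately have "[coef (?h [^]\<^bsub>ambient\<^esub> p) w = 0] (mod int p)" by (rule cong_trans)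
    then show ?thesis using coefD(2)[OF hp, of w] True by (simp add: cong_def)
  next
    case False
    then show ?thesis
    proof (cases "length w = Suc n")
      case False
      then show ?thesis using P Suc that by (simp add: flat_def)
    qed (use coefD(3)[OF hp] in simp)
  qed
  then show ?case using P Suc coefD(1)[OF hp] unfolding e by (simp add: flat_def)
qed

lemma rot_pow: "g \<in> carrier ambient \<Longrightarrow> rot (g [^]\<^bsub>ambient\<^esub> n) = (n * rot g) mod q"
  by (induction n) (simp_all add: one_ambient rot_mult mod_simps algebra_simps)

lemma snd_pow: "g \<in> carrier ambient \<Longrightarrow>
  snd (g [^]\<^bsub>ambient\<^esub> n) = ((int n * fst (snd g)) mod int m1, (int n * snd (snd g)) mod int m2)"
  by (induction n) (simp_all add: one_ambient snd_mult mod_simps algebra_simps)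

text \<open>The power \<open>q\<close> removes the rotation, and then \<open>c + 1\<close> powers with exponent \<open>p\<close> remove the
  \<open>c + 1\<close> degrees of the words.\<close>

lemma core_exponent:
  assumes g: "g \<in> carrier ambient"
  shows "fst (g [^]\<^bsub>ambient\<^esub> (q * p ^ Suc c)) = (0, unit_word)"
proof -
  let ?h = "g [^]\<^bsub>ambient\<^esub> q"
  have h: "?h \<in> carrier ambient" "rot ?h = 0" using g by (simp_all add: rot_pow)
  let ?k = "?h [^]\<^bsub>ambient\<^esub> (p ^ Suc c)"
  have k: "?k \<in> carrier ambient" using h by simp
  have P: "rot ?k = 0" "flat (Suc (Suc c)) (coef ?k)" using flat_pow_p[OF h, of "Suc c"] by blast+
  have "coef ?k w = unit_word w" for w
  proof (cases "w \<in> W \<and> w \<noteq> []")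
    case True
    then show ?thesis using P(2) length_W[of w] by (auto simp: flat_def unit_word_def)
  next
    case False
    then show ?thesis using coefD(1,3)[OF k] by (cases "w = []") (auto simp: unit_word_def)
  qed
  then have "fst ?k = (0, unit_word)" using P(1) by (simp add: prod_eq_iff fun_eq_iff)
  then show ?thesis using g by (simp add: amb.nat_pow_pow)
qed

section \<open>Shuffle relations\<close>

text \<open>The words on which the shuffle relations are used.  Words of degree \<open>c + 1\<close> are left out: whether
  they belong to \<open>W\<close> depends on the order of their letters, so shuffling could lead out of \<open>W\<close>.\<close>

definition good :: "nat list \<Rightarrow> bool" where
  "good w \<longleftrightarrow> distinct w \<and> set w \<subseteq> {..<q} \<and> (length w < c \<or> length w = c \<and> marked q d (set w))"

lemma good_W: "good w \<Longrightarrow> w \<in> W"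
  by (auto simp: good_def words_def)

lemma good_sub:
  assumes "good w" "distinct w'" "set w' \<subseteq> set w"
  shows "good w'"
proof -
  have l: "length w' = card (set w')" "length w = card (set w)"
    using assms by (simp_all add: good_def distinct_card)
  then have "length w' \<le> length w" using assms(3) by (simp add: card_mono)
  moreover have "set w' = set w" if "length w' = length w"
    using l that assms(3) by (simp add: card_subset_eq)
  ultimately show ?thesis using assms unfolding good_def by (cases "length w' = length w") auto
qed

lemma good_mset: "good w \<Longrightarrow> mset w' = mset w \<Longrightarrow> good w'"
  using good_sub[of w w'] mset_eq_imp_distinct_iff[of w' w] mset_eq_setD[of w' w]
  by (simp add: good_def)

lemma good_shift: "good w \<Longrightarrow> good (shift k w)"
proof -
  assume w: "good w"
  have "distinct (shift k w)"
    using w inj_on_subset[OF inj_on_shift] by (simp add: good_def shift_def distinct_map)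
  moreover have "set (shift k w) \<subseteq> {..<q}" using q0 by (auto simp: shift_def)
  moreover have "marked q d (set (shift k w)) = marked q d (set w)"
    by (simp only: shift_def list.set_map marked_shift)
  ultimately show ?thesis using w by (simp add: good_def)
qed

text \<open>The coefficients of a group-like series form a character of the shuffle algebra.  Every element of
  the group generated by the series \<open>1 + X\<close> is group-like, and these relations cut down the number of
  coefficients that can be chosen freely.\<close>

definition group_like :: "(nat list \<Rightarrow> int) \<Rightarrow> bool" where
  "group_like F \<longleftrightarrow> (\<forall>u v. good (u @ v) \<longrightarrow> [shsum F u v = F u * F v] (mod int p))"

lemma group_like_twist: "group_like F \<Longrightarrow> group_like (twist k F)"
proof -
  assume F: "group_like F"
  have "shsum (twist k F) u v = shsum F (shift k u) (shift k v)" for u v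
    using shsum_map[of F "\<lambda>i. (i + k) mod q" u v] by (simp add: twist_def[abs_def] shift_def)
  moreover have "good (shift k u @ shift k v)" if "good (u @ v)" for u v
    using good_shift[OF that, of k] by (simp add: shift_append)
  ultimately show ?thesis using F by (simp add: group_like_def twist_def)
qed

lemma group_like_conv:
  assumes F: "group_like F" and G: "group_like G"
  shows "group_like (conv F G)"
  unfolding group_like_def
proof (intro allI impI)
  fix u v assume uv: "good (u @ v)"
  have "[shsum F (take i u) (take j v) * shsum G (drop i u) (drop j v)
       = (F (take i u) * F (take j v)) * (G (drop i u) * G (drop j v))] (mod int p)" for i j
  proof (rule cong_mult)
    have "distinct (u @ v)" using uv by (simp add: good_def)
    then have "distinct (take i u @ take j v)" "distinct (drop i u @ drop j v)"
      using set_take_subset[of i u] set_take_subset[of j v] set_drop_subset[of i u] set_drop_subset[of j v]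
      by (auto simp: distinct_take distinct_drop)
    then have "good (take i u @ take j v)" "good (drop i u @ drop j v)"
      using set_take_subset[of i u] set_take_subset[of j v] set_drop_subset[of i u] set_drop_subset[of j v]
      by (auto intro!: good_sub[OF uv])
    then show "[shsum F (take i u) (take j v) = F (take i u) * F (take j v)] (mod int p)"
      "[shsum G (drop i u) (drop j v) = G (drop i u) * G (drop j v)] (mod int p)"
      using F G by (simp_all add: group_like_def)
  qed
  then have "[shsum (conv F G) u v = (\<Sum>i\<le>length u. \<Sum>j\<le>length v.
      (F (take i u) * F (take j v)) * (G (drop i u) * G (drop j v)))] (mod int p)"
    unfolding shsum_conv by (intro cong_sum)
  also have "(\<Sum>i\<le>length u. \<Sum>j\<le>length v. (F (take i u) * F (take j v)) * (G (drop i u) * G (drop j v)))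
    = conv F G u * conv F G v"
    unfolding conv_eq_sum sum_product by (simp add: mult_ac)
  finally show "[shsum (conv F G) u v = conv F G u * conv F G v] (mod int p)" .
qed

lemma group_like_mult:
  assumes g: "group_like (coef g)" and h: "group_like (coef h)"
  shows "group_like (coef (g \<otimes>\<^bsub>ambient\<^esub> h))"
  unfolding group_like_def
proof (intro allI impI)
  fix u v assume uv: "good (u @ v)"
  let ?C = "conv (twist (rot h) (coef g)) (coef h)" and ?gh = "g \<otimes>\<^bsub>ambient\<^esub> h"
  have C: "group_like ?C" by (intro group_like_conv group_like_twist g h)
  have "[shsum (coef ?gh) u v = shsum ?C u v] (mod int p)"
    by (rule shsum_cong_mod, rule coef_mult) (use good_mset[OF uv] good_W in blast)
  also have "[shsum ?C u v = ?C u * ?C v] (mod int p)" using C uv by (simp add: group_like_def)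
  also have "[?C u * ?C v = coef ?gh u * coef ?gh v] (mod int p)"
  proof -
    have "u @ v \<in> W" using good_W[OF uv] .
    then have "u \<in> W" "v \<in> W" using factor by blast+
    then show ?thesis by (intro cong_mult cong_sym[OF coef_mult])
  qed
  finally show "[shsum (coef ?gh) u v = coef ?gh u * coef ?gh v] (mod int p)" .
qed

lemma group_like_short:
  assumes "F [] = 1" "\<And>w. length w > 1 \<Longrightarrow> F w = 0" "\<And>a b. F [a] \<noteq> 0 \<Longrightarrow> F [b] \<noteq> 0 \<Longrightarrow> a = b"
  shows "group_like F"
  unfolding group_like_def
proof (intro allI impI)
  fix u v assume uv: "good (u @ v)"
  show "[shsum F u v = F u * F v] (mod int p)"
  proof (cases "u = [] \<or> v = []")
    case True
    then show ?thesis using assms(1) by auto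
  next
    case False
    then have l: "length u > 0" "length v > 0" by simp_all
    have "[shsum F u v = shsum (\<lambda>_. 0) u v] (mod int p)"
    proof (rule shsum_cong_mod)
      fix w assume "mset w = mset (u @ v)"
      then have "length w = length (u @ v)" by (rule mset_eq_length)
      then have "length w = length u + length v" by simp
      then have "length w > 1" using l by linarith
      then show "[F w = 0] (mod int p)" using assms(2) by simp
    qed
    moreover have "F u * F v = 0"
    proof (rule ccontr)
      assume n: "F u * F v \<noteq> 0"
      then have "length u \<le> 1" "length v \<le> 1" using assms(2)[of u] assms(2)[of v] by (auto simp: not_less[symmetric])
      then have "length u = Suc 0" "length v = Suc 0" using l by linarith+
      then obtain a b where "u = [a]" "v = [b]" by (auto simp: length_Suc_conv)
      then show False using n assms(3)[of a b] uv by (simp add: good_def)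
    qed
    ultimately show ?thesis by (simp only: shsum_zero)
  qed
qed

lemma gen_set_group_like: "g \<in> gen_set \<Longrightarrow> group_like (coef g)"
proof -
  let ?S = "{g \<in> carrier ambient. group_like (coef g)}"
  have u: "group_like unit_word" by (rule group_like_short) (auto simp: unit_word_def)
  have "subgroup ?S ambient"
  proof (rule amb.subgroup_of_finite[OF finite_ambient])
    show "\<one>\<^bsub>ambient\<^esub> \<in> ?S" using u amb.one_closed by (simp add: one_ambient)
  next
    fix a b assume "a \<in> ?S" "b \<in> ?S"
    then show "a \<otimes>\<^bsub>ambient\<^esub> b \<in> ?S" using group_like_mult by simp
  qed auto
  moreover have "group_like (letter 0)" by (rule group_like_short) (auto simp: letter_def split: if_splits)
  then have "{gen_x, gen_y} \<subseteq> ?S" using gens u by (auto simp: gen_x_def gen_y_def)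
  ultimately have "gen_set \<subseteq> ?S" unfolding gen_set_def by (intro amb.generate_subgroup_incl)
  then show "g \<in> gen_set \<Longrightarrow> group_like (coef g)" by blast
qed

text \<open>The elements of \<open>gen_set\<close> are not arbitrary: in degree \<open>c\<close> their coefficients are determined by
  those of lower degree together with those at words that start with their largest letter \<open>z\<close>.
  For \<open>u \<noteq> []\<close> the shuffle relation for \<open>u\<close> and \<open>z # v\<close> expresses the coefficient at
  \<open>u @ z # v\<close> by coefficients of lower degree and by those at words in which \<open>z\<close> stands further
  left.  This keeps only one of \<open>c\<close> cyclic rearrangements of each word, a factor that is essential
  for the constant \<open>1 / 4\<close>.\<close>

lemma coef_determined:
  assumes g: "g \<in> gen_set" and h: "h \<in> gen_set"
    and short: "\<And>w. w \<in> W \<Longrightarrow> length w < c \<Longrightarrow> coef g w = coef h w"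
    and lead: "\<And>w. good w \<Longrightarrow> length w = c \<Longrightarrow> hd w = Max (set w) \<Longrightarrow> coef g w = coef h w"
    and w: "w \<in> W" "length w \<le> c"
  shows "coef g w = coef h w"
proof (cases "length w < c")
  case False
  then have lw: "length w = c" using w by simp
  then have gw: "good w" using w by (auto simp: good_def words_def)
  define z where "z = Max (set w)"
  have "z \<in> set w" unfolding z_def using lw c by (intro Max_in) auto
  then obtain u v where uv: "w = u @ z # v" by (auto dest: split_list)
  have "coef g (u @ z # v) = coef h (u @ z # v)" if "mset (u @ z # v) = mset w" for u v
    using that
  proof (induction "length u" arbitrary: u v rule: less_induct)
    case less
    let ?w = "u @ z # v"
    have gd: "good ?w" using good_mset[OF gw less.prems] .
    have lw': "length ?w = c" using lw mset_eq_length[OF less.prems] by simp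
    have sw: "set ?w = set w" using mset_eq_setD[OF less.prems] .
    show ?case
    proof (cases "u = []")
      case True
      then show ?thesis using lead[OF gd lw'] sw by (simp add: z_def)
    next
      case False
      have W': "u \<in> W" "z # v \<in> W" "?w \<in> W" using good_W[OF gd] factor[of u "z # v"] by simp_all
      have len: "length u < c" "length (z # v) < c" using lw' False by auto
      have "[shsum (coef g) u (z # v) - coef g ?w = shsum (coef h) u (z # v) - coef h ?w] (mod int p)"
      proof (rule shsum_last_letter)
        fix x y assume xy: "length x < length u" "mset (x @ z # y) = mset (u @ z # v)"
        then show "[coef g (x @ z # y) = coef h (x @ z # y)] (mod int p)"
          using less.hyps[OF xy(1)] less.prems by simp
      qed
      moreover have "[shsum (coef g) u (z # v) = shsum (coef h) u (z # v)] (mod int p)"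
      proof -
        have "[shsum (coef g) u (z # v) = coef g u * coef g (z # v)] (mod int p)"
          using gen_set_group_like[OF g] gd by (simp add: group_like_def)
        moreover have "[shsum (coef h) u (z # v) = coef h u * coef h (z # v)] (mod int p)"
          using gen_set_group_like[OF h] gd by (simp add: group_like_def)
        moreover have "coef g u * coef g (z # v) = coef h u * coef h (z # v)"
          using short W' len by simp
        ultimately show ?thesis by (metis cong_sym cong_trans)
      qed
      ultimately have "[coef g ?w = coef h ?w] (mod int p)"
        using cong_diff[of "shsum (coef g) u (z # v)" "shsum (coef h) u (z # v)" "int p"
          "shsum (coef g) u (z # v) - coef g ?w" "shsum (coef h) u (z # v) - coef h ?w"] by simp
      then show ?thesis by (rule coef_eqI[OF gen_set_carrier[OF g] gen_set_carrier[OF h] W'(3)])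
    qed
  qed
  then show ?thesis using uv by simp
qed (use short w in simp)

section \<open>Commutators\<close>

lemma shift_surj: "w \<in> W \<Longrightarrow> k < q \<Longrightarrow> shift k (shift (q - k) w) = w"
  by (simp add: shift_shift) (metis letters mod_self shift_0 shift_mod)

text \<open>If \<open>g\<close> and \<open>h\<close> agree below degree \<open>n\<close>, then \<open>g h\<inverse>\<close> starts in degree \<open>n\<close>, and its terms there are
  the differences of the coefficients, up to the rotation by \<open>h\<close>.\<close>

lemma left_quotient:
  assumes m: "m \<in> carrier ambient" and h: "h \<in> carrier ambient" and g: "m \<otimes>\<^bsub>ambient\<^esub> h = g"
    and eq: "\<And>w. w \<in> W \<Longrightarrow> 0 < length w \<Longrightarrow> length w < n \<Longrightarrow> coef g w = coef h w"
  shows "flat n (coef m)"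
    and "\<And>w. w \<in> W \<Longrightarrow> 0 < length w \<Longrightarrow> length w \<le> n \<Longrightarrow>
           [coef m (shift (rot h) w) = coef g w - coef h w] (mod int p)"
proof -
  have step: "[coef m (shift (rot h) w) = coef g w - coef h w] (mod int p)"
    if f: "flat i (coef m)" and w: "w \<in> W" "0 < length w" "length w \<le> i" for i w
  proof -
    have tf: "flat i (twist (rot h) (coef m))" using f by (simp add: flat_def twist_def shift_def)
    have "[coef g w = conv (twist (rot h) (coef m)) (coef h) w] (mod int p)"
      using coef_mult[OF w(1), of m h] g by simp
    also have "conv (twist (rot h) (coef m)) (coef h) w = coef m (shift (rot h) w) + coef h w"
      using conv_flat_left[OF tf, of "coef h" w] coefD(1)[OF h] w by (simp add: twist_def)
    finally have "[coef g w - coef h w = coef m (shift (rot h) w) + coef h w - coef h w] (mod int p)"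
      by (intro cong_diff) simp_all
    then show ?thesis by (simp add: cong_sym)
  qed
  have fl: "flat i (coef m)" if "i \<le> n" for i
    using that
  proof (induction i)
    case 0
    then show ?case using coefD(1)[OF m] by (simp add: flat_def)
  next
    case (Suc i)
    then have f: "flat i (coef m)" by simp
    have "coef m w = 0" if w: "0 < length w" "length w < Suc i" for w
    proof (cases "w \<in> W")
      case True
      let ?v = "shift (q - rot h) w"
      have v: "?v \<in> W" "shift (rot h) ?v = w" "length ?v = length w"
        using shift_in_W[OF True] shift_surj[OF True] coefD(4)[OF h] by simp_all
      have "[coef m (shift (rot h) ?v) = coef g ?v - coef h ?v] (mod int p)"
        by (rule step[OF f v(1)]) (use v w in simp_all)
      also have "coef g ?v - coef h ?v = 0" using eq[OF v(1)] v(3) w Suc.prems by simp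
      finally show ?thesis using v coefD(2)[OF m True] by (simp add: cong_def)
    qed (use coefD(3)[OF m] in simp)
    then show ?case using coefD(1)[OF m] by (simp add: flat_def)
  qed
  show "flat n (coef m)" by (rule fl) simp
  then show "[coef m (shift (rot h) w) = coef g w - coef h w] (mod int p)"
    if "w \<in> W" "0 < length w" "length w \<le> n" for w by (rule step) (use that in simp_all)
qed

lemma left_quotient_trivial:
  assumes m: "m \<in> carrier ambient" and h: "h \<in> carrier ambient" and g: "m \<otimes>\<^bsub>ambient\<^esub> h = g"
  shows "rot g = rot h \<Longrightarrow> rot m = 0" and "snd g = snd h \<Longrightarrow> snd m = (0, 0)"
proof -
  have r: "rot m < q" "rot h < q" using coefD m h by blast+
  assume "rot g = rot h"
  then have "[rot m + rot h = 0 + rot h] (mod q)" using g rot_mult[of m h] r by (simp add: cong_def)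
  then have "[rot m = 0] (mod q)" by (simp only: cong_add_rcancel_nat)
  then show "rot m = 0" using r by (simp add: cong_def)
next
  have zero: "x = 0" if "x \<in> {0..<int l}" "y \<in> {0..<int l}" "(x + y) mod int l = y" for x y l
  proof -
    have "[x + y = 0 + y] (mod int l)" using that by (simp add: cong_def)
    then have "[x = 0] (mod int l)" by (simp only: cong_add_rcancel)
    then show ?thesis using that by (simp add: cong_def)
  qed
  have c: "fst (snd m) \<in> {0..<int m1}" "snd (snd m) \<in> {0..<int m2}"
    "fst (snd h) \<in> {0..<int m1}" "snd (snd h) \<in> {0..<int m2}"
    using m h by (auto simp: carrier_ambient)
  assume "snd g = snd h"
  then have "(fst (snd m) + fst (snd h)) mod int m1 = fst (snd h)" "(snd (snd m) + snd (snd h)) mod int m2 = snd (snd h)"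
    using snd_mult[of m h] g by (simp_all add: prod_eq_iff)
  then show "snd m = (0, 0)" using zero[OF c(1,3)] zero[OF c(2,4)] by (simp add: prod_eq_iff)
qed

definition letter_elem :: "nat \<Rightarrow> (nat \<times> (nat list \<Rightarrow> int)) \<times> int \<times> int" where
  "letter_elem i = ((0, letter i), (1 mod int m1, 0))"

lemma letter_elem_carrier: "i < q \<Longrightarrow> letter_elem i \<in> carrier ambient"
  using q0 m1 m2 by (auto simp: letter_elem_def carrier_ambient letter_units)

lemma gen_y_pow: "gen_y [^]\<^bsub>ambient\<^esub> k = ((k mod q, unit_word), (0, int k mod int m2))"
proof (induction k)
  case 0
  then show ?case by (simp add: one_ambient)
next
  case (Suc k)
  have "conv unit_word unit_word = (unit_word :: nat list \<Rightarrow> int)" by (simp add: fun_eq_iff conv_unit_left)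
  then show ?case using Suc by (simp add: gen_y_def mult_ambient mod_simps algebra_simps)
qed

lemma twist_letter: assumes i: "i < q" and w: "w \<in> W" shows "twist (q - i) (letter 0) w = letter i w"
proof (cases w)
  case (Cons j v)
  then have j: "j < q" using letters[OF w] by simp
  have "(j + (q - i)) mod q = 0 \<longleftrightarrow> j = i"
  proof
    assume "(j + (q - i)) mod q = 0"
    then have "[j + (q - i) = i + (q - i)] (mod q)" using i by (simp add: cong_def)
    then have "[j = i] (mod q)" by (simp only: cong_add_rcancel_nat)
    then show "j = i" using i j by (simp add: cong_def)
  qed (use i in simp)
  then show ?thesis using Cons by (auto simp: twist_def letter_def shift_def)
qed (simp add: twist_def letter_def)

lemma letter_elem_gen_set: assumes i: "i < q" shows "letter_elem i \<in> gen_set"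
proof -
  let ?y = "gen_y [^]\<^bsub>ambient\<^esub> (q - i)"
  have y: "?y \<in> carrier ambient" using gens by simp
  have "?y \<otimes>\<^bsub>ambient\<^esub> letter_elem i = gen_x \<otimes>\<^bsub>ambient\<^esub> ?y"
  proof (rule ambient_eqI)
    show "?y \<otimes>\<^bsub>ambient\<^esub> letter_elem i \<in> carrier ambient" "gen_x \<otimes>\<^bsub>ambient\<^esub> ?y \<in> carrier ambient"
      using y letter_elem_carrier[OF i] gens by simp_all
    show "rot (?y \<otimes>\<^bsub>ambient\<^esub> letter_elem i) = rot (gen_x \<otimes>\<^bsub>ambient\<^esub> ?y)"
      by (simp add: rot_mult letter_elem_def gen_x_def)
    show "snd (?y \<otimes>\<^bsub>ambient\<^esub> letter_elem i) = snd (gen_x \<otimes>\<^bsub>ambient\<^esub> ?y)"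
      by (simp add: snd_mult letter_elem_def gen_x_def gen_y_pow)
  next
    fix w assume w: "w \<in> W"
    have "[coef (?y \<otimes>\<^bsub>ambient\<^esub> letter_elem i) w = letter i w] (mod int p)"
      using coef_mult[OF w, of ?y "letter_elem i"] by (simp add: gen_y_pow letter_elem_def conv_unit_left)
    moreover have "[coef (gen_x \<otimes>\<^bsub>ambient\<^esub> ?y) w = letter i w] (mod int p)"
      using coef_mult[OF w, of gen_x ?y] twist_letter[OF i w]
      by (simp add: gen_y_pow gen_x_def conv_unit_right twist_mod)
    ultimately show "[coef (?y \<otimes>\<^bsub>ambient\<^esub> letter_elem i) w = coef (gen_x \<otimes>\<^bsub>ambient\<^esub> ?y) w] (mod int p)"
      by (rule cong_trans[OF _ cong_sym])
  qed
  then have "letter_elem i = inv\<^bsub>ambient\<^esub> ?y \<otimes>\<^bsub>ambient\<^esub> (gen_x \<otimes>\<^bsub>ambient\<^esub> ?y)"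
    using amb.inv_solve_left[OF letter_elem_carrier[OF i] y, of "gen_x \<otimes>\<^bsub>ambient\<^esub> ?y"] y gens by simp
  moreover have "?y \<in> gen_set"
    using amb.subgroup_int_pow_closed[OF gen_set_subgroup gens_in_gen_set(2), of "int (q - i)"] by (simp add: int_pow_int)
  ultimately show ?thesis
    using gen_set_subgroup gens_in_gen_set by (simp add: subgroup.m_closed subgroup.m_inv_closed)
qed

lemma conv_letter_left: "conv (letter a) G (b # v) = G (b # v) + (if b = a then G v else 0)"
proof -
  have "(\<lambda>v. letter a (b # v)) = (\<lambda>v. (if b = a then 1 else 0) * unit_word v)"
    by (auto simp: letter_def unit_word_def)
  then show ?thesis by (simp add: conv_scale_left conv_unit_left letter_def)
qed

lemma conv_letter_right: "conv G (letter a) (v @ [b]) = G (v @ [b]) + (if b = a then G v else 0)"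
proof -
  have "(\<Sum>i<length v. G (take i (v @ [b])) * letter a (drop i (v @ [b]))) = 0"
    by (rule sum.neutral) (auto simp: letter_def Cons_nth_drop_Suc[symmetric])
  then show ?thesis
    unfolding conv_eq_sum by (simp add: lessThan_Suc_atMost[symmetric]) (simp add: letter_def)
qed

text \<open>In the lowest degree the commutator of groups becomes the bracket of the algebra: appending the
  letter \<open>a\<close> minus prepending it.\<close>

lemma commutator_step:
  assumes g: "g \<in> gen_set" "rot g = 0" "flat n (coef g)" and n: "0 < n" and a: "a < q"
  shows "\<exists>D \<in> gen_set. rot D = 0 \<and> snd D = (0, 0) \<and> flat (Suc n) (coef D) \<and>
    (\<forall>w \<in> W. length w = Suc n \<longrightarrow>
      [coef D w = (if last w = a then coef g (butlast w) else 0) - (if hd w = a then coef g (tl w) else 0)] (mod int p))"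
proof -
  let ?x = "letter_elem a"
  have gc: "g \<in> carrier ambient" "?x \<in> carrier ambient" using gen_set_carrier[OF g(1)] letter_elem_carrier[OF a] by auto
  have x: "rot ?x = 0" "coef ?x = letter a" by (simp_all add: letter_elem_def)
  define D where "D = g \<otimes>\<^bsub>ambient\<^esub> ?x \<otimes>\<^bsub>ambient\<^esub> inv\<^bsub>ambient\<^esub> (?x \<otimes>\<^bsub>ambient\<^esub> g)"
  have Dc: "D \<in> carrier ambient" using gc by (simp add: D_def)
  have e: "D \<otimes>\<^bsub>ambient\<^esub> (?x \<otimes>\<^bsub>ambient\<^esub> g) = g \<otimes>\<^bsub>ambient\<^esub> ?x"
    using gc by (simp add: D_def amb.m_assoc)
  have xg: "?x \<otimes>\<^bsub>ambient\<^esub> g \<in> carrier ambient" "g \<otimes>\<^bsub>ambient\<^esub> ?x \<in> carrier ambient" using gc by auto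
  have cxg: "[coef (?x \<otimes>\<^bsub>ambient\<^esub> g) w = coef g w + (if hd w = a then coef g (tl w) else 0)] (mod int p)"
    if "w \<in> W" "w \<noteq> []" for w
    using coef_mult0[OF gc(2) that(1) g(2), unfolded x(2)] that(2) by (cases w) (simp, simp only: conv_letter_left list.sel)
  have cgx: "[coef (g \<otimes>\<^bsub>ambient\<^esub> ?x) w = coef g w + (if last w = a then coef g (butlast w) else 0)] (mod int p)"
    if "w \<in> W" "w \<noteq> []" for w
    using coef_mult0[OF gc(1) that(1) x(1), unfolded x(2)] that(2) by (cases w rule: rev_cases) (simp, simp only: conv_letter_right last_snoc butlast_snoc)
  \<comment> \<open>Up to degree \<open>n\<close> the two products agree: appending or prepending a letter to the terms of \<open>g\<close> leads to degree at least
    \<open>n + 1\<close>, except for the letter itself, which both products contain.\<close>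
  have eq: "coef (g \<otimes>\<^bsub>ambient\<^esub> ?x) w = coef (?x \<otimes>\<^bsub>ambient\<^esub> g) w" if w: "w \<in> W" "0 < length w" "length w < Suc n" for w
  proof -
    have "(if last w = a then coef g (butlast w) else 0) = (if hd w = a then coef g (tl w) else 0)"
    proof (cases "length w = 1")
      case True
      then obtain b where "w = [b]" by (auto simp: length_Suc_conv)
      then show ?thesis by simp
    next
      case False
      then have "0 < length w - 1 \<and> length w - 1 < n" using w(2,3) by (intro conjI) linarith+
      then have "0 < length (butlast w) \<and> length (butlast w) < n" "0 < length (tl w) \<and> length (tl w) < n"
        by (simp_all only: length_butlast length_tl)
      then have "coef g (butlast w) = 0" "coef g (tl w) = 0" using g(3) unfolding flat_def by blast+
      then show ?thesis by simp
    qed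
    then have "[coef (g \<otimes>\<^bsub>ambient\<^esub> ?x) w = coef g w + (if hd w = a then coef g (tl w) else 0)] (mod int p)"
      using cgx[of w] w by simp
    then have "[coef (g \<otimes>\<^bsub>ambient\<^esub> ?x) w = coef (?x \<otimes>\<^bsub>ambient\<^esub> g) w] (mod int p)"
      by (rule cong_trans[OF _ cong_sym[OF cxg]]) (use w in auto)
    then show ?thesis by (rule coef_eqI[OF xg(2,1) w(1)])
  qed
  have rr: "rot (?x \<otimes>\<^bsub>ambient\<^esub> g) = 0" using g x by (simp add: rot_mult)
  show ?thesis
  proof (intro bexI[of _ D] conjI ballI impI)
    show "D \<in> gen_set" unfolding D_def
      using gen_set_subgroup letter_elem_gen_set[OF a] g by (simp add: subgroup.m_closed subgroup.m_inv_closed)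
    show "rot D = 0" using left_quotient_trivial(1)[OF Dc xg(1) e] g x by (simp add: rot_mult)
    show "snd D = (0, 0)" using left_quotient_trivial(2)[OF Dc xg(1) e] by (simp add: snd_mult add.commute)
    show "flat (Suc n) (coef D)" by (rule left_quotient(1)[OF Dc xg(1) e eq])
    fix w assume w: "w \<in> W" "length w = Suc n"
    have "[coef D w = coef (g \<otimes>\<^bsub>ambient\<^esub> ?x) w - coef (?x \<otimes>\<^bsub>ambient\<^esub> g) w] (mod int p)"
      using left_quotient(2)[OF Dc xg(1) e eq w(1)] w rr by (simp add: shift_0 letters)
    also have "[coef (g \<otimes>\<^bsub>ambient\<^esub> ?x) w - coef (?x \<otimes>\<^bsub>ambient\<^esub> g) w
      = (coef g w + (if last w = a then coef g (butlast w) else 0)) - (coef g w + (if hd w = a then coef g (tl w) else 0))] (mod int p)"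
      using w by (intro cong_diff cgx cxg) auto
    finally show "[coef D w = (if last w = a then coef g (butlast w) else 0) - (if hd w = a then coef g (tl w) else 0)] (mod int p)"
      by simp
  qed
qed

text \<open>The iterated commutator of the letters \<open>z, a\<^sub>1, a\<^sub>2, \<dots>\<close> of \<open>w\<close>.  In its expansion each new letter
  is put at the right end or, with a minus sign, at the left end.  The letters are distinct, so the
  only term that still starts with \<open>z\<close> is the one in which all letters went to the right, and this
  is \<open>w\<close>.\<close>

lemma lie_element:
  assumes "w \<in> W" "length w = Suc n"
  shows "\<exists>g \<in> gen_set. rot g = 0 \<and> flat (Suc n) (coef g) \<and> (n > 0 \<longrightarrow> snd g = (0, 0)) \<and>
    (\<forall>v \<in> W. length v = Suc n \<longrightarrow> (coef g v \<noteq> 0 \<longrightarrow> set v = set w) \<and>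
       (hd v = hd w \<longrightarrow> coef g v = (if v = w then 1 else 0)))"
  using assms
proof (induction n arbitrary: w)
  case 0
  then obtain i where i: "w = [i]" by (auto simp: length_Suc_conv)
  then have iq: "i < q" using letters[OF 0(1)] by simp
  have "\<forall>v \<in> W. length v = Suc 0 \<longrightarrow> (coef (letter_elem i) v \<noteq> 0 \<longrightarrow> set v = set w) \<and>
       (hd v = hd w \<longrightarrow> coef (letter_elem i) v = (if v = w then 1 else 0))"
    by (auto simp: letter_elem_def letter_def i length_Suc_conv)
  then show ?case using letter_elem_gen_set[OF iq] by (intro bexI[of _ "letter_elem i"]) (auto simp: letter_elem_def flat_def letter_def)
next
  case (Suc n)
  obtain w' a where w: "w = w' @ [a]" using Suc.prems(2) by (cases w rule: rev_cases) auto
  have w'W: "w' \<in> W" "length w' = Suc n" using Suc.prems factor[of w' "[a]"] by (simp_all add: w)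
  have a: "a < q" "a \<notin> set w'" using Suc.prems letters[of w] by (auto simp: w words_def)
  have w'0: "w' \<noteq> []" using w'W by auto
  obtain g where g: "g \<in> gen_set" "rot g = 0" "flat (Suc n) (coef g)"
    and v: "\<And>v. v \<in> W \<Longrightarrow> length v = Suc n \<Longrightarrow> (coef g v \<noteq> 0 \<longrightarrow> set v = set w') \<and>
       (hd v = hd w' \<longrightarrow> coef g v = (if v = w' then 1 else 0))"
    using Suc.IH[OF w'W] by blast
  obtain D where D: "D \<in> gen_set" "rot D = 0" "snd D = (0, 0)" "flat (Suc (Suc n)) (coef D)"
    "\<And>w. w \<in> W \<Longrightarrow> length w = Suc (Suc n) \<Longrightarrow>
      [coef D w = (if last w = a then coef g (butlast w) else 0) - (if hd w = a then coef g (tl w) else 0)] (mod int p)"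
    using commutator_step[OF g zero_less_Suc a(1)] by blast
  have Dc: "D \<in> carrier ambient" by (rule gen_set_carrier[OF D(1)])
  have "(coef D u \<noteq> 0 \<longrightarrow> set u = set w) \<and> (hd u = hd w \<longrightarrow> coef D u = (if u = w then 1 else 0))"
    if u: "u \<in> W" "length u = Suc (Suc n)" for u
  proof -
    have u0: "u \<noteq> []" using u by auto
    have bW: "butlast u \<in> W" "tl u \<in> W" "length (butlast u) = Suc n" "length (tl u) = Suc n"
      using u factor[of "butlast u" "[last u]"] factor[of "[hd u]" "tl u"] u0 by simp_all
    have su: "set u = set (butlast u) \<union> {last u}" using u0 by (cases u rule: rev_cases) auto
    have su': "set u = insert (hd u) (set (tl u))" using u0 by (cases u) auto
    have hb: "hd (butlast u) = hd u" using u u0 by (cases u) auto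
    note Du = D(5)[OF u]
    have "set u = set w" if nz: "coef D u \<noteq> 0"
    proof -
      have "\<not> [coef D u = 0] (mod int p)" using nz coefD(2)[OF Dc u(1)] by (simp add: cong_def)
      have "(if last u = a then coef g (butlast u) else 0) - (if hd u = a then coef g (tl u) else 0) \<noteq> 0" (is "?e \<noteq> 0")
      proof
        assume "?e = 0"
        with Du have "[coef D u = 0] (mod int p)" by (simp only:)
        then show False using \<open>\<not> [coef D u = 0] (mod int p)\<close> by contradiction
      qed
      then consider "last u = a" "coef g (butlast u) \<noteq> 0" | "hd u = a" "coef g (tl u) \<noteq> 0"
        by (cases "coef g (butlast u) = 0"; cases "coef g (tl u) = 0") (auto split: if_splits)
      then show ?thesis using v[OF bW(1,3)] v[OF bW(2,4)] su su' by cases (auto simp: w)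
    qed
    moreover have "coef D u = (if u = w then 1 else 0)" if h: "hd u = hd w"
    proof -
      have hw: "hd u = hd w'" using h w'0 by (simp add: w)
      then have "hd u \<noteq> a" using a(2) w'0 by auto
      then have "[coef D u = (if last u = a then coef g (butlast u) else 0)] (mod int p)" using Du by simp
      also have "(if last u = a then coef g (butlast u) else 0) = (if u = w then 1 else 0)"
      proof -
        have "u = w \<longleftrightarrow> last u = a \<and> butlast u = w'"
          using u0 append_butlast_last_id[OF u0] by (auto simp: w)
        then show ?thesis using v[OF bW(1,3)] hb hw by auto
      qed
      finally show ?thesis using coefD(2)[OF Dc u(1)] p1 by (auto simp: cong_def split: if_splits)
    qed
    ultimately show ?thesis by blast
  qed
  then show ?case using D by (intro bexI[of _ D]) auto
qed

section \<open>The top layer and its index\<close>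

text \<open>An elementary abelian normal subgroup on which conjugation acts only through the rotation.
  Every subgroup of it that is invariant under rotation is therefore normal, and such subgroups
  abound.\<close>

definition top_layer where
  "top_layer = {g \<in> gen_set. rot g = 0 \<and> snd g = (0, 0) \<and> flat (Suc c) (coef g)}"

lemma top_layer_gen_set: "g \<in> top_layer \<Longrightarrow> g \<in> gen_set" by (simp add: top_layer_def)

lemma top_layer_carrier: "g \<in> top_layer \<Longrightarrow> g \<in> carrier ambient" by (simp add: top_layer_def gen_set_carrier)

lemma top_layer_mult:
  assumes g: "g \<in> top_layer" and h: "h \<in> top_layer"
  shows "g \<otimes>\<^bsub>ambient\<^esub> h \<in> top_layer"
    and "\<And>w. w \<in> W \<Longrightarrow> length w = Suc c \<Longrightarrow> [coef (g \<otimes>\<^bsub>ambient\<^esub> h) w = coef g w + coef h w] (mod int p)"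
proof -
  have gh: "g \<otimes>\<^bsub>ambient\<^esub> h \<in> carrier ambient" using g h top_layer_carrier by simp
  have a: "[coef (g \<otimes>\<^bsub>ambient\<^esub> h) w = coef g w + coef h w] (mod int p)"
    if "w \<in> W" "0 < length w" "length w \<le> Suc c" for w
    using coef_mult_flat_right[of g h "Suc c" w] g h that by (simp add: top_layer_def gen_set_carrier)
  then show "[coef (g \<otimes>\<^bsub>ambient\<^esub> h) w = coef g w + coef h w] (mod int p)"
    if "w \<in> W" "length w = Suc c" for w using a[OF that(1), unfolded that(2)] by simp
  have "coef (g \<otimes>\<^bsub>ambient\<^esub> h) w = 0" if w: "0 < length w" "length w < Suc c" for w
  proof (cases "w \<in> W")
    case True
    have "coef g w = 0" "coef h w = 0" using g h w by (auto simp: top_layer_def flat_def)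
    then have "[coef (g \<otimes>\<^bsub>ambient\<^esub> h) w = 0] (mod int p)" using a[OF True] w by simp
    then show ?thesis using coefD(2)[OF gh True] by (simp add: cong_def)
  qed (use coefD(3)[OF gh] in simp)
  then show "g \<otimes>\<^bsub>ambient\<^esub> h \<in> top_layer"
    using g h gen_set_subgroup coefD(1)[OF gh] unfolding top_layer_def mem_Collect_eq flat_def
    by (simp add: subgroup.m_closed rot_mult snd_mult)
qed

lemma one_top_layer: "\<one>\<^bsub>ambient\<^esub> \<in> top_layer"
  using gen_set_subgroup by (auto simp: top_layer_def subgroup.one_closed one_ambient[symmetric]) (auto simp: one_ambient flat_def unit_word_def)

lemma top_layer_subgroup: "subgroup top_layer ambient"
  by (rule amb.subgroup_of_finite[OF finite_ambient]) (use top_layer_carrier one_top_layer top_layer_mult in auto)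

lemma finite_top_layer: "finite top_layer"
  using finite_ambient top_layer_carrier by (meson finite_subset subsetI)

lemma top_layer_conj:
  assumes g: "g \<in> gen_set" and m: "m \<in> top_layer"
  shows "g \<otimes>\<^bsub>ambient\<^esub> m \<otimes>\<^bsub>ambient\<^esub> inv\<^bsub>ambient\<^esub> g \<in> top_layer"
    and "\<And>w. w \<in> W \<Longrightarrow> length w = Suc c \<Longrightarrow>
      coef (g \<otimes>\<^bsub>ambient\<^esub> m \<otimes>\<^bsub>ambient\<^esub> inv\<^bsub>ambient\<^esub> g) w = coef m (shift (q - rot g) w)"
proof -
  let ?m = "g \<otimes>\<^bsub>ambient\<^esub> m \<otimes>\<^bsub>ambient\<^esub> inv\<^bsub>ambient\<^esub> g"
  have cg: "g \<in> carrier ambient" "m \<in> carrier ambient" "rot g < q"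
    using g m gen_set_carrier top_layer_carrier coefD(4) by blast+
  have mc: "?m \<in> carrier ambient" using cg by simp
  have e: "?m \<otimes>\<^bsub>ambient\<^esub> g = g \<otimes>\<^bsub>ambient\<^esub> m" using cg by (simp add: amb.m_assoc)
  have gm: "g \<otimes>\<^bsub>ambient\<^esub> m \<in> carrier ambient" using cg by simp
  have a: "[coef (g \<otimes>\<^bsub>ambient\<^esub> m) w = coef g w + coef m w] (mod int p)"
    if "w \<in> W" "0 < length w" "length w \<le> Suc c" for w
    using coef_mult_flat_right[of g m "Suc c" w] cg m that by (simp add: top_layer_def)
  have eq: "coef (g \<otimes>\<^bsub>ambient\<^esub> m) w = coef g w" if w: "w \<in> W" "0 < length w" "length w < Suc c" for w
  proof (rule coef_eqI[OF gm cg(1) w(1)])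
    have "coef m w = 0" using m w by (auto simp: top_layer_def flat_def)
    then show "[coef (g \<otimes>\<^bsub>ambient\<^esub> m) w = coef g w] (mod int p)" using a[OF w(1,2)] w by simp
  qed
  have "?m \<in> gen_set" using gen_set_subgroup g top_layer_gen_set[OF m] by (simp add: subgroup.m_closed subgroup.m_inv_closed)
  moreover have "rot ?m = 0"
    using left_quotient_trivial(1)[OF mc cg(1) e] m cg by (simp add: rot_mult top_layer_def)
  moreover have "snd ?m = (0, 0)"
  proof (rule left_quotient_trivial(2)[OF mc cg(1) e])
    have "fst (snd g) \<in> {0..<int m1}" "snd (snd g) \<in> {0..<int m2}"
      using cg(1) by (auto simp: carrier_ambient)
    then show "snd (g \<otimes>\<^bsub>ambient\<^esub> m) = snd g" using m by (simp add: snd_mult top_layer_def prod_eq_iff)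
  qed
  ultimately show mM: "?m \<in> top_layer" using left_quotient(1)[OF mc cg(1) e eq] by (simp add: top_layer_def)
  fix w assume w: "w \<in> W" "length w = Suc c"
  let ?v = "shift (q - rot g) w"
  have v: "?v \<in> W" "shift (rot g) ?v = w" "length ?v = Suc c"
    using shift_in_W[OF w(1)] shift_surj[OF w(1)] cg w by simp_all
  have "[coef ?m (shift (rot g) ?v) = coef (g \<otimes>\<^bsub>ambient\<^esub> m) ?v - coef g ?v] (mod int p)"
    using left_quotient(2)[OF mc cg(1) e eq v(1), unfolded v(3)] by simp
  also have "[coef (g \<otimes>\<^bsub>ambient\<^esub> m) ?v - coef g ?v = (coef g ?v + coef m ?v) - coef g ?v] (mod int p)"
    using a[OF v(1), unfolded v(3)] by (intro cong_diff) simp_all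
  finally have "[coef ?m w = coef m ?v] (mod int p)" using v by simp
  then show "coef ?m w = coef m ?v"
    using coefD(2)[OF mc w(1)] coefD(2)[OF cg(2) v(1)] by (simp add: cong_def)
qed

text \<open>The positions of the coefficients that determine an element up to \<open>top_layer\<close>.  Their number is
  paid for in the order of every quotient by a subgroup of \<open>top_layer\<close>, whence the wish to
  have few of them.\<close>

definition cost_words where
  "cost_words = {w \<in> W. w \<noteq> [] \<and> (length w < c \<or> good w \<and> length w = c \<and> hd w = Max (set w))}"

lemma card_gen_set_le: "card gen_set \<le> card top_layer * (q * (m1 * m2) * p ^ card cost_words)"
proof -
  define \<tau> where "\<tau> g = (rot g, snd g, restrict (coef g) cost_words)" for g :: "(nat \<times> (nat list \<Rightarrow> int)) \<times> int \<times> int"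
  let ?T = "{..<q} \<times> ({0..<int m1} \<times> {0..<int m2}) \<times> (cost_words \<rightarrow>\<^sub>E {0..<int p})"
  have fW: "finite cost_words" using finW by (simp add: cost_words_def)
  have finP: "finite gen_set" using finite_ambient gen_set_carrier by (meson finite_subset subsetI)
  have "\<tau> ` gen_set \<subseteq> ?T"
  proof (rule image_subsetI)
    fix g assume "g \<in> gen_set"
    then have g: "g \<in> carrier ambient" by (rule gen_set_carrier)
    have "coef g w \<in> {0..<int p}" if "w \<in> cost_words" for w
      using coefD(2)[OF g] that by (simp add: cost_words_def)
    then show "\<tau> g \<in> ?T" using g coefD(4)[OF g] unfolding \<tau>_def by (auto simp: carrier_ambient)
  qed
  moreover have "finite ?T" using fW by (simp add: finite_PiE)
  ultimately have c1: "card (\<tau> ` gen_set) \<le> card ?T" by (simp add: card_mono)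
  have c2: "card ?T = q * (m1 * m2) * p ^ card cost_words"
    using fW by (simp add: card_cartesian_product card_PiE)
  have fib: "card {g \<in> gen_set. \<tau> g = \<tau> h} \<le> card top_layer" if h: "h \<in> gen_set" for h
  proof (rule card_inj_on_le[where f = "\<lambda>g. g \<otimes>\<^bsub>ambient\<^esub> inv\<^bsub>ambient\<^esub> h"])
    have hc: "h \<in> carrier ambient" using h by (rule gen_set_carrier)
    show "inj_on (\<lambda>g. g \<otimes>\<^bsub>ambient\<^esub> inv\<^bsub>ambient\<^esub> h) {g \<in> gen_set. \<tau> g = \<tau> h}"
      using hc gen_set_carrier by (auto intro!: inj_onI)
    show "(\<lambda>g. g \<otimes>\<^bsub>ambient\<^esub> inv\<^bsub>ambient\<^esub> h) ` {g \<in> gen_set. \<tau> g = \<tau> h} \<subseteq> top_layer"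
    proof (rule image_subsetI)
      fix g assume "g \<in> {g \<in> gen_set. \<tau> g = \<tau> h}"
      then have g: "g \<in> gen_set" "rot g = rot h" "snd g = snd h"
        and r: "restrict (coef g) cost_words = restrict (coef h) cost_words" by (auto simp: \<tau>_def)
      have gc: "g \<in> carrier ambient" using g by (simp add: gen_set_carrier)
      have eqc: "coef g w = coef h w" if "w \<in> cost_words" for w
        using fun_cong[OF r, of w] that by simp
      let ?m = "g \<otimes>\<^bsub>ambient\<^esub> inv\<^bsub>ambient\<^esub> h"
      have mc: "?m \<in> carrier ambient" using gc hc by simp
      have e: "?m \<otimes>\<^bsub>ambient\<^esub> h = g" using gc hc by (simp add: amb.m_assoc)
      have "coef g w = coef h w" if w: "w \<in> W" "0 < length w" "length w < Suc c" for w
      proof (rule coef_determined[OF g(1) h])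
        fix w assume w: "w \<in> W" "length w < c"
        show "coef g w = coef h w"
        proof (cases "w = []")
          case True
          then show ?thesis using coefD(1)[OF gc] coefD(1)[OF hc] by simp
        qed (use eqc w in \<open>simp add: cost_words_def\<close>)
      next
        fix w assume w: "good w" "length w = c" "hd w = Max (set w)"
        then have "w \<noteq> []" "w \<in> W" using c good_W by auto
        then show "coef g w = coef h w" using eqc w by (simp add: cost_words_def)
      qed (use w in auto)
      then have "flat (Suc c) (coef ?m)" by (rule left_quotient(1)[OF mc hc e])
      moreover have "rot ?m = 0" "snd ?m = (0, 0)"
        using left_quotient_trivial[OF mc hc e] g by simp_all
      moreover have "?m \<in> gen_set" using gen_set_subgroup g h by (simp add: subgroup.m_closed subgroup.m_inv_closed)
      ultimately show "?m \<in> top_layer" by (simp add: top_layer_def)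
    qed
  qed (rule finite_top_layer)
  have "gen_set = (\<Union>t \<in> \<tau> ` gen_set. {g \<in> gen_set. \<tau> g = t})" by blast
  then have "card gen_set \<le> (\<Sum>t \<in> \<tau> ` gen_set. card {g \<in> gen_set. \<tau> g = t})"
    using card_UN_le[of "\<tau> ` gen_set" "\<lambda>t. {g \<in> gen_set. \<tau> g = t}"] finP by simp
  also have "\<dots> \<le> (\<Sum>t \<in> \<tau> ` gen_set. card top_layer)"
    by (rule sum_mono) (use fib in auto)
  also have "\<dots> \<le> card ?T * card top_layer" using c1 by simp
  finally show ?thesis using c2 by (simp add: mult.commute)
qed

section \<open>Normal subgroups inside the top layer\<close>

abbreviation gen_group where "gen_group \<equiv> ambient\<lparr>carrier := gen_set\<rparr>"

lemma group_gen_group: "group gen_group"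
  using amb.subgroup_imp_group[OF gen_set_subgroup] .

lemma top_layer_pow:
  assumes g: "g \<in> top_layer"
  shows "g [^]\<^bsub>ambient\<^esub> (k :: nat) \<in> top_layer \<and>
    (\<forall>w \<in> W. length w = Suc c \<longrightarrow> [coef (g [^]\<^bsub>ambient\<^esub> k) w = int k * coef g w] (mod int p))"
proof (induction k)
  case 0
  show ?case using one_top_layer by (auto simp: one_ambient unit_word_def)
next
  case (Suc k)
  let ?h = "g [^]\<^bsub>ambient\<^esub> k"
  have h: "?h \<in> top_layer" using Suc by blast
  have "[coef (?h \<otimes>\<^bsub>ambient\<^esub> g) w = int (Suc k) * coef g w] (mod int p)" if w: "w \<in> W" "length w = Suc c" for w
  proof -
    have "[coef (?h \<otimes>\<^bsub>ambient\<^esub> g) w = coef ?h w + coef g w] (mod int p)" by (rule top_layer_mult(2)[OF h g w])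
    also have "[coef ?h w + coef g w = int k * coef g w + coef g w] (mod int p)"
      using Suc w by (intro cong_add) auto
    finally show ?thesis by (simp add: algebra_simps)
  qed
  then show ?case using top_layer_mult(1)[OF h g] by simp
qed

end

text \<open>A set of top words that is closed under rotation and in which the letters of a word determine
  which of them comes first.  The iterated commutators of these words then have a unit matrix as
  their coefficients at \<open>L\<close>, by \<open>lie_element\<close>.\<close>

locale lead_words = marked_group +
  fixes L :: "nat list set"
  assumes LW: "w \<in> L \<Longrightarrow> w \<in> W \<and> length w = Suc c"
    and L_hd: "\<lbrakk>w \<in> L; v \<in> L; set v = set w\<rbrakk> \<Longrightarrow> hd v = hd w"
    and L_shift: "w \<in> L \<Longrightarrow> shift k w \<in> L"
begin

lemma finite_L: "finite L"
  using LW finW by (meson finite_subset subsetI)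

text \<open>Products of powers of the iterated commutators of the words of \<open>L\<close> take prescribed values at
  all of \<open>L\<close>.\<close>

lemma top_values:
  fixes T :: "nat list \<Rightarrow> int"
  shows "\<exists>m \<in> top_layer. \<forall>v \<in> L. [coef m v = T v] (mod int p)"
proof -
  have E: "\<exists>g \<in> top_layer. \<forall>v \<in> L. coef g v = (if v = w then 1 else 0)" if w: "w \<in> L" for w
  proof -
    obtain g where g: "g \<in> gen_set" "rot g = 0" "flat (Suc c) (coef g)" "c > 0 \<longrightarrow> snd g = (0, 0)"
      and v: "\<forall>v \<in> W. length v = Suc c \<longrightarrow> (coef g v \<noteq> 0 \<longrightarrow> set v = set w) \<and>
        (hd v = hd w \<longrightarrow> coef g v = (if v = w then 1 else 0))"
      using lie_element[of w c] LW[OF w] by blast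
    have "coef g v = (if v = w then 1 else 0)" if vL: "v \<in> L" for v
    proof (cases "set v = set w")
      case True
      then show ?thesis using v LW[OF vL] L_hd[OF w vL True] by blast
    next
      case False
      then have "coef g v = 0" "v \<noteq> w" using v LW[OF vL] by blast+
      then show ?thesis by simp
    qed
    moreover have "g \<in> top_layer" using g c by (simp add: top_layer_def)
    ultimately show ?thesis by blast
  qed
  have "\<exists>m \<in> top_layer. \<forall>v \<in> L. [coef m v = (if v \<in> S then T v else 0)] (mod int p)" if "finite S" "S \<subseteq> L" for S
    using that
  proof (induction S rule: finite_induct)
    case empty
    have "coef \<one>\<^bsub>ambient\<^esub> v = 0" if "v \<in> L" for v using LW[OF that] by (auto simp: one_ambient unit_word_def)
    then show ?case using one_top_layer by (intro bexI[of _ "\<one>\<^bsub>ambient\<^esub>"]) auto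
  next
    case (insert w S)
    obtain m where m: "m \<in> top_layer" "\<And>v. v \<in> L \<Longrightarrow> [coef m v = (if v \<in> S then T v else 0)] (mod int p)"
      using insert by auto
    obtain g where g: "g \<in> top_layer" "\<And>v. v \<in> L \<Longrightarrow> coef g v = (if v = w then 1 else 0)"
      using E[of w] insert by auto
    define k where "k = nat (T w mod int p)"
    have k: "[int k = T w] (mod int p)" using p1 by (simp add: k_def)
    let ?gk = "g [^]\<^bsub>ambient\<^esub> k"
    have gk: "?gk \<in> top_layer" using top_layer_pow[OF g(1)] by blast
    have "[coef (m \<otimes>\<^bsub>ambient\<^esub> ?gk) v = (if v \<in> insert w S then T v else 0)] (mod int p)" if v: "v \<in> L" for v
    proof -
      have "[coef (m \<otimes>\<^bsub>ambient\<^esub> ?gk) v = coef m v + coef ?gk v] (mod int p)"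
        using top_layer_mult(2)[OF m(1) gk] LW[OF v] by blast
      also have "[coef m v + coef ?gk v = (if v \<in> S then T v else 0) + int k * coef g v] (mod int p)"
        using m(2)[OF v] top_layer_pow[OF g(1), of k] LW[OF v] by (intro cong_add) auto
      also have "[(if v \<in> S then T v else 0) + int k * coef g v = (if v \<in> S then T v else 0) + T w * coef g v] (mod int p)"
        by (intro cong_add cong_mult k) simp_all
      also have "(if v \<in> S then T v else 0) + T w * coef g v = (if v \<in> insert w S then T v else 0)"
        using g(2)[OF v] insert by auto
      finally show ?thesis .
    qed
    then show ?case using top_layer_mult(1)[OF m(1) gk] by blast
  qed
  from this[OF finite_L order_refl] show ?thesis by auto
qed

definition functional where
  "functional a m = (\<Sum>v\<in>L. a v * coef m v)" for a :: "nat list \<Rightarrow> int" and m :: "(nat \<times> (nat list \<Rightarrow> int)) \<times> int \<times> int"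

definition cut where
  "cut A I = {m \<in> top_layer. \<forall>i \<in> I. int p dvd functional (A i) m}" for A :: "'i \<Rightarrow> nat list \<Rightarrow> int" and I :: "'i set"

lemma functional_mult:
  assumes "g \<in> top_layer" "h \<in> top_layer"
  shows "[functional a (g \<otimes>\<^bsub>ambient\<^esub> h) = functional a g + functional a h] (mod int p)"
proof -
  have "[functional a (g \<otimes>\<^bsub>ambient\<^esub> h) = (\<Sum>v\<in>L. a v * (coef g v + coef h v))] (mod int p)"
    unfolding functional_def
    by (intro cong_sum cong_mult cong_refl top_layer_mult(2)[OF assms]) (use LW in auto)
  then show ?thesis by (simp add: functional_def distrib_left sum.distrib)
qed

lemma functional_pow:
  assumes "g \<in> top_layer"
  shows "[functional a (g [^]\<^bsub>ambient\<^esub> (k :: nat)) = int k * functional a g] (mod int p)"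
proof -
  have "[functional a (g [^]\<^bsub>ambient\<^esub> k) = (\<Sum>v\<in>L. a v * (int k * coef g v))] (mod int p)"
    unfolding functional_def
    by (intro cong_sum cong_mult cong_refl) (use LW top_layer_pow[OF assms] in auto)
  then show ?thesis by (simp add: functional_def sum_distrib_left mult_ac)
qed

lemma functional_values:
  assumes "\<And>v. v \<in> L \<Longrightarrow> [coef m v = T v] (mod int p)"
  shows "[functional a m = (\<Sum>v\<in>L. a v * T v)] (mod int p)"
  unfolding functional_def by (intro cong_sum cong_mult cong_refl) (use assms in auto)

lemma sum_delta_L: "x \<in> L \<Longrightarrow> (\<Sum>v\<in>L. a v * (if v = x then 1 else 0)) = (a x :: int)"
proof -
  assume x: "x \<in> L"
  have "(\<Sum>v\<in>L. a v * (if v = x then 1 else 0)) = (\<Sum>v\<in>L. if v = x then a v else 0)"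
    by (rule sum.cong) auto
  then show ?thesis using sum.delta[OF finite_L, of x a] x by simp
qed

lemma cut_top_layer: "cut A I \<subseteq> top_layer" by (auto simp: cut_def)

lemma cut_subgroup: "subgroup (cut A I) ambient"
proof (rule amb.subgroup_of_finite[OF finite_ambient])
  show "cut A I \<subseteq> carrier ambient" using cut_top_layer top_layer_carrier by blast
  have "coef \<one>\<^bsub>ambient\<^esub> v = 0" if "v \<in> L" for v using LW[OF that] by (auto simp: one_ambient unit_word_def)
  then show "\<one>\<^bsub>ambient\<^esub> \<in> cut A I" using one_top_layer by (simp add: cut_def functional_def)
next
  fix g h assume g: "g \<in> cut A I" "h \<in> cut A I"
  then have top_layer: "g \<in> top_layer" "h \<in> top_layer" using cut_top_layer by auto
  have "int p dvd functional (A i) (g \<otimes>\<^bsub>ambient\<^esub> h)" if "i \<in> I" for i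
    using functional_mult[OF top_layer, of "A i"] g that by (simp add: cut_def cong_dvd_iff)
  then show "g \<otimes>\<^bsub>ambient\<^esub> h \<in> cut A I" using top_layer_mult(1)[OF top_layer] by (simp add: cut_def)
qed

lemma shift_L_bij: assumes "k < q" shows "bij_betw (shift k) L L"
proof (rule bij_betw_byWitness[where f' = "shift (q - k)"])
  show "\<forall>w \<in> L. shift (q - k) (shift k w) = w" "\<forall>w \<in> L. shift k (shift (q - k) w) = w"
    using shift_surj[of _ k] LW assms by (simp_all add: shift_shift add.commute)
qed (use L_shift in auto)

text \<open>Conjugation rotates the coefficients, so it permutes the conditions that define the cut.\<close>

lemma cut_normal:
  assumes inv: "\<And>i k. i \<in> I \<Longrightarrow> \<exists>j \<in> I. \<forall>v \<in> L. A i (shift k v) = A j v"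
  shows "cut A I \<lhd> gen_group"
proof (rule group.normal_invI[OF group_gen_group])
  show "subgroup (cut A I) gen_group"
    by (rule amb.subgroup_incl[OF cut_subgroup gen_set_subgroup]) (use cut_top_layer top_layer_gen_set in blast)
next
  fix g m assume g: "g \<in> carrier gen_group" and m: "m \<in> cut A I"
  then have gP: "g \<in> gen_set" and mM: "m \<in> top_layer" using cut_top_layer by auto
  let ?m = "g \<otimes>\<^bsub>ambient\<^esub> m \<otimes>\<^bsub>ambient\<^esub> inv\<^bsub>ambient\<^esub> g"
  have r: "rot g < q" using gen_set_carrier[OF gP] coefD(4) by blast
  have "int p dvd functional (A i) ?m" if i: "i \<in> I" for i
  proof -
    obtain j where j: "j \<in> I" "\<forall>v \<in> L. A i (shift (rot g) v) = A j v" using inv[OF i] by blast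
    have "functional (A i) ?m = (\<Sum>v\<in>L. A i (shift (rot g) v) * coef ?m (shift (rot g) v))"
      unfolding functional_def
      using sum.reindex_bij_betw[OF shift_L_bij[OF r], of "\<lambda>v. A i v * coef ?m v"] by simp
    also have "\<dots> = (\<Sum>v\<in>L. A j v * coef m v)"
    proof (rule sum.cong[OF refl])
      fix v assume v: "v \<in> L"
      have "coef ?m (shift (rot g) v) = coef m (shift (q - rot g) (shift (rot g) v))"
        using top_layer_conj(2)[OF gP mM] LW[OF L_shift[OF v]] by blast
      also have "shift (q - rot g) (shift (rot g) v) = v"
        using shift_surj[of v "rot g"] LW[OF v] r by (simp add: shift_shift add.commute)
      finally show "A i (shift (rot g) v) * coef ?m (shift (rot g) v) = A j v * coef m v" using j v by simp
    qed
    finally show ?thesis using m j by (simp add: cut_def functional_def)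
  qed
  then have "?m \<in> cut A I" using top_layer_conj(1)[OF gP mM] by (simp add: cut_def)
  then show "g \<otimes>\<^bsub>gen_group\<^esub> m \<otimes>\<^bsub>gen_group\<^esub> inv\<^bsub>gen_group\<^esub> g \<in> cut A I"
    using amb.m_inv_consistent[OF gen_set_subgroup gP] by simp
qed

lemma card_cut_insert:
  assumes u: "u \<in> cut A I" "[functional (A i) u = 1] (mod int p)"
  shows "card (cut A I) = p * card (cut A (insert i I))"
proof -
  define H where "H r = {h \<in> cut A I. [functional (A i) h = int r] (mod int p)}" for r :: nat
  have fin: "finite (cut A I)" using finite_top_layer cut_top_layer finite_subset by metis
  have finH: "finite (H r)" for r using fin by (simp add: H_def)
  have uM: "u \<in> top_layer" using u cut_top_layer by blast
  have uk: "u [^]\<^bsub>ambient\<^esub> k \<in> cut A I" for k :: nat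
    using amb.subgroup_int_pow_closed[OF cut_subgroup u(1), of "int k"] by (simp add: int_pow_int)
  have le: "card (H r) \<le> card (H ((r + k) mod p))" for r k
  proof (rule card_inj_on_le[OF _ _ finH])
    let ?f = "\<lambda>h. u [^]\<^bsub>ambient\<^esub> k \<otimes>\<^bsub>ambient\<^esub> h"
    show "inj_on ?f (H r)"
    proof (rule inj_onI)
      fix a b assume ab: "a \<in> H r" "b \<in> H r" "?f a = ?f b"
      have "a \<in> carrier ambient" "b \<in> carrier ambient" "u [^]\<^bsub>ambient\<^esub> k \<in> carrier ambient"
        using ab(1,2) uk cut_top_layer top_layer_carrier unfolding H_def by blast+
      then show "a = b" using ab(3) by simp
    qed
    show "?f ` H r \<subseteq> H ((r + k) mod p)"
    proof (rule image_subsetI)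
      fix h assume "h \<in> H r"
      then have h: "h \<in> cut A I" "[functional (A i) h = int r] (mod int p)" by (auto simp: H_def)
      have ukM: "u [^]\<^bsub>ambient\<^esub> k \<in> top_layer" "h \<in> top_layer" using uk h cut_top_layer by blast+
      have "[functional (A i) (?f h) = functional (A i) (u [^]\<^bsub>ambient\<^esub> k) + functional (A i) h] (mod int p)"
        by (rule functional_mult[OF ukM])
      also have "[functional (A i) (u [^]\<^bsub>ambient\<^esub> k) + functional (A i) h = int k * 1 + int r] (mod int p)"
        by (intro cong_add h cong_trans[OF functional_pow[OF uM]] cong_mult u) simp
      also have "[int k * 1 + int r = int ((r + k) mod p)] (mod int p)"
        by (simp add: zmod_int cong_def add.commute)
      finally show "?f h \<in> H ((r + k) mod p)"
        using subgroup.m_closed[OF cut_subgroup uk h(1)] by (simp add: H_def)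
    qed
  qed
  have "card (H r) = card (H 0)" if "r < p" for r
    using le[of 0 r] le[of r "p - r"] that by simp
  moreover have "card (cut A I) = (\<Sum>r<p. card (H r))"
  proof -
    have "cut A I = (\<Union>r<p. H r)"
    proof (intro equalityI subsetI)
      fix h assume h: "h \<in> cut A I"
      define r where "r = nat (functional (A i) h mod int p)"
      have "int r = functional (A i) h mod int p" using p1 by (simp add: r_def)
      moreover have "functional (A i) h mod int p < int p" using p1 by simp
      ultimately have "int r < int p" "[functional (A i) h = int r] (mod int p)"
        by (simp_all add: cong_def)
      then have "r < p" "h \<in> H r" using h by (simp_all add: H_def)
      then show "h \<in> (\<Union>r<p. H r)" by blast
    qed (auto simp: H_def)
    moreover have "H r \<inter> H s = {}" if "r < p" "s < p" "r \<noteq> s" for r s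
    proof (rule ccontr)
      assume "H r \<inter> H s \<noteq> {}"
      then obtain h where "[functional (A i) h = int r] (mod int p)" "[functional (A i) h = int s] (mod int p)"
        by (auto simp: H_def)
      then have "[int r = int s] (mod int p)" using cong_sym cong_trans by blast
      then show False using that by (simp add: cong_int_iff cong_def)
    qed
    ultimately show ?thesis using finH by (simp add: card_UN_disjoint)
  qed
  moreover have "H 0 = cut A (insert i I)" by (auto simp: H_def cut_def cong_0_iff)
  ultimately show ?thesis by simp
qed

text \<open>Values at the points \<open>pt i\<close> show that the conditions are independent, so each of them has index
  \<open>p\<close> in the ones before.\<close>

lemma card_cut:
  assumes "finite I" and eL: "\<And>i. i \<in> I \<Longrightarrow> pt i \<in> L"
    and dual: "\<And>i j. i \<in> I \<Longrightarrow> j \<in> I \<Longrightarrow> A i (pt j) = (if i = j then 1 else 0)"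
  shows "card top_layer = p ^ card I * card (cut A I)"
proof -
  have "card top_layer = p ^ card S * card (cut A S)" if "finite S" "S \<subseteq> I" for S
    using that
  proof (induction S rule: finite_induct)
    case empty
    then show ?case by (simp add: cut_def)
  next
    case (insert i S)
    obtain m where m: "m \<in> top_layer" "\<forall>v \<in> L. [coef m v = (if v = pt i then 1 else 0)] (mod int p)"
      using top_values[of "\<lambda>v. if v = pt i then 1 else 0"] by blast
    have f: "[functional (A j) m = (if j = i then 1 else 0)] (mod int p)" if "j \<in> I" for j
    proof -
      have "[functional (A j) m = (\<Sum>v\<in>L. A j v * (if v = pt i then 1 else 0))] (mod int p)"
        by (rule functional_values) (use m in blast)
      also have "(\<Sum>v\<in>L. A j v * (if v = pt i then 1 else 0)) = A j (pt i)"
        using eL[of i] insert by (intro sum_delta_L) auto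
      finally show ?thesis using dual[OF that, of i] insert by simp
    qed
    have "m \<in> cut A S"
    proof -
      have "int p dvd functional (A j) m" if "j \<in> S" for j
        using f[of j] that insert by (auto simp: cong_0_iff split: if_splits)
      then show ?thesis using m by (simp add: cut_def)
    qed
    then have "card (cut A S) = p * card (cut A (insert i S))"
      using f[of i] insert by (intro card_cut_insert) auto
    then show ?case using insert by simp
  qed
  then show ?thesis using assms(1) by blast
qed

text \<open>The conditions are in reduced echelon form with pivots \<open>pt i\<close>, and a subspace has only one system
  of equations of this form.\<close>

lemma cut_determines:
  assumes I: "finite I" and eL: "\<And>i. i \<in> I \<Longrightarrow> pt i \<in> L"
    and dual: "\<And>i j. i \<in> I \<Longrightarrow> j \<in> I \<Longrightarrow> A i (pt j) = (if i = j then 1 else 0)"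
    and dual': "\<And>i j. i \<in> I \<Longrightarrow> j \<in> I \<Longrightarrow> A' i (pt j) = (if i = j then 1 else 0)"
    and eq: "cut A I = cut A' I" and i: "i \<in> I" and w: "w \<in> L"
  shows "[A i w = A' i w] (mod int p)"
proof -
  \<comment> \<open>The unit vector at \<open>w\<close>, corrected at the pivots so that all equations of \<open>A\<close> hold.\<close>
  define T where "T v = (if v = w then 1 else 0) - (\<Sum>j\<in>I. A j w * (if v = pt j then 1 else 0))" for v
  obtain m where m: "m \<in> top_layer" "\<And>v. v \<in> L \<Longrightarrow> [coef m v = T v] (mod int p)"
    using top_values[of T] by blast
  have val: "[functional (B j) m = B j w - A j w] (mod int p)"
    if j: "j \<in> I" and d: "\<And>i j. i \<in> I \<Longrightarrow> j \<in> I \<Longrightarrow> B i (pt j) = (if i = j then 1 else 0)" for B j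
  proof -
    have "[functional (B j) m = (\<Sum>v\<in>L. B j v * T v)] (mod int p)"
      by (rule functional_values[OF m(2)])
    also have "(\<Sum>v\<in>L. B j v * T v) = (\<Sum>v\<in>L. B j v * (if v = w then 1 else 0))
        - (\<Sum>i\<in>I. \<Sum>v\<in>L. B j v * (A i w * (if v = pt i then 1 else 0)))"
      unfolding T_def by (subst sum.swap) (simp add: right_diff_distrib sum_subtractf sum_distrib_left)
    also have "(\<Sum>v\<in>L. B j v * (if v = w then 1 else 0)) = B j w"
      by (rule sum_delta_L[OF w])
    also have "(\<Sum>i\<in>I. \<Sum>v\<in>L. B j v * (A i w * (if v = pt i then 1 else 0))) = (\<Sum>i\<in>I. B j (pt i) * A i w)"
    proof (rule sum.cong[OF refl])
      fix i assume "i \<in> I"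
      then show "(\<Sum>v\<in>L. B j v * (A i w * (if v = pt i then 1 else 0))) = B j (pt i) * A i w"
        using sum_delta_L[OF eL, of i "\<lambda>v. B j v * A i w"] by (simp add: mult.assoc)
    qed
    also have "\<dots> = (\<Sum>i\<in>I. if i = j then A i w else 0)"
      using d[OF j] by (intro sum.cong refl) auto
    also have "\<dots> = A j w" using I j by simp
    finally show ?thesis .
  qed
  have "m \<in> cut A I"
    unfolding cut_def using m(1) val[OF _ dual] by (auto simp: cong_0_iff)
  then have "m \<in> cut A' I" by (simp only: eq)
  then have "int p dvd functional (A' i) m" using i by (simp add: cut_def)
  then have "[A' i w - A i w = 0] (mod int p)"
    using val[OF i dual'] by (simp add: cong_0_iff cong_dvd_iff)
  then show ?thesis by (simp add: cong_0_iff cong_iff_dvd_diff dvd_diff_commute)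
qed

end

context marked_group begin

text \<open>The rotations of the words of \<open>N\<close> are \<open>card N\<close> orbits of \<open>q\<close> words each.  The pivots consist of
  \<open>r\<close> full orbits and of one point in each of \<open>s0\<close> further orbits.  For a pivot in a full orbit the
  equation may have arbitrary entries \<open>\<psi>\<close> at the remaining words, chosen for one pivot of the orbit
  and carried to the others by rotation; these entries give the many subgroups.  For the \<open>s0\<close> single
  pivots the equation is the sum over the orbit; such an equation is invariant under rotation and
  lowers the order by a single factor \<open>p\<close>, so every exponent \<open>r * q + s0\<close> can be reached.\<close>

lemma many_normal_subgroups:
  assumes N: "\<And>w. w \<in> N \<Longrightarrow> w \<in> W \<and> length w = Suc c"
    and free: "\<And>w w' s s'. \<lbrakk>w \<in> N; w' \<in> N; s < q; s' < q; shift s w = shift s' w'\<rbrakk> \<Longrightarrow> w = w' \<and> s = s'"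
    and hdN: "\<And>w w' s s'. \<lbrakk>w \<in> N; w' \<in> N; s < q; s' < q; set (shift s w) = set (shift s' w')\<rbrakk>
      \<Longrightarrow> hd (shift s w) = hd (shift s' w')"
    and rs: "r + s0 \<le> card N"
  shows "\<exists>\<J>. card \<J> = p ^ (r * (q * (card N - (r + s0)))) \<and>
    (\<forall>J \<in> \<J>. J \<lhd> gen_group \<and> J \<subseteq> top_layer \<and> card top_layer = p ^ (r * q + s0) * card J)"
proof -
  define L where "L = {shift s w |w s. w \<in> N \<and> s < q}"
  have sh: "shift k (shift s w) = shift ((k + s) mod q) w" for k s w by (simp add: shift_shift shift_mod)
  have sW: "shift 0 w = w" if "w \<in> W" for w using shift_0 letters[OF that] by simp
  interpret lead_words p e c d m1 m2 q L
  proof unfold_locales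
    fix w assume "w \<in> L"
    then obtain u s where "u \<in> N" "w = shift s u" unfolding L_def by blast
    then show "w \<in> W \<and> length w = Suc c" using N[of u] shift_in_W[of u s] by simp
  next
    fix w v assume wv: "w \<in> L" "v \<in> L" "set v = set w"
    obtain u s where u: "u \<in> N" "s < q" "w = shift s u" using wv(1) unfolding L_def by blast
    obtain u' s' where u': "u' \<in> N" "s' < q" "v = shift s' u'" using wv(2) unfolding L_def by blast
    show "hd v = hd w" using hdN[OF u'(1) u(1) u'(2) u(2)] u(3) u'(3) wv(3) by blast
  next
    fix w k assume "w \<in> L"
    then obtain u s where u: "u \<in> N" "w = shift s u" unfolding L_def by blast
    then have e: "shift k w = shift ((k + s) mod q) u" by (simp only: sh)
    have "(k + s) mod q < q" using q0 by simp
    then show "shift k w \<in> L" unfolding e L_def using u(1) by blast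
  qed
  have finN: "finite N" using N finW by (meson finite_subset subsetI)
  obtain \<nu> where \<nu>: "bij_betw \<nu> {..<card N} N"
    using ex_bij_betw_nat_finite[OF finN] by (auto simp: atLeast0LessThan)
  have \<nu>N: "\<nu> i \<in> N" if "i < card N" for i using bij_betwE[OF \<nu>] that by blast
  have \<nu>eq: "i = j \<and> s mod q = t mod q" if "i < card N" "j < card N" "shift s (\<nu> i) = shift t (\<nu> j)" for i j s t
  proof -
    have "shift (s mod q) (\<nu> i) = shift (t mod q) (\<nu> j)" using that by (simp add: shift_mod)
    then have "\<nu> i = \<nu> j \<and> s mod q = t mod q"
      by (intro free[OF \<nu>N[OF that(1)] \<nu>N[OF that(2)]] mod_less_divisor q0)
    then show ?thesis using bij_betw_imp_inj_on[OF \<nu>] that inj_onD[of \<nu> "{..<card N}" i j] by simp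
  qed
  have \<nu>0: "shift 0 (\<nu> i) = \<nu> i" if "i < card N" for i using N[OF \<nu>N[OF that]] sW by blast
  have \<nu>L: "shift s (\<nu> i) \<in> L" if "i < card N" for i s
  proof -
    have "\<nu> i \<in> L" using \<nu>N[OF that] \<nu>0[OF that, symmetric] q0 unfolding L_def by blast
    then show ?thesis by (rule L_shift)
  qed
  \<comment> \<open>The places of the free entries.\<close>
  define F where "F = (\<lambda>(i, s). shift s (\<nu> i)) ` ({r + s0..<card N} \<times> {..<q})"
  have FL: "v \<in> L" if "v \<in> F" for v using that \<nu>L by (auto simp: F_def)
  have cF: "card F = q * (card N - (r + s0))"
  proof -
    have "inj_on (\<lambda>(i, s). shift s (\<nu> i)) ({r + s0..<card N} \<times> {..<q})"
    proof (rule inj_onI, clarify)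
      fix i s j t assume "i \<in> {r + s0..<card N}" "j \<in> {r + s0..<card N}" "s < q" "t < q" "shift s (\<nu> i) = shift t (\<nu> j)"
      then show "i = j \<and> s = t" using \<nu>eq[of i j s t] by simp
    qed
    then show ?thesis unfolding F_def by (simp add: card_image card_cartesian_product)
  qed
  define I where "I = {..<r} \<times> {..<q} \<union> {r..<r + s0} \<times> {0 :: nat}"
  define pt where "pt = (\<lambda>(j, s). shift s (\<nu> j))"
  define row where "row \<psi> j v = (if v \<in> F then \<psi> (j, v) else if v = \<nu> j then 1 else (0 :: int))"
    for \<psi> :: "nat \<times> nat list \<Rightarrow> int" and j v
  define A where "A \<psi> = (\<lambda>(j, s) v. if j < r then row \<psi> j (shift (q - s) v)
      else if \<exists>t<q. v = shift t (\<nu> j) then 1 else 0)" for \<psi>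
  have finI: "finite I" and cI: "card I = r * q + s0"
  proof -
    show "finite I" by (simp add: I_def)
    have "({..<r} \<times> {..<q}) \<inter> ({r..<r + s0} \<times> {0 :: nat}) = {}" by auto
    then show "card I = r * q + s0" unfolding I_def by (simp add: card_Un_disjoint card_cartesian_product)
  qed
  have Ij: "j < card N" "s < q" if "(j, s) \<in> I" for j s using that rs q0 by (auto simp: I_def)
  have ptL: "pt i \<in> L" if "i \<in> I" for i
    using that \<nu>L Ij by (cases i) (auto simp: pt_def)
  have ptF: "shift s (\<nu> j) \<notin> F" if "j < r + s0" for j s
  proof
    assume "shift s (\<nu> j) \<in> F"
    then obtain i t where "i \<in> {r + s0..<card N}" "shift s (\<nu> j) = shift t (\<nu> i)" by (auto simp: F_def)
    then show False using \<nu>eq[of j i s t] that rs by simp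
  qed
  have dual: "A \<psi> i (pt i') = (if i = i' then 1 else 0)" if ii: "i \<in> I" "i' \<in> I" for \<psi> i i'
  proof -
    obtain j s j' s' where e: "i = (j, s)" "i' = (j', s')" by (metis prod.exhaust)
    have b: "j < card N" "s < q" "j' < card N" "s' < q" "j' < r + s0"
      using ii Ij rs by (auto simp: e I_def)
    show ?thesis
    proof (cases "j < r")
      case True
      have "A \<psi> i (pt i') = row \<psi> j (shift (q - s + s') (\<nu> j'))"
        using True by (simp add: A_def pt_def e shift_shift)
      also have "\<dots> = (if shift (q - s + s') (\<nu> j') = shift 0 (\<nu> j) then 1 else 0)"
        using ptF[OF b(5)] \<nu>0[OF b(1)] by (simp add: row_def)
      also have "shift (q - s + s') (\<nu> j') = shift 0 (\<nu> j) \<longleftrightarrow> i = i'"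
      proof
        assume "shift (q - s + s') (\<nu> j') = shift 0 (\<nu> j)"
        then have 1: "j' = j" "(q - s + s') mod q = 0" using \<nu>eq[OF b(3,1)] by force+
        have "[(q - s + s') + s = 0 + s] (mod q)" using 1(2) by (intro cong_add) (simp_all add: cong_def)
        then have "[s' = s] (mod q)" using b by (simp add: cong_def)
        then show "i = i'" using 1 b by (simp add: e cong_def)
      next
        assume "i = i'"
        then have "q - s + s' = q" "j = j'" using b e by auto
        then show "shift (q - s + s') (\<nu> j') = shift 0 (\<nu> j)" using shift_mod[of q "\<nu> j"] by simp
      qed
      finally show ?thesis .
    next
      case False
      then have s: "s = 0" using ii by (auto simp: I_def e)
      have "(\<exists>t<q. shift s' (\<nu> j') = shift t (\<nu> j)) \<longleftrightarrow> i = i'"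
      proof
        assume "\<exists>t<q. shift s' (\<nu> j') = shift t (\<nu> j)"
        then have "j' = j" using \<nu>eq[OF b(3,1)] by blast
        then have "s' = 0" using False ii by (auto simp: I_def e)
        then show "i = i'" using s \<open>j' = j\<close> by (simp add: e)
      qed (use b e in auto)
      then show ?thesis using False by (simp add: A_def pt_def e)
    qed
  qed
  have inv: "\<exists>j \<in> I. \<forall>v \<in> L. A \<psi> i (shift k v) = A \<psi> j v" if i: "i \<in> I" for \<psi> i k
  proof -
    obtain j s where e: "i = (j, s)" by (metis prod.exhaust)
    show ?thesis
    proof (cases "j < r")
      case True
      \<comment> \<open>Rotation by \<open>k\<close> turns the equation with number \<open>s\<close> into the one with number \<open>s - k\<close>.\<close>
      define s' where "s' = (s + (q - k mod q)) mod q"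
      have "s' < q" using q0 by (simp add: s'_def)
      have c1: "[s' + k = s] (mod q)"
      proof -
        have "[s' + k = s + (q - k mod q) + k mod q] (mod q)"
          unfolding s'_def by (simp add: cong_def mod_simps)
        also have "s + (q - k mod q) + k mod q = s + q" using mod_less_divisor[OF q0, of k] by linarith
        also have "[s + q = s] (mod q)" by (simp add: cong_def)
        finally show ?thesis .
      qed
      have sq: "s < q" using Ij i e by blast
      have "[(q - s + k) + s = (q - s') + s] (mod q)"
      proof -
        have "(q - s + k) + s = q + k" using sq by simp
        moreover have "[q + k = q - s' + (s' + k)] (mod q)" using \<open>s' < q\<close> by simp
        moreover have "[q - s' + (s' + k) = q - s' + s] (mod q)" by (intro cong_add cong_refl c1)
        ultimately show ?thesis using cong_trans by metis
      qed
      then have "[q - s + k = q - s'] (mod q)" by (simp only: cong_add_rcancel_nat)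
      then have "shift (q - s) (shift k v) = shift (q - s') v" for v
        by (metis cong_def shift_mod shift_shift)
      then have "\<forall>v \<in> L. A \<psi> i (shift k v) = A \<psi> (j, s') v" using True by (simp add: A_def e)
      moreover have "(j, s') \<in> I" using True \<open>s' < q\<close> by (simp add: I_def)
      ultimately show ?thesis by blast
    next
      case False
      have "(\<exists>t<q. shift k v = shift t (\<nu> j)) \<longleftrightarrow> (\<exists>t<q. v = shift t (\<nu> j))" if v: "v \<in> L" for v
      proof
        assume "\<exists>t<q. shift k v = shift t (\<nu> j)"
        then obtain t where "shift k v = shift t (\<nu> j)" by blast
        then have "shift (q - k mod q) (shift (k mod q) v) = shift (q - k mod q) (shift t (\<nu> j))"
          by (simp add: shift_mod)
        moreover have "shift (q - k mod q) (shift (k mod q) v) = v"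
          using shift_surj[of v "k mod q"] LW[OF v] q0 by (simp add: shift_shift add.commute)
        ultimately have "v = shift ((q - k mod q + t) mod q) (\<nu> j)" by (simp add: sh)
        then show "\<exists>t<q. v = shift t (\<nu> j)" using mod_less_divisor[OF q0] by blast
      next
        assume "\<exists>t<q. v = shift t (\<nu> j)"
        then obtain t where "v = shift t (\<nu> j)" by blast
        then have "shift k v = shift ((k + t) mod q) (\<nu> j)" by (simp add: sh)
        then show "\<exists>t<q. shift k v = shift t (\<nu> j)" using mod_less_divisor[OF q0] by blast
      qed
      then have "\<forall>v \<in> L. A \<psi> i (shift k v) = A \<psi> i v" using False by (simp add: A_def e)
      then show ?thesis using i by blast
    qed
  qed
  define \<Psi> where "\<Psi> = ({..<r} \<times> F) \<rightarrow>\<^sub>E {0..<int p}"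
  have finF: "finite F" by (simp add: F_def)
  have card\<Psi>: "card \<Psi> = p ^ (r * (q * (card N - (r + s0))))"
    unfolding \<Psi>_def using finF by (simp add: card_PiE card_cartesian_product cF)
  have inj: "inj_on (\<lambda>\<psi>. cut (A \<psi>) I) \<Psi>"
  proof (rule inj_onI)
    fix \<psi> \<psi>' assume \<psi>: "\<psi> \<in> \<Psi>" "\<psi>' \<in> \<Psi>" and eq: "cut (A \<psi>) I = cut (A \<psi>') I"
    show "\<psi> = \<psi>'"
    proof (rule PiE_ext[OF \<psi>[unfolded \<Psi>_def]])
      fix z assume "z \<in> {..<r} \<times> F"
      then obtain j v where z: "z = (j, v)" "j < r" "v \<in> F" by auto
      have jI: "(j, 0) \<in> I" using z q0 by (simp add: I_def)
      have "[A \<psi> (j, 0) v = A \<psi>' (j, 0) v] (mod int p)"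
        by (rule cut_determines[where pt = pt, OF finI ptL dual dual eq jI FL[OF z(3)]])
      moreover have "shift q v = v" using shift_mod[of q v] LW[OF FL[OF z(3)]] sW by simp
      ultimately have "[\<psi> z = \<psi>' z] (mod int p)" using z by (simp add: A_def row_def)
      moreover have "\<psi> z \<in> {0..<int p}" "\<psi>' z \<in> {0..<int p}"
        using \<psi> z by (auto simp: \<Psi>_def dest!: PiE_mem)
      ultimately show "\<psi> z = \<psi>' z" by (simp add: cong_def)
    qed
  qed
  show ?thesis
  proof (intro exI[of _ "(\<lambda>\<psi>. cut (A \<psi>) I) ` \<Psi>"] conjI ballI)
    show "card ((\<lambda>\<psi>. cut (A \<psi>) I) ` \<Psi>) = p ^ (r * (q * (card N - (r + s0))))"
      using card_image[OF inj] card\<Psi> by simp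
    fix J assume "J \<in> (\<lambda>\<psi>. cut (A \<psi>) I) ` \<Psi>"
    then obtain \<psi> where J: "J = cut (A \<psi>) I" by blast
    show "J \<lhd> gen_group" unfolding J by (rule cut_normal[OF inv])
    show "J \<subseteq> top_layer" unfolding J by (rule cut_top_layer)
    show "card top_layer = p ^ (r * q + s0) * card J"
      using card_cut[where A = "A \<psi>" and pt = pt, OF finI ptL dual] unfolding J cI by simp
  qed
qed

end

section \<open>Counting marked words\<close>

definition marked_words :: "nat \<Rightarrow> nat \<Rightarrow> nat \<Rightarrow> nat list set" where
  "marked_words q d n = {w. distinct w \<and> set w \<subseteq> {..<q} \<and> length w = n \<and> marked q d (set w)}"

lemma finite_marked_words: "finite (marked_words q d n)"
  by (rule finite_subset[OF _ finite_lists_length_eq[of "{..<q}" n]]) (auto simp: marked_words_def)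

text \<open>The \<open>n\<close> cyclic rearrangements of words that start with their maximum are all different, since
  the maximum can be rotated back to the front.\<close>

lemma card_max_first:
  assumes n: "n > 0"
  shows "n * card {w \<in> marked_words q d n. hd w = Max (set w)} \<le> card (marked_words q d n)"
proof -
  let ?MF = "{w \<in> marked_words q d n. hd w = Max (set w)}"
  have len: "length w = n" "distinct w" if "w \<in> ?MF" for w using that by (auto simp: marked_words_def)
  have "inj_on (\<lambda>(w, r). rotate r w) (?MF \<times> {..<n})"
  proof (rule inj_onI)
    fix z z' assume z: "z \<in> ?MF \<times> {..<n}" "z' \<in> ?MF \<times> {..<n}"
      "(case z of (w, r) \<Rightarrow> rotate r w) = (case z' of (w, r) \<Rightarrow> rotate r w)"
    obtain w r w' r' where zz: "z = (w, r)" "z' = (w', r')" by (metis prod.exhaust)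
    have w: "w \<in> marked_words q d n" "hd w = Max (set w)"
      and w': "w' \<in> marked_words q d n" "hd w' = Max (set w')"
      and r: "r \<in> {..<n}" "r' \<in> {..<n}" and eq: "rotate r w = rotate r' w'"
      using z by (simp_all add: zz)
    have l: "length w = n" "length w' = n" "distinct w'" "w \<noteq> []" "w' \<noteq> []"
      using w w' n by (auto simp: marked_words_def)
    have "set w = set w'" using arg_cong[OF eq, of set] by simp
    then have hd: "w ! 0 = w' ! 0" using w w' l by (simp add: hd_conv_nth)
    define i where "i = (n - r) mod n"
    have i: "i < n" "(r + i) mod n = 0" using n r by (auto simp: i_def mod_simps)
    have "rotate r w ! i = w ! 0" using i l by (simp add: nth_rotate add.commute)
    moreover have "rotate r' w' ! i = w' ! ((r' + i) mod n)" using i l by (simp add: nth_rotate add.commute)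
    ultimately have "w' ! ((r' + i) mod n) = w' ! 0" using eq hd by simp
    then have "(r' + i) mod n = 0" using l n by (simp add: nth_eq_iff_index_eq)
    then have "[r' + i = r + i] (mod n)" using i by (simp add: cong_def)
    then have "[r' = r] (mod n)" by (simp only: cong_add_rcancel_nat)
    then have rr: "r' = r" using r by (simp add: cong_def)
    have "rotate (n - r) (rotate r w) = rotate (n - r) (rotate r w')" using eq rr by simp
    then show "z = z'" using rr r l by (simp add: zz rotate_rotate)
  qed
  moreover have "(\<lambda>(w, r). rotate r w) ` (?MF \<times> {..<n}) \<subseteq> marked_words q d n"
    by (auto simp: marked_words_def)
  ultimately have "card (?MF \<times> {..<n}) \<le> card (marked_words q d n)"
    using finite_marked_words by (rule card_inj_on_le)
  then show ?thesis by (simp add: card_cartesian_product mult.commute)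
qed

text \<open>Double counting of deletions: a word of length \<open>n + 2\<close> stays marked when a letter other than two
  witnessing letters is deleted, and a word of length \<open>n + 1\<close> arises from at most \<open>(n + 2) * q\<close> words.\<close>

lemma card_marked_step:
  "n * card (marked_words q d (Suc (Suc n))) \<le> Suc (Suc n) * q * card (marked_words q d (Suc n))"
proof -
  let ?n = "Suc (Suc n)"
  define del where "del w r = take r w @ drop (Suc r) w" for w :: "nat list" and r
  let ?S = "SIGMA w : marked_words q d ?n. {r \<in> {..<?n}. marked q d (set (del w r))}"
  have many: "n \<le> card {r \<in> {..<?n}. marked q d (set (del w r))}" if w: "w \<in> marked_words q d ?n" for w
  proof -
    have l: "length w = ?n" "distinct w" using w by (auto simp: marked_words_def)
    obtain i j where ij: "i \<in> set w" "j \<in> set w" "(int j - int i) mod int q \<in> {1..int d}"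
      using w by (auto simp: marked_words_def marked_def)
    obtain s t where st: "s < ?n" "t < ?n" "w ! s = i" "w ! t = j" using ij l by (auto simp: in_set_conv_nth)
    have "{..<?n} - {s, t} \<subseteq> {r \<in> {..<?n}. marked q d (set (del w r))}"
    proof
      fix r assume r: "r \<in> {..<?n} - {s, t}"
      have "w ! k \<in> set (del w r)" if "k < ?n" "k \<noteq> r" for k
      proof (cases "k < r")
        case True
        then have "w ! k = take r w ! k" "k < length (take r w)" using l that by simp_all
        then show ?thesis unfolding del_def by (metis UnCI nth_mem set_append)
      next
        case False
        then have "w ! k = drop (Suc r) w ! (k - Suc r)" "k - Suc r < length (drop (Suc r) w)" using l that by simp_all
        then show ?thesis unfolding del_def by (metis UnCI nth_mem set_append)
      qed
      from this[of s] this[of t] have "i \<in> set (del w r)" "j \<in> set (del w r)" using st r by auto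
      then show "r \<in> {r \<in> {..<?n}. marked q d (set (del w r))}" using r ij(3) unfolding marked_def by blast
    qed
    then have "card ({..<?n} - {s, t}) \<le> card {r \<in> {..<?n}. marked q d (set (del w r))}"
      by (intro card_mono) auto
    moreover have "n \<le> card ({..<?n} - {s, t})"
      using diff_card_le_card_Diff[of "{s, t}" "{..<?n}"] card_insert_le_m1[of 2 "{t}" s] by simp
    ultimately show ?thesis by linarith
  qed
  have fin: "finite (marked_words q d ?n)" by (rule finite_marked_words)
  have "n * card (marked_words q d ?n) = (\<Sum>w\<in>marked_words q d ?n. n)" by simp
  also have "\<dots> \<le> (\<Sum>w\<in>marked_words q d ?n. card {r \<in> {..<?n}. marked q d (set (del w r))})"
    by (rule sum_mono) (rule many)
  also have "\<dots> = card ?S" by (rule card_SigmaI[symmetric]) (use fin in auto)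
  also have "\<dots> \<le> card (marked_words q d (Suc n) \<times> {..<?n} \<times> {..<q})"
  proof (rule card_inj_on_le[where f = "\<lambda>(w, r). (del w r, r, w ! r)"])
    show "inj_on (\<lambda>(w, r). (del w r, r, w ! r)) ?S"
    proof (rule inj_onI)
      fix z z' assume z: "z \<in> ?S" "z' \<in> ?S"
        "(case z of (w, r) \<Rightarrow> (del w r, r, w ! r)) = (case z' of (w, r) \<Rightarrow> (del w r, r, w ! r))"
      obtain w r w' r' where zz: "z = (w, r)" "z' = (w', r')" by (metis prod.exhaust)
      have w: "w \<in> marked_words q d ?n" "w' \<in> marked_words q d ?n" and r: "r < ?n" "r' = r"
        and e: "del w r = del w' r" "w ! r = w' ! r" using z by (auto simp: zz)
      have l: "length w = ?n" "length w' = ?n" using w by (auto simp: marked_words_def)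
      have "take r w = take r w'" "drop (Suc r) w = drop (Suc r) w'"
        using e(1) l r unfolding del_def by (simp_all add: append_eq_append_conv)
      then show "z = z'" using id_take_nth_drop[of r w] id_take_nth_drop[of r w'] e(2) l r by (simp add: zz)
    qed
    show "(\<lambda>(w, r). (del w r, r, w ! r)) ` ?S \<subseteq> marked_words q d (Suc n) \<times> {..<?n} \<times> {..<q}"
    proof (rule image_subsetI)
      fix z assume z: "z \<in> ?S"
      obtain w r where zz: "z = (w, r)" by (metis prod.exhaust)
      have w: "w \<in> marked_words q d ?n" and r: "r < ?n" and m: "marked q d (set (del w r))"
        using z by (simp_all add: zz)
      have l: "length w = ?n" "distinct w" "set w \<subseteq> {..<q}" using w by (auto simp: marked_words_def)
      have "w = take r w @ w ! r # drop (Suc r) w" using r l by (simp add: id_take_nth_drop)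
      then have "distinct (take r w @ w ! r # drop (Suc r) w)" "set (take r w @ w ! r # drop (Suc r) w) \<subseteq> {..<q}"
        using l by metis+
      then have "distinct (del w r)" "set (del w r) \<subseteq> {..<q}" "w ! r < q" by (auto simp: del_def)
      moreover have "length (del w r) = Suc n" using l r by (simp add: del_def)
      ultimately show "(case z of (w, r) \<Rightarrow> (del w r, r, w ! r)) \<in> marked_words q d (Suc n) \<times> {..<?n} \<times> {..<q}"
        using m r by (simp add: zz marked_words_def)
    qed
  qed (use finite_marked_words in auto)
  also have "\<dots> = Suc (Suc n) * q * card (marked_words q d (Suc n))"
    by (simp add: card_cartesian_product)
  finally show ?thesis .
qed

text \<open>A marked word of length \<open>n\<close> may be extended by a letter at each end, because both factors of length
  \<open>n + 1\<close> inherit its mark.\<close>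

lemma card_top_words:
  "card (marked_words q d n) * (q - Suc n)\<^sup>2 \<le> card {w \<in> words q d (Suc n). length w = Suc (Suc n)}"
proof -
  let ?S = "SIGMA m : marked_words q d n. SIGMA u : {..<q} - set m. {..<q} - insert u (set m)"
  have fin: "finite (marked_words q d n)" by (rule finite_marked_words)
  have c1: "q - Suc n \<le> card ({..<q} - insert u (set m))" if "m \<in> marked_words q d n" for m u
    using diff_card_le_card_Diff[of "insert u (set m)" "{..<q}"] that card_insert_le_m1[of "Suc n" "set m" u]
    by (auto simp: marked_words_def distinct_card)
  have c2: "q - Suc n \<le> card ({..<q} - set m)" if "m \<in> marked_words q d n" for m
    using diff_card_le_card_Diff[of "set m" "{..<q}"] that by (auto simp: marked_words_def distinct_card)
  have "card (marked_words q d n) * (q - Suc n)\<^sup>2 = (\<Sum>m\<in>marked_words q d n. (q - Suc n) * (q - Suc n))"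
    by (simp add: power2_eq_square)
  also have "\<dots> \<le> (\<Sum>m\<in>marked_words q d n. \<Sum>u\<in>{..<q} - set m. card ({..<q} - insert u (set m)))"
  proof (rule sum_mono)
    fix m assume m: "m \<in> marked_words q d n"
    have "(q - Suc n) * (q - Suc n) \<le> card ({..<q} - set m) * (q - Suc n)" using c2[OF m] by simp
    also have "\<dots> = (\<Sum>u\<in>{..<q} - set m. q - Suc n)" by simp
    also have "\<dots> \<le> (\<Sum>u\<in>{..<q} - set m. card ({..<q} - insert u (set m)))"
      by (rule sum_mono) (rule c1[OF m])
    finally show "(q - Suc n) * (q - Suc n) \<le> \<dots>" .
  qed
  also have "\<dots> = card ?S" using fin by (simp add: card_SigmaI)
  also have "\<dots> \<le> card {w \<in> words q d (Suc n). length w = Suc (Suc n)}"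
  proof (rule card_inj_on_le[where f = "\<lambda>(m, u, v). u # m @ [v]"])
    show "inj_on (\<lambda>(m, u, v). u # m @ [v]) ?S" by (rule inj_onI) auto
    show "(\<lambda>(m, u, v). u # m @ [v]) ` ?S \<subseteq> {w \<in> words q d (Suc n). length w = Suc (Suc n)}"
    proof (rule image_subsetI)
      fix z assume z: "z \<in> ?S"
      obtain m u v where zz: "z = (m, u, v)" by (metis prod.exhaust)
      have m: "m \<in> marked_words q d n" and u: "u \<in> {..<q}" "u \<notin> set m"
        and v: "v \<in> {..<q}" "v \<notin> insert u (set m)" using z by (simp_all add: zz)
      have "marked q d (set (m @ [v]))" "marked q d (set (u # m))"
        using m by (auto simp: marked_words_def intro: marked_mono)
      then show "(case z of (m, u, v) \<Rightarrow> u # m @ [v]) \<in> {w \<in> words q d (Suc n). length w = Suc (Suc n)}"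
        using m u v by (auto simp: zz words_def marked_words_def butlast_append)
    qed
    have "{w \<in> words q d (Suc n). length w = Suc (Suc n)} \<subseteq> {w. set w \<subseteq> {..<q} \<and> length w = Suc (Suc n)}"
      by (auto simp: words_def)
    then show "finite {w \<in> words q d (Suc n). length w = Suc (Suc n)}"
      by (rule finite_subset) (rule finite_lists_length_eq, simp)
  qed
  finally show ?thesis .
qed

text \<open>A word that becomes marked when \<open>d\<close> grows by one has two letters with difference exactly \<open>d + 1\<close>;
  given their positions, one of them is determined by the rest of the word.\<close>

lemma card_marked_words_increment:
  "card (marked_words q (Suc d) (Suc n)) \<le> card (marked_words q d (Suc n)) + (Suc n)\<^sup>2 * q ^ n"
proof -
  let ?n = "Suc n"
  define X where "X = (\<lambda>(s, t). {w. set w \<subseteq> {..<q} \<and> length w = ?n \<and> s < ?n \<and> t < ?n \<and> s \<noteq> t \<and> (int (w ! t) - int (w ! s)) mod int q = int (Suc d)})"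
  have cX: "finite (X st) \<and> card (X st) \<le> q ^ n" for st
  proof -
    obtain s t where st: "st = (s, t)" by force
    let ?f = "\<lambda>w. take t w @ drop (Suc t) w"
    have "inj_on ?f (X st)"
    proof (rule inj_onI)
      fix w w' assume ww: "w \<in> X st" "w' \<in> X st" "?f w = ?f w'"
      have l: "length w = ?n" "length w' = ?n" "s < ?n" "t < ?n" "s \<noteq> t" "set w \<subseteq> {..<q}" "set w' \<subseteq> {..<q}"
        and e: "(int (w ! t) - int (w ! s)) mod int q = (int (w' ! t) - int (w' ! s)) mod int q"
        using ww by (auto simp: X_def st)
      have td: "take t w = take t w'" "drop (Suc t) w = drop (Suc t) w'"
        using ww(3) l by (simp_all add: append_eq_append_conv)
      have "w ! s = w' ! s"
      proof (cases "s < t")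
        case True
        then show ?thesis using arg_cong[OF td(1), of "\<lambda>x. x ! s"] by simp
      next
        case False
        then show ?thesis using arg_cong[OF td(2), of "\<lambda>x. x ! (s - Suc t)"] l by simp
      qed
      then have "[int (w ! t) - int (w ! s) = int (w' ! t) - int (w ! s)] (mod int q)"
        using e by (simp add: cong_def)
      then have "[int (w ! t) = int (w' ! t)] (mod int q)" by (metis cong_add cong_refl diff_add_cancel)
      moreover have "w ! t < q" "w' ! t < q" using l nth_mem[of t w] nth_mem[of t w'] unfolding subset_iff by simp_all
      ultimately have "w ! t = w' ! t" by (simp add: cong_int_iff cong_def)
      then show "w = w'" using id_take_nth_drop[of t w] id_take_nth_drop[of t w'] td l by simp
    qed
    moreover have "?f ` X st \<subseteq> {w. set w \<subseteq> {..<q} \<and> length w = n}"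
    proof (rule image_subsetI)
      fix w assume "w \<in> X st"
      then have "set w \<subseteq> {..<q}" "length w = ?n" "t < ?n" by (auto simp: X_def st)
      then show "?f w \<in> {w. set w \<subseteq> {..<q} \<and> length w = n}"
        using set_take_subset[of t w] set_drop_subset[of "Suc t" w] by auto
    qed
    ultimately have "card (X st) \<le> card {w. set w \<subseteq> {..<q} \<and> length w = n}"
      by (rule card_inj_on_le) (rule finite_lists_length_eq, simp)
    moreover have "finite (X st)"
      by (rule finite_subset[OF _ finite_lists_length_eq[of "{..<q}" ?n]]) (auto simp: X_def st)
    ultimately show ?thesis by (simp add: card_lists_length_eq)
  qed
  have "marked_words q (Suc d) ?n \<subseteq> marked_words q d ?n \<union> (\<Union>st\<in>{..<?n} \<times> {..<?n}. X st)"
  proof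
    fix w assume w: "w \<in> marked_words q (Suc d) ?n"
    then obtain i j where ij: "i \<in> set w" "j \<in> set w" "(int j - int i) mod int q \<in> {1..int (Suc d)}"
      by (auto simp: marked_words_def marked_def)
    obtain s t where st: "s < ?n" "t < ?n" "w ! s = i" "w ! t = j"
      using ij w by (auto simp: in_set_conv_nth marked_words_def)
    show "w \<in> marked_words q d ?n \<union> (\<Union>st\<in>{..<?n} \<times> {..<?n}. X st)"
    proof (cases "(int j - int i) mod int q \<in> {1..int d}")
      case True
      then have "marked q d (set w)" using ij unfolding marked_def by blast
      then show ?thesis using w by (simp add: marked_words_def)
    next
      case False
      then have e: "(int j - int i) mod int q = int (Suc d)" using ij(3) by auto
      then have "s \<noteq> t" using st by auto
      then have "w \<in> X (s, t)" using w st e by (auto simp: X_def marked_words_def)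
      then show ?thesis using st by blast
    qed
  qed
  then have "card (marked_words q (Suc d) ?n) \<le> card (marked_words q d ?n \<union> (\<Union>st\<in>{..<?n} \<times> {..<?n}. X st))"
    using finite_marked_words cX by (intro card_mono) auto
  also have "\<dots> \<le> card (marked_words q d ?n) + card (\<Union>st\<in>{..<?n} \<times> {..<?n}. X st)"
    by (rule card_Un_le)
  also have "card (\<Union>st\<in>{..<?n} \<times> {..<?n}. X st) \<le> (\<Sum>st\<in>{..<?n} \<times> {..<?n}. card (X st))"
    by (rule card_UN_le) simp
  also have "\<dots> \<le> (\<Sum>st\<in>{..<?n} \<times> {..<?n}. q ^ n)" using cX by (intro sum_mono) blast
  also have "\<dots> = (Suc n)\<^sup>2 * q ^ n" by (simp add: card_cartesian_product power2_eq_square)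
  finally show ?thesis by simp
qed

lemma card_distinct_words_ge: "(q - n) ^ n \<le> card {w. distinct w \<and> set w \<subseteq> {..<q} \<and> length w = n}"
proof (cases "n \<le> q")
  case True
  have "(q - n) ^ n = (\<Prod>i\<in>{q - n + 1..q}. q - n)" using True by simp
  also have "\<dots> \<le> \<Prod>{q - n + 1..q}" by (rule prod_mono) auto
  also have "\<dots> = card {w. length w = n \<and> distinct w \<and> set w \<subseteq> {..<q}}"
    using True card_lists_distinct_length_eq[of "{..<q}" n] by simp
  finally show ?thesis by (simp add: conj_ac)
qed (cases n, auto)

text \<open>The number of marked words grows with \<open>d\<close> from \<open>0\<close> to the number of all words without repeated
  letters, in steps bounded by \<open>card_marked_words_increment\<close>.\<close>

lemma tune_marked_words:
  assumes X: "X < (q - Suc (Suc n)) ^ Suc (Suc n)"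
  shows "\<exists>d. card (marked_words q d (Suc (Suc n))) \<le> X \<and>
     X < card (marked_words q d (Suc (Suc n))) + (Suc (Suc n))\<^sup>2 * q ^ Suc n"
proof -
  let ?n = "Suc (Suc n)"
  let ?b = "\<lambda>d. card (marked_words q d ?n)"
  have "{w. distinct w \<and> set w \<subseteq> {..<q} \<and> length w = ?n} \<subseteq> marked_words q q ?n"
  proof
    fix w assume "w \<in> {w. distinct w \<and> set w \<subseteq> {..<q} \<and> length w = ?n}"
    then have w: "distinct w" "set w \<subseteq> {..<q}" "length w = ?n" by auto
    obtain i j v where v: "w = i # j # v" using w(3) by (auto simp: length_Suc_conv)
    have ij: "i \<noteq> j" "i < q" "j < q" using w v by auto
    have "\<not> [int j = int i] (mod int q)" using ij by (simp add: cong_int_iff cong_def)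
    then have "(int j - int i) mod int q \<noteq> 0" by (simp add: cong_iff_dvd_diff mod_eq_0_iff_dvd)
    moreover have "0 \<le> (int j - int i) mod int q" "(int j - int i) mod int q < int q" using ij by simp_all
    ultimately have "marked q q (set w)" unfolding marked_def v by (intro bexI[of _ i] bexI[of _ j]) auto
    then show "w \<in> marked_words q q ?n" using w by (simp add: marked_words_def)
  qed
  then have "X < ?b q" using X card_distinct_words_ge[of q ?n] card_mono[OF finite_marked_words] by (meson le_trans not_less)
  then have ex: "\<exists>d. X < ?b d" by blast
  define D where "D = (LEAST d. X < ?b d)"
  have D: "X < ?b D" unfolding D_def by (rule LeastI_ex[OF ex])
  have "marked_words q 0 ?n = {}" by (auto simp: marked_words_def marked_def)
  then have "D \<noteq> 0" using D by (cases D) simp_all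
  then obtain d where d: "D = Suc d" by (cases D) auto
  have "\<not> X < ?b d" using not_less_Least[of d "\<lambda>d. X < ?b d"] d by (simp add: D_def)
  moreover have "?b (Suc d) \<le> ?b d + ?n\<^sup>2 * q ^ Suc n" by (rule card_marked_words_increment)
  ultimately show ?thesis using D d by (intro exI[of _ d]) simp
qed

section \<open>Quotients of prescribed order\<close>

context marked_group begin

lemma sum_list_shift: "[sum_list (shift s w) = sum_list w + length w * s] (mod q)"
proof (induction w)
  case Nil
  show ?case by (simp add: cong_def)
next
  case (Cons a w)
  have "[(a + s) mod q = a + s] (mod q)" by (simp add: cong_def)
  note X = cong_add[OF this Cons]
  have "sum_list (a # w) + length (a # w) * s = (a + s) + (sum_list w + length w * s)" by simp
  with X show ?case by (simp only: shift_Cons sum_list.Cons)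
qed

text \<open>Rotation by \<open>s\<close> adds \<open>(c + 1) * s\<close> to the sum of the letters of a top word.  As \<open>c + 1\<close> is
  invertible modulo \<open>q\<close>, each orbit has \<open>q\<close> elements and exactly one of them has a sum divisible by
  \<open>q\<close>; the same is true for the sets of letters, since the sum depends only on the set.  Among these
  normalised words those are kept whose first letter has a fixed rank in the set of letters, so that
  the set determines the first letter.  Some rank keeps at least one word in \<open>c + 1\<close>.\<close>

lemma ex_leads:
  assumes cop: "coprime (Suc c) q"
  shows "\<exists>N. (\<forall>w \<in> N. w \<in> W \<and> length w = Suc c) \<and>
    (\<forall>w \<in> N. \<forall>w' \<in> N. \<forall>s<q. \<forall>s'<q. shift s w = shift s' w' \<longrightarrow> w = w' \<and> s = s') \<and>
    (\<forall>w \<in> N. \<forall>w' \<in> N. \<forall>s<q. \<forall>s'<q. set (shift s w) = set (shift s' w') \<longrightarrow> hd (shift s w) = hd (shift s' w')) \<and>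
    card {w \<in> W. length w = Suc c} \<le> q * (Suc c * card N)"
proof -
  define T where "T = {w \<in> W. length w = Suc c}"
  define rank where "rank w = card {i \<in> set w. i < hd w}" for w :: "nat list"
  define Norm where "Norm = {w \<in> T. q dvd sum_list w}"
  define N where "N r = {w \<in> Norm. rank w = r}" for r
  have finT: "finite T" using finW by (simp add: T_def)
  have T: "distinct w" "set w \<subseteq> {..<q}" "length w = Suc c" "w \<in> W" if "w \<in> T" for w
    using that by (auto simp: T_def words_def)
  have same_shift: "s = s'" if w: "w \<in> Norm" "w' \<in> Norm" "s < q" "s' < q"
      "sum_list (shift s w) = sum_list (shift s' w')" for w w' s s'
  proof -
    have z: "[sum_list (shift s w) = Suc c * s] (mod q)" if "w \<in> Norm" for w s
    proof -
      have "[sum_list w + length w * s = 0 + Suc c * s] (mod q)"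
        using that T(3)[of w] by (intro cong_add) (auto simp: Norm_def cong_0_iff)
      then show ?thesis using cong_trans[OF sum_list_shift] by simp
    qed
    have "[Suc c * s = Suc c * s'] (mod q)"
      using cong_trans[OF cong_sym[OF z[OF w(1), of s]]] z[OF w(2), of s'] w(5) by simp
    then have "[s = s'] (mod q)" using cop by (simp only: cong_mult_lcancel_nat)
    then show ?thesis using w by (simp add: cong_def)
  qed
  have free: "w = w' \<and> s = s'" if w: "w \<in> Norm" "w' \<in> Norm" "s < q" "s' < q" "shift s w = shift s' w'" for w w' s s'
  proof -
    have s: "s = s'" using same_shift[OF w(1-4)] w(5) by simp
    have u: "u = shift (q - s) (shift s u)" if "u \<in> Norm" for u
    proof -
      have "u \<in> W" using that T(4) by (simp add: Norm_def)
      then have "shift s (shift (q - s) u) = u" using shift_surj w(3) by blast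
      then show ?thesis using w(3) by (simp add: shift_shift)
    qed
    have "w = w'" using u[OF w(1)] u[OF w(2)] w(5) s by simp
    then show ?thesis using s by simp
  qed
  have hdN: "hd (shift s w) = hd (shift s' w')"
    if w: "w \<in> N r" "w' \<in> N r" "s < q" "s' < q" "set (shift s w) = set (shift s' w')" for w w' s s' r
  proof -
    have wn: "w \<in> Norm" "w' \<in> Norm" "rank w = rank w'" using w by (auto simp: N_def)
    have wT: "w \<in> T" "w' \<in> T" using wn by (auto simp: Norm_def)
    have dis: "distinct (shift k u)" if "u \<in> T" for u k
      using shift_in_W[OF T(4)[OF that]] by (auto simp: words_def)
    have "sum_list (shift s w) = sum_list (shift s' w')"
      using w(5) dis[OF wT(1)] dis[OF wT(2)] by (simp add: distinct_sum_list_conv_Sum)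
    then have s: "s = s'" by (rule same_shift[OF wn(1,2) w(3,4)])
    then have "(\<lambda>i. (i + s) mod q) ` set w = (\<lambda>i. (i + s) mod q) ` set w'"
      using w(5) by (simp add: shift_def)
    then have sw: "set w = set w'" using inj_on_image_eq_iff[OF inj_on_shift T(2)[OF wT(1)] T(2)[OF wT(2)]] by simp
    have ne: "w \<noteq> []" "w' \<noteq> []" using T(3)[OF wT(1)] T(3)[OF wT(2)] by auto
    have lt: "rank u < rank v" if "hd u < hd v" "set u = set v" "u \<noteq> []" for u v
      unfolding rank_def
    proof (rule psubset_card_mono)
      show "{i \<in> set u. i < hd u} \<subset> {i \<in> set v. i < hd v}"
        using that hd_in_set[of u] by auto
    qed simp
    have "hd w = hd w'" using lt[of w w'] lt[of w' w] sw ne wn(3) by (cases "hd w" "hd w'" rule: linorder_cases) simp_all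
    then show ?thesis using s ne by (simp add: shift_def hd_map)
  qed
  have rank_le: "rank w \<in> {..c}" if "w \<in> Norm" for w
  proof -
    have wT: "w \<in> T" using that by (simp add: Norm_def)
    have "w \<noteq> []" using T(3)[OF wT] by auto
    then have "{i \<in> set w. i < hd w} \<subset> set w" using hd_in_set by blast
    then have "rank w < card (set w)" unfolding rank_def by (intro psubset_card_mono) auto
    then show ?thesis using T(1,3)[OF wT] by (simp add: distinct_card)
  qed
  have "card Norm \<le> (\<Sum>r\<le>c. card (N r))"
  proof -
    have "Norm = (\<Union>r\<le>c. N r)" using rank_le by (auto simp: N_def)
    then show ?thesis using card_UN_le[of "{..c}" N] by simp
  qed
  moreover have "\<exists>r\<le>c. (\<Sum>r\<le>c. card (N r)) \<le> Suc c * card (N r)"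
  proof -
    define m where "m = Max ((\<lambda>r. card (N r)) ` {..c})"
    have "m \<in> (\<lambda>r. card (N r)) ` {..c}" unfolding m_def by (rule Max_in) auto
    then obtain r where r: "r \<le> c" "m = card (N r)" by auto
    have "(\<Sum>r\<le>c. card (N r)) \<le> (\<Sum>r\<le>c. m)" by (rule sum_mono) (simp add: m_def)
    then show ?thesis using r by auto
  qed
  ultimately obtain r where r: "card Norm \<le> Suc c * card (N r)" by (meson le_trans)
  have "card T \<le> q * card Norm"
  proof -
    have "T \<subseteq> (\<Union>s<q. shift s ` Norm)"
    proof
      fix w assume w: "w \<in> T"
      obtain x where x: "[Suc c * x = 1] (mod q)" using cong_solve_coprime_nat[OF cop] by auto
      \<comment> \<open>The solution of \<open>sum_list w + (c + 1) * s = 0\<close> modulo \<open>q\<close>, with \<open>q - 1\<close> in the role of \<open>-1\<close>.\<close>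
      define s where "s = (x * (sum_list w * (q - 1))) mod q"
      have "[sum_list (shift s w) = sum_list w + Suc c * s] (mod q)"
        using sum_list_shift[of s w] T(3)[OF w] by simp
      also have "[sum_list w + Suc c * s = sum_list w + (Suc c * x) * (sum_list w * (q - 1))] (mod q)"
      proof -
        have "[Suc c * s = Suc c * (x * (sum_list w * (q - 1)))] (mod q)"
          unfolding s_def by (intro cong_mult cong_refl) (simp add: cong_def)
        then show ?thesis by (intro cong_add cong_refl) (simp only: mult.assoc)
      qed
      also have "[sum_list w + (Suc c * x) * (sum_list w * (q - 1)) = sum_list w + 1 * (sum_list w * (q - 1))] (mod q)"
        by (intro cong_add cong_mult x cong_refl)
      also have "sum_list w + 1 * (sum_list w * (q - 1)) = sum_list w * q"
        using q0 by (cases q) (simp_all add: algebra_simps)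
      finally have "q dvd sum_list (shift s w)" by (simp add: cong_def mod_eq_0_iff_dvd)
      then have sN: "shift s w \<in> Norm"
        using shift_in_W[OF T(4)[OF w], of s] T(3)[OF w] by (simp add: Norm_def T_def)
      have sq: "s < q" using q0 by (simp add: s_def)
      have "shift ((q - s) mod q) (shift s w) = shift (q - s) (shift s w)" by (rule shift_mod)
      also have "\<dots> = shift s (shift (q - s) w)" using sq by (simp add: shift_shift)
      also have "\<dots> = w" using shift_surj[OF T(4)[OF w] sq] .
      finally have "w = shift ((q - s) mod q) (shift s w)" ..
      moreover have "(q - s) mod q < q" using q0 by simp
      ultimately show "w \<in> (\<Union>s<q. shift s ` Norm)" using sN by blast
    qed
    moreover have finNorm: "finite Norm" using finT by (simp add: Norm_def)
    ultimately have "card T \<le> card (\<Union>s<q. shift s ` Norm)" by (intro card_mono) auto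
    also have "\<dots> \<le> (\<Sum>s<q. card (shift s ` Norm))" by (rule card_UN_le) simp
    also have "\<dots> \<le> (\<Sum>s<q. card Norm)" by (intro sum_mono card_image_le finNorm)
    finally show ?thesis by simp
  qed
  then have "card T \<le> q * (Suc c * card (N r))" using r by (meson le_trans mult_le_mono2)
  moreover have "\<forall>w \<in> N r. w \<in> W \<and> length w = Suc c" by (simp add: N_def Norm_def T_def)
  moreover have "N r \<subseteq> Norm" by (auto simp: N_def)
  ultimately show ?thesis using free hdN unfolding T_def by (intro exI[of _ "N r"]) blast
qed

lemma card_cost_words:
  "card cost_words \<le> c * q ^ (c - 1) + card {w \<in> marked_words q d c. hd w = Max (set w)}"
proof -
  let ?A = "\<Union>n\<in>{1..<c}. {w :: nat list. set w \<subseteq> {..<q} \<and> length w = n}"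
  let ?B = "{w \<in> marked_words q d c. hd w = Max (set w)}"
  have "cost_words \<subseteq> ?A \<union> ?B"
  proof
    fix w assume w: "w \<in> cost_words"
    then have l: "w \<noteq> []" "set w \<subseteq> {..<q}" using letters by (auto simp: cost_words_def)
    show "w \<in> ?A \<union> ?B"
    proof (cases "length w < c")
      case True
      then have "length w \<in> {1..<c}" using l by (cases w) auto
      then show ?thesis using l by blast
    next
      case False
      then show ?thesis using w by (auto simp: cost_words_def good_def marked_words_def)
    qed
  qed
  moreover have fA: "finite ?A" by (intro finite_UN_I finite_lists_length_eq) auto
  moreover have "finite ?B" using finite_marked_words by simp
  ultimately have "card cost_words \<le> card (?A \<union> ?B)" by (intro card_mono) auto
  also have "\<dots> \<le> card ?A + card ?B" by (rule card_Un_le)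
  also have "card ?A \<le> (\<Sum>n\<in>{1..<c}. card {w :: nat list. set w \<subseteq> {..<q} \<and> length w = n})"
    by (rule card_UN_le) simp
  also have "\<dots> \<le> (\<Sum>n\<in>{1..<c}. q ^ (c - 1))"
    by (rule sum_mono) (use q0 in \<open>auto simp: card_lists_length_eq intro!: power_increasing\<close>)
  also have "\<dots> \<le> c * q ^ (c - 1)" by simp
  finally show ?thesis by simp
qed

lemma order_Mod: "J \<lhd> gen_group \<Longrightarrow> order (gen_group Mod J) * card J = card gen_set"
  using group.lagrange[OF group_gen_group, of J] normal_imp_subgroup[of J gen_group]
  by (simp add: FactGroup_def order_def)

text \<open>The index of \<open>top_layer\<close> is a power of \<open>p\<close> with exponent at most \<open>C\<close>, and the cut makes up for
  the exact difference to \<open>t\<close>.  The parameter \<open>R\<close> is a lower bound for the number of orbits of leading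
  words.\<close>

lemma many_quotients:
  assumes m: "m1 = p ^ a" "m2 = p ^ b" and cop: "coprime (Suc c) q"
    and C: "e + a + b + card cost_words \<le> C" "C \<le> t"
    and R: "card {w \<in> W. length w = Suc c} \<ge> q * (Suc c * R)" "t div q + q \<le> R"
  shows "\<exists>\<J>. (\<forall>J \<in> \<J>. J \<lhd> gen_group \<and> J \<subseteq> top_layer \<and> order (gen_group Mod J) = p ^ t) \<and>
    p ^ ((t - C - q) * (R - (t div q + q))) \<le> card \<J>"
proof -
  have oA: "order ambient = p ^ (e + card (W - {[]}) + (a + b))"
  proof -
    have "order ambient = q * p ^ card (W - {[]}) * (m1 * m2)" by (rule order_ambient)
    also have "\<dots> = p ^ (e + card (W - {[]}) + (a + b))" by (simp add: m q_def power_add)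
    finally show ?thesis .
  qed
  have lag: "card S dvd p ^ (e + card (W - {[]}) + (a + b))" if "subgroup S ambient" for S
  proof (rule dvdI)
    show "p ^ (e + card (W - {[]}) + (a + b)) = card S * card (rcosets\<^bsub>ambient\<^esub> S)"
      using amb.lagrange[OF that] unfolding oA by (simp only: mult.commute)
  qed
  obtain n where n: "card gen_set = p ^ n" using divides_primepow_nat[OF prime_p, THEN iffD1, OF lag[OF gen_set_subgroup]] by blast
  obtain \<mu> where \<mu>: "card top_layer = p ^ \<mu>" using divides_primepow_nat[OF prime_p, THEN iffD1, OF lag[OF top_layer_subgroup]] by blast
  have "p ^ n \<le> p ^ (\<mu> + (e + a + b + card cost_words))"
  proof -
    have "p ^ n \<le> p ^ \<mu> * (q * (m1 * m2) * p ^ card cost_words)" using card_gen_set_le by (simp only: n \<mu>)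
    also have "\<dots> = p ^ (\<mu> + (e + a + b + card cost_words))" by (simp add: m q_def power_add mult_ac)
    finally show ?thesis .
  qed
  then have "n \<le> \<mu> + (e + a + b + card cost_words)" by (rule power_le_imp_le_exp[OF p1])
  then have nm: "n - \<mu> \<le> C" using C by simp
  have "finite gen_set" using finite_ambient gen_set_carrier by (meson finite_subset subsetI)
  then have "card top_layer \<le> card gen_set" using top_layer_gen_set by (intro card_mono) auto
  then have "p ^ \<mu> \<le> p ^ n" by (simp only: n \<mu>)
  then have \<mu>n: "\<mu> \<le> n" by (rule power_le_imp_le_exp[OF p1])
  \<comment> \<open>The number of equations to impose on \<open>top_layer\<close>.\<close>
  define k where "k = t - (n - \<mu>)"
  define r where "r = k div q"
  define s0 where "s0 = k mod q"
  have k: "t - C \<le> k" "k \<le> t" "k + (n - \<mu>) = t" using nm C by (auto simp: k_def)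
  have rk: "r * q + s0 = k" by (simp add: r_def s0_def)
  have rs: "r + s0 \<le> t div q + q"
    using div_le_mono[OF k(2), of q] mod_less_divisor[OF q0, of k] by (simp add: r_def s0_def)
  obtain N where N: "\<forall>w \<in> N. w \<in> W \<and> length w = Suc c"
    "\<forall>w \<in> N. \<forall>w' \<in> N. \<forall>s<q. \<forall>s'<q. shift s w = shift s' w' \<longrightarrow> w = w' \<and> s = s'"
    "\<forall>w \<in> N. \<forall>w' \<in> N. \<forall>s<q. \<forall>s'<q. set (shift s w) = set (shift s' w') \<longrightarrow> hd (shift s w) = hd (shift s' w')"
    "card {w \<in> W. length w = Suc c} \<le> q * (Suc c * card N)"
    using ex_leads[OF cop] by blast
  have RN: "R \<le> card N"
    using le_trans[OF R(1) N(4)] q0 by (simp only: mult_le_cancel1 Suc_mult_le_cancel1 simp_thms)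
  have rsN: "r + s0 \<le> card N" using rs R(2) RN by linarith
  obtain \<J> where J: "card \<J> = p ^ (r * (q * (card N - (r + s0))))"
    "\<forall>J \<in> \<J>. J \<lhd> gen_group \<and> J \<subseteq> top_layer \<and> card top_layer = p ^ (r * q + s0) * card J"
    using many_normal_subgroups[of N r s0] N rsN by blast
  have ord: "order (gen_group Mod J) = p ^ t" if "J \<in> \<J>" for J
  proof -
    have j: "J \<lhd> gen_group" "card top_layer = p ^ k * card J" using J(2) that rk by auto
    have "card J > 0" using j(2) \<mu> p1 by (cases "card J") auto
    have "p ^ n = p ^ (n - \<mu>) * p ^ \<mu>" using \<mu>n by (simp add: power_add[symmetric])
    also have "\<dots> = p ^ (n - \<mu>) * (p ^ k * card J)" using j(2) \<mu> by simp
    also have "\<dots> = p ^ t * card J" unfolding k(3)[symmetric] power_add by (simp only: mult.assoc mult.left_commute)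
    finally have "order (gen_group Mod J) * card J = p ^ t * card J" using order_Mod[OF j(1)] n by simp
    then show ?thesis using \<open>card J > 0\<close> by simp
  qed
  have "(t - C - q) * (R - (t div q + q)) \<le> r * (q * (card N - (r + s0)))"
  proof -
    have "t - C - q \<le> r * q" using k(1) rk mod_less_divisor[OF q0, of k] unfolding s0_def by linarith
    moreover have "R - (t div q + q) \<le> card N - (r + s0)" using rs RN by linarith
    ultimately have "(t - C - q) * (R - (t div q + q)) \<le> (r * q) * (card N - (r + s0))" by (rule mult_le_mono)
    then show ?thesis by (simp add: mult.assoc)
  qed
  then have big: "p ^ ((t - C - q) * (R - (t div q + q))) \<le> card \<J>"
    unfolding J(1) by (rule power_increasing[OF _ less_imp_le[OF p1]])
  show ?thesis
  proof (intro exI[of _ \<J>] conjI ballI)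
    fix J assume "J \<in> \<J>"
    then show "J \<lhd> gen_group" "J \<subseteq> top_layer" "order (gen_group Mod J) = p ^ t" using J(2) ord by blast+
  qed (rule big)
qed

section \<open>Beauville and other quotients of the group\<close>

lemma generate_gen_group: "generate gen_group {gen_x, gen_y} = carrier gen_group"
  using amb.generate_consistent[of "{gen_x, gen_y}" gen_set] gen_set_subgroup gens_in_gen_set by (simp add: gen_set_def)

lemma pow_gen_group: "g [^]\<^bsub>gen_group\<^esub> (n :: nat) = g [^]\<^bsub>ambient\<^esub> n"
  by (simp add: nat_pow_def)

lemma fst_snd_hom: "(\<lambda>g. fst (snd g)) \<in> hom gen_group (integer_mod_group m1)"
  and snd_snd_hom: "(\<lambda>g. snd (snd g)) \<in> hom gen_group (integer_mod_group m2)"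
  using m1 m2 by (auto simp: hom_def snd_mult carrier_integer_mod_group carrier_ambient dest!: gen_set_carrier)

text \<open>The cyclic factors have as order a number \<open>N\<close> that annihilates the core.  So \<open>N\<close> is an exponent of the whole
  group, and the two cyclic coordinates are characters with values modulo \<open>N\<close> that vanish on
  \<open>top_layer\<close>.\<close>

lemma quotient_is_beauville:
  fixes H :: "nat monoid"
  assumes p5: "p \<ge> 5" and m: "m1 = q * p ^ Suc c" "m2 = q * p ^ Suc c"
    and H: "group H" "order H > 0" and \<theta>: "\<theta> \<in> hom gen_group H" "\<theta> ` carrier gen_group = carrier H" "kernel gen_group H \<theta> \<subseteq> top_layer"
  shows "beauville_group H"
proof -
  let ?N = "q * p ^ Suc c"
  have gh: "group_hom gen_group H \<theta>" using group_gen_group H \<theta> by (simp add: group_hom_def group_hom_axioms_def)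
  have N: "?N = p ^ (e + Suc c)" by (simp add: q_def power_add)
  have "coprime 2 p" "coprime 3 p"
    using primes_coprime[OF two_is_prime_nat prime_p] primes_coprime[OF _ prime_p, of 3] p5 by auto
  then have c6: "coprime 6 ?N" unfolding N by (simp add: coprime_mult_left_iff[of 2 3, simplified])
  have N1: "?N > 1" unfolding N by (rule one_less_power[OF p1]) simp
  interpret \<theta>: group_hom gen_group H \<theta> by (rule gh)
  show ?thesis
  proof (rule beauville_criterion[OF gh \<theta>(2) _ N1 c6, where x = gen_x and y = gen_y
        and \<chi>x = "\<lambda>g. fst (snd g)" and \<chi>y = "\<lambda>g. snd (snd g)"])
    show "finite (carrier H)" using H(2) by (simp add: order_def card_gt_0_iff)
    show "(\<lambda>g. fst (snd g)) \<in> hom gen_group (integer_mod_group ?N)" "(\<lambda>g. snd (snd g)) \<in> hom gen_group (integer_mod_group ?N)"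
      using fst_snd_hom snd_snd_hom m by simp_all
    fix g assume g: "g \<in> carrier gen_group"
    show "\<theta> g = \<one>\<^bsub>H\<^esub> \<Longrightarrow> fst (snd g) = 0 \<and> snd (snd g) = 0"
      using \<theta>(3) g by (auto simp: kernel_def top_layer_def)
    have gc: "g \<in> carrier ambient" using g gen_set_carrier by simp
    have m21: "m2 = m1" using m by simp
    have s: "snd (g [^]\<^bsub>ambient\<^esub> ?N) = (0, 0)"
      unfolding snd_pow[OF gc] unfolding m(1)[symmetric] m21 by simp
    have "g [^]\<^bsub>ambient\<^esub> ?N = \<one>\<^bsub>ambient\<^esub>"
      by (rule prod_eqI) (simp_all only: core_exponent[OF gc] s one_ambient fst_conv snd_conv)
    then show "\<theta> g [^]\<^bsub>H\<^esub> ?N = \<one>\<^bsub>H\<^esub>"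
      using g \<theta>.hom_nat_pow[OF g, of ?N] \<theta>.hom_one by (simp only: pow_gen_group) simp
  next
    show "generate gen_group {gen_x, gen_y} = carrier gen_group" by (rule generate_gen_group)
    have "1 mod int ?N = 1" using N1 by (intro mod_pos_pos_trivial) linarith+
    then have "1 mod int m1 = 1" "1 mod int m2 = 1" using m by simp_all
    then show "fst (snd gen_x) = 1" "snd (snd gen_y) = 1" by (simp_all add: gen_x_def gen_y_def)
  qed (simp_all add: gens_in_gen_set, simp_all add: gen_x_def gen_y_def)
qed

text \<open>With a first cyclic factor of order \<open>p * N\<close> and a trivial second one, the power with exponent \<open>N\<close>
  forgets everything but the first coordinate.  All such powers are powers of \<open>w = gen_x [^] N\<close>, an
  element of order \<open>p\<close> whose image in the quotient is not trivial.\<close>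

lemma quotient_is_not_beauville:
  fixes H :: "nat monoid"
  assumes m: "m1 = p * (q * p ^ Suc c)" "m2 = 1"
    and H: "group H" and \<theta>: "\<theta> \<in> hom gen_group H" "\<theta> ` carrier gen_group = carrier H" "kernel gen_group H \<theta> \<subseteq> top_layer"
  shows "two_generated H \<and> \<not> beauville_group H"
proof
  define N where "N = q * p ^ Suc c"
  have m1N: "m1 = p * N" using m(1) by (simp only: N_def)
  have core: "fst (g [^]\<^bsub>ambient\<^esub> N) = (0, unit_word)" if "g \<in> carrier ambient" for g
    unfolding N_def by (rule core_exponent[OF that])
  have gh: "group_hom gen_group H \<theta>" using group_gen_group H \<theta> by (simp add: group_hom_def group_hom_axioms_def)
  interpret \<theta>: group_hom gen_group H \<theta> by (rule gh)
  have gP: "gen_x \<in> carrier gen_group" "gen_y \<in> carrier gen_group" using gens_in_gen_set by simp_all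
  have "generate H {\<theta> gen_x, \<theta> gen_y} = carrier H"
    using \<theta>.generate_img[of "{gen_x, gen_y}"] gP generate_gen_group \<theta>(2) by simp
  then show "two_generated H" unfolding two_generated_def
    by (intro bexI[of _ "\<theta> gen_x"] bexI[of _ "\<theta> gen_y"] \<theta>.hom_closed gP)
  have N0: "N > 0" using q0 p1 by (simp add: N_def)
  have x1: "fst (snd gen_x) = 1"
  proof -
    have "p \<le> p * k" if "k > 0" for k using that by simp
    from less_le_trans[OF p1 this[OF N0]] have "1 < p * N" .
    then have "1 mod int (p * N) = 1" by (intro mod_pos_pos_trivial) linarith+
    then have "1 mod int m1 = 1" by (simp only: m1N)
    then show ?thesis by (simp add: gen_x_def)
  qed
  have x: "gen_x \<in> carrier ambient" using gens by simp
  define w where "w = \<theta> (gen_x [^]\<^bsub>ambient\<^esub> N)"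
  have pw: "\<theta> g [^]\<^bsub>H\<^esub> (k :: nat) = \<theta> (g [^]\<^bsub>ambient\<^esub> k)" if "g \<in> carrier gen_group" for g k
    using \<theta>.hom_nat_pow[OF that, of k] by (simp only: pow_gen_group)
  have w': "w = \<theta> gen_x [^]\<^bsub>H\<^esub> N" unfolding w_def by (rule pw[OF gP(1), symmetric])
  have wc: "w \<in> carrier H" unfolding w' using gP by simp
  show "\<not> beauville_group H"
  proof (rule not_beauville_criterion[OF gh \<theta>(2) prime_p, where l = m1 and \<chi> = "\<lambda>g. fst (snd g)"
        and x = gen_x and w = w and N = N])
    show "p dvd m1" by (simp add: m1N)
    show "(\<lambda>g. fst (snd g)) \<in> hom gen_group (integer_mod_group m1)" by (rule fst_snd_hom)
    show "w \<noteq> \<one>\<^bsub>H\<^esub>"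
    proof
      assume "w = \<one>\<^bsub>H\<^esub>"
      moreover have "gen_x [^]\<^bsub>ambient\<^esub> N \<in> gen_set"
        using amb.subgroup_int_pow_closed[OF gen_set_subgroup gens_in_gen_set(1), of "int N"] by (simp only: int_pow_int)
      ultimately have "gen_x [^]\<^bsub>ambient\<^esub> N \<in> top_layer" using \<theta>(3) by (auto simp: kernel_def w_def)
      then have "int N mod int m1 = 0" using snd_pow[OF x, of N] x1 by (simp add: top_layer_def)
      moreover have "int N < int m1" using N0 p1 unfolding m1N by (simp only: of_nat_less_iff) simp
      ultimately show False using N0 by simp
    qed
    show "w [^]\<^bsub>H\<^esub> p = \<one>\<^bsub>H\<^esub>"
    proof -
      have "gen_x [^]\<^bsub>ambient\<^esub> (p * N) = \<one>\<^bsub>ambient\<^esub>"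
      proof -
        have "gen_x [^]\<^bsub>ambient\<^esub> (p * N) = (gen_x [^]\<^bsub>ambient\<^esub> p) [^]\<^bsub>ambient\<^esub> N"
          using x by (simp only: amb.nat_pow_pow)
        then have "fst (gen_x [^]\<^bsub>ambient\<^esub> (p * N)) = (0, unit_word)"
          using core[of "gen_x [^]\<^bsub>ambient\<^esub> p"] x by simp
        moreover have "snd (gen_x [^]\<^bsub>ambient\<^esub> (p * N)) = (0, 0)"
        proof -
          have "int (p * N) mod int m1 = 0" using m1N by simp
          moreover have "z mod int m2 = 0" for z using m(2) by simp
          ultimately show ?thesis by (simp only: snd_pow[OF x] x1 mult_1_right)
        qed
        ultimately show ?thesis by (simp only: one_ambient prod_eq_iff) simp
      qed
      then have "\<theta> gen_x [^]\<^bsub>H\<^esub> (N * p) = \<one>\<^bsub>H\<^esub>"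
        using pw[OF gP(1), of "p * N"] \<theta>.hom_one by (simp only: mult.commute) simp
      then show ?thesis unfolding w' using gP by (simp only: \<theta>.H.nat_pow_pow \<theta>.hom_closed)
    qed
    fix g assume g: "g \<in> carrier gen_group"
    have gc: "g \<in> carrier ambient" using g gen_set_carrier by simp
    define k where "k = nat (fst (snd g))"
    have k: "int k = fst (snd g)" using gc by (auto simp: k_def carrier_ambient)
    have "g [^]\<^bsub>ambient\<^esub> N = gen_x [^]\<^bsub>ambient\<^esub> (N * k)"
    proof (rule prod_eqI)
      have "gen_x [^]\<^bsub>ambient\<^esub> (N * k) = (gen_x [^]\<^bsub>ambient\<^esub> k) [^]\<^bsub>ambient\<^esub> N"
        using x by (simp only: amb.nat_pow_pow mult.commute)
      then show "fst (g [^]\<^bsub>ambient\<^esub> N) = fst (gen_x [^]\<^bsub>ambient\<^esub> (N * k))"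
        using core[OF gc] core[of "gen_x [^]\<^bsub>ambient\<^esub> k"] x by simp
      show "snd (g [^]\<^bsub>ambient\<^esub> N) = snd (gen_x [^]\<^bsub>ambient\<^esub> (N * k))"
        unfolding snd_pow[OF gc] snd_pow[OF x] using x1 k by (simp add: m(2))
    qed
    then have "\<theta> g [^]\<^bsub>H\<^esub> N = \<theta> gen_x [^]\<^bsub>H\<^esub> (N * k)" using pw[OF g] pw[OF gP(1)] by simp
    also have "\<dots> = w [^]\<^bsub>H\<^esub> k" unfolding w' using gP by (simp only: \<theta>.H.nat_pow_pow \<theta>.hom_closed)
    also have "\<dots> = w [^]\<^bsub>H\<^esub> fst (snd g)" unfolding k[symmetric] by (simp only: int_pow_int)
    finally show "\<theta> g [^]\<^bsub>H\<^esub> N = w [^]\<^bsub>H\<^esub> fst (snd g)" .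
  qed (use gP x1 wc in auto)
qed

section \<open>Asymptotics\<close>

lemma num_groups_lower:
  assumes m: "m1 = p ^ a" "m2 = p ^ b" and cop: "coprime (Suc c) q"
    and C: "e + a + b + card cost_words \<le> C" "C \<le> t"
    and R: "card {w \<in> W. length w = Suc c} \<ge> q * (Suc c * R)" "t div q + q \<le> R"
    and Q: "\<And>(H :: nat monoid) \<theta>. \<lbrakk>group H; order H > 0; \<theta> \<in> hom gen_group H; \<theta> ` carrier gen_group = carrier H;
      kernel gen_group H \<theta> \<subseteq> top_layer\<rbrakk> \<Longrightarrow> Q H"
  shows "p ^ ((t - C - q) * (R - (t div q + q))) \<le> num_groups_up_to_iso Q (p ^ t) * (p ^ t)\<^sup>2"
proof -
  obtain \<J> where J: "\<forall>J \<in> \<J>. J \<lhd> gen_group \<and> J \<subseteq> top_layer \<and> order (gen_group Mod J) = p ^ t"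
    "p ^ ((t - C - q) * (R - (t div q + q))) \<le> card \<J>"
    using many_quotients[OF m cop C R] by blast
  have pt: "p ^ t > 0" using p1 by (intro zero_less_power) linarith
  have "card \<J> \<le> num_groups_up_to_iso Q (p ^ t) * (p ^ t)\<^sup>2"
  proof (rule card_le_num_groups[OF group_gen_group _ _ generate_gen_group pt])
    show "gen_x \<in> carrier gen_group" "gen_y \<in> carrier gen_group" using gens_in_gen_set by simp_all
    show "J \<lhd> gen_group \<and> order (gen_group Mod J) = p ^ t" if "J \<in> \<J>" for J using J(1) that by blast
    fix J and H :: "nat monoid" and \<theta>
    assume h: "J \<in> \<J>" "group H" "order H = p ^ t" "\<theta> \<in> hom gen_group H" "\<theta> ` carrier gen_group = carrier H" "kernel gen_group H \<theta> = J"
    have "kernel gen_group H \<theta> \<subseteq> top_layer" using J(1) h by blast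
    moreover have "order H > 0" using h pt by simp
    ultimately show "Q H" using Q h by blast
  qed
  then show ?thesis using J(2) by (rule le_trans[rotated])
qed

text \<open>The main terms are \<open>C \<approx> t / 2\<close>, because \<open>1 / c\<close> of the \<open>c * t / 2\<close> marked words of length \<open>c\<close> are
  cost words, and \<open>R \<approx> \<gamma> * t / 2\<close> with \<open>\<gamma> = (c - 2) / (c + 1)\<close>, where \<open>c - 2\<close> comes from
  \<open>card_marked_step\<close> and \<open>c + 1\<close> from the rank of the first letter in \<open>ex_leads\<close>.  The product is
  \<open>\<gamma> / 4\<close> times \<open>t\<^sup>2\<close>; all other terms are at most multiples of \<open>\<epsilon> * t\<close>.\<close>

lemma exponent_bound:
  fixes \<epsilon> :: real
  assumes c3: "c \<ge> 3"
    and tune: "card (marked_words q d c) \<le> c * (t div 2)" "c * (t div 2) < card (marked_words q d c) + c\<^sup>2 * q ^ (c - 1)"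
    and ab: "a + b \<le> 2 * (e + c + 2)"
    and small: "real q ^ (c - 1) \<le> \<epsilon> * t" "real c \<le> \<epsilon> * q" "1 \<le> \<epsilon> * t"
    and \<epsilon>: "\<epsilon> > 0" "(3 * c + 8) * \<epsilon> \<le> 1 / 2" "(c + 6) * \<epsilon> \<le> (real c - 2) / (c + 1) / 2"
    and C: "C = e + a + b + card cost_words"
    and R: "R = card {w \<in> W. length w = Suc c} div (q * Suc c)"
  shows "C \<le> t" "t div q + q \<le> R"
    "real t ^ 2 * ((real c - 2) / (c + 1) / 4 - (4 * c + 14) * \<epsilon>) \<le> real ((t - C - q) * (R - (t div q + q)))"
proof -
  define B where "B = card (marked_words q d c)"
  define B1 where "B1 = card (marked_words q d (c - 1))"
  define top where "top = card {w \<in> W. length w = Suc c}"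
  define \<gamma> where "\<gamma> = (real c - 2) / (c + 1)"
  define Q where "Q = real q ^ (c - 1)"
  have \<gamma>: "0 \<le> \<gamma>" "\<gamma> \<le> 1" using c3 by (auto simp: \<gamma>_def divide_simps)
  have q1: "real q \<ge> 1" using q0 by simp
  have qQ: "real q \<le> Q"
    using power_increasing[of 1 "c - 1" "real q"] q1 c3 by (simp add: Q_def)
  have eq: "real e \<le> real q"
  proof -
    have "e < p ^ e" using p1 by (intro power_gt_expt) simp
    then show ?thesis using q_def by simp
  qed
  have cpos: "real c > 0" using c3 by simp
  have mf: "real (card {w \<in> marked_words q d c. hd w = Max (set w)}) \<le> t / 2"
  proof -
    have "c * card {w \<in> marked_words q d c. hd w = Max (set w)} \<le> c * (t div 2)"
      using card_max_first[of c q d] c3 tune(1) by linarith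
    then have "card {w \<in> marked_words q d c. hd w = Max (set w)} \<le> t div 2" using c3 by simp
    then show ?thesis by linarith
  qed
  have cost: "real (card cost_words) \<le> c * Q + t / 2"
  proof -
    have "real (card cost_words) \<le> real (c * q ^ (c - 1) + card {w \<in> marked_words q d c. hd w = Max (set w)})"
      using card_cost_words by (simp only: of_nat_le_iff)
    then show ?thesis using mf by (simp add: Q_def)
  qed
  have Cq: "real C + real q \<le> t / 2 + (3 * c + 8) * \<epsilon> * t"
  proof -
    have "real C = e + real (a + b) + card cost_words" using C by simp
    also have "\<dots> \<le> e + 2 * (e + c + 2) + (c * Q + t / 2)"
      using ab cost by (intro add_mono) (simp_all only: of_nat_le_iff of_nat_add of_nat_mult order_refl, simp)
    also have "\<dots> \<le> t / 2 + (c + 3) * Q + (2 * c + 4)" using eq qQ by (simp add: algebra_simps)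
    finally have "real C + real q \<le> t / 2 + (c + 4) * Q + (2 * c + 4) * 1" using qQ by (simp add: algebra_simps)
    also have "\<dots> \<le> t / 2 + (c + 4) * (\<epsilon> * t) + (2 * c + 4) * (\<epsilon> * t)"
      using small by (intro add_mono mult_left_mono) (auto simp: Q_def)
    also have "\<dots> = t / 2 + (3 * c + 8) * \<epsilon> * t" by (simp add: algebra_simps)
    finally show ?thesis .
  qed
  have half: "(1 / 2 - (3 * c + 8) * \<epsilon>) * t \<le> real t - C - q" using Cq by (simp add: algebra_simps)
  have "(1 / 2 - (3 * c + 8) * \<epsilon>) * t \<ge> 0" using \<epsilon> by (intro mult_nonneg_nonneg) auto
  then have CqT: "real C + real q \<le> real t" using half by linarith
  then show "C \<le> t" by linarith
  have tC: "real (t - C - q) = real t - C - q" using CqT by linarith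
  have Bc: "B / c \<ge> t / 2 - (c + 1) * \<epsilon> * t"
  proof -
    have "real (c * (t div 2)) \<le> real (B + c\<^sup>2 * q ^ (c - 1))"
      using tune(2) unfolding B_def by (simp only: of_nat_le_iff less_imp_le)
    then have "c * real (t div 2) \<le> B + c * (c * Q)" by (simp add: Q_def power2_eq_square)
    then have "real (t div 2) \<le> (B + c * (c * Q)) / c" using cpos by (simp add: field_simps)
    also have "\<dots> = B / c + c * Q" using cpos by (simp add: field_simps)
    finally have "real (t div 2) \<le> B / c + c * Q" .
    moreover have "(real t - 1) / 2 \<le> real (t div 2)"
    proof -
      have "t \<le> 2 * (t div 2) + 1" by simp
      then have "real t \<le> real (2 * (t div 2) + 1)" by (simp only: of_nat_le_iff)
      then show ?thesis by simp
    qed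
    moreover have "c * Q \<le> c * (\<epsilon> * t)" using small by (intro mult_left_mono) (auto simp: Q_def)
    moreover have "1 / 2 \<le> \<epsilon> * t" using small by linarith
    moreover have "(c + 1) * \<epsilon> * t = c * (\<epsilon> * t) + \<epsilon> * t" by (simp add: algebra_simps)
    ultimately show ?thesis by linarith
  qed
  have \<epsilon>1: "\<epsilon> \<le> 1"
  proof -
    have "1 * \<epsilon> \<le> (3 * c + 8) * \<epsilon>" using \<epsilon>(1) by (intro mult_right_mono) auto
    then show ?thesis using \<epsilon> by linarith
  qed
  have cq: "c \<le> q"
  proof -
    have "\<epsilon> * q \<le> 1 * real q" using \<epsilon>1 by (intro mult_right_mono) auto
    then show ?thesis using small(2) by linarith
  qed
  have topB: "\<gamma> * (1 - 2 * \<epsilon>) * (B / c) \<le> top / (q * Suc c)"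
  proof -
    have "(c - 2) * B \<le> c * q * B1"
    proof -
      obtain n where n: "c = Suc (Suc n)" using c3 by (metis Suc_le_D numeral_3_eq_3 Suc_le_mono)
      show ?thesis using card_marked_step[of n q d] by (simp add: n B_def B1_def)
    qed
    then have "real ((c - 2) * B) \<le> real (c * q * B1)" by (simp only: of_nat_le_iff)
    then have 1: "(real c - 2) * B \<le> c * q * B1" using c3 by (simp add: of_nat_diff)
    have "B1 * (q - c)\<^sup>2 \<le> top"
      using card_top_words[of q d "c - 1"] c3 by (simp add: B1_def top_def)
    then have "real (B1 * (q - c)\<^sup>2) \<le> real top" by (simp only: of_nat_le_iff)
    then have 2: "B1 * (real q - c)\<^sup>2 \<le> top" using cq by (simp add: of_nat_diff)
    have "1 - 2 * \<epsilon> \<le> (1 - \<epsilon>)\<^sup>2" by (simp add: power2_eq_square algebra_simps)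
    also have "\<dots> \<le> ((real q - c) / q)\<^sup>2"
    proof (rule power_mono)
      show "1 - \<epsilon> \<le> (real q - c) / q" using small(2) q1 by (simp add: field_simps)
    qed (use \<epsilon>1 in simp)
    finally have 3: "(1 - 2 * \<epsilon>) * q\<^sup>2 \<le> (real q - c)\<^sup>2" using q1 by (simp add: power_divide field_simps)
    have "\<gamma> * (1 - 2 * \<epsilon>) * (B / c) = ((real c - 2) * B) * ((1 - 2 * \<epsilon>) * q\<^sup>2) / (c * q * (q * (c + 1)))"
    proof -
      let ?X = "(real c - 2) * B * (1 - 2 * \<epsilon>)"
      have "((real c - 2) * B) * ((1 - 2 * \<epsilon>) * q\<^sup>2) / (c * q * (q * (c + 1)))
        = (?X * (real q)\<^sup>2) / ((real c * (real c + 1)) * (real q)\<^sup>2)"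
      proof (rule arg_cong2[where f = "(/)"])
        show "((real c - 2) * B) * ((1 - 2 * \<epsilon>) * q\<^sup>2) = ?X * (real q)\<^sup>2" by (simp add: mult_ac)
      qed (simp add: power2_eq_square algebra_simps)
      also have "\<dots> = ?X / (real c * (real c + 1))" using q1 by (intro mult_divide_mult_cancel_right) simp
      finally show ?thesis by (simp add: \<gamma>_def mult_ac)
    qed
    also have "\<dots> \<le> ((real c - 2) * B) * (real q - c)\<^sup>2 / (c * q * (q * (c + 1)))"
      using c3 by (intro divide_right_mono mult_left_mono 3) auto
    also have "\<dots> \<le> (c * q * B1) * (real q - c)\<^sup>2 / (c * q * (q * (c + 1)))"
      by (intro divide_right_mono mult_right_mono 1) auto
    also have "\<dots> = ((real c * q) * (B1 * (real q - c)\<^sup>2)) / ((real c * q) * (q * (c + 1)))"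
      by (rule arg_cong2[where f = "(/)"]) (simp_all add: mult_ac)
    also have "\<dots> = (B1 * (real q - c)\<^sup>2) / (q * (c + 1))"
      using cpos q1 by (intro mult_divide_mult_cancel_left) simp
    also have "\<dots> \<le> top / (q * (c + 1))" by (intro divide_right_mono 2) auto
    finally show ?thesis by (simp add: add.commute)
  qed
  have Rtop: "top / (q * Suc c) - 1 \<le> R"
  proof -
    define D where "D = q * Suc c"
    have D0: "D > 0" using q0 by (simp add: D_def)
    have "top \<le> D * (top div D) + D"
      using mult_div_mod_eq[of D top] mod_less_divisor[OF D0, of top] by linarith
    then have "real top \<le> real (D * (top div D) + D)" by (simp only: of_nat_le_iff)
    then have "real top \<le> (real (top div D) + 1) * real D" by (simp add: algebra_simps)
    then have "real top / real D \<le> real (top div D) + 1" using D0 by (simp add: pos_divide_le_eq)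
    then have "top / (q * Suc c) \<le> real (top div (q * Suc c)) + 1" by (simp only: D_def)
    then show ?thesis by (simp add: R top_def)
  qed
  have R1: "\<gamma> / 2 * t - (c + 4) * \<epsilon> * t \<le> R"
  proof -
    have "\<gamma> * t / 2 - (c + 2) * \<epsilon> * t \<le> \<gamma> * (1 - 2 * \<epsilon>) * (t / 2 - (c + 1) * \<epsilon> * t)"
    proof -
      have "\<gamma> * (1 - 2 * \<epsilon>) * (t / 2 - (c + 1) * \<epsilon> * t)
        = \<gamma> * t / 2 - \<gamma> * ((c + 2) * \<epsilon> * t) + 2 * \<gamma> * (c + 1) * \<epsilon> * \<epsilon> * t"
        by (simp add: algebra_simps)
      moreover have "\<gamma> * ((c + 2) * \<epsilon> * t) \<le> 1 * ((c + 2) * \<epsilon> * t)"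
        using \<gamma> \<epsilon> by (intro mult_right_mono) auto
      moreover have "0 \<le> 2 * \<gamma> * (c + 1) * \<epsilon> * \<epsilon> * t" using \<gamma> \<epsilon> by simp
      ultimately show ?thesis by linarith
    qed
    also have "\<dots> \<le> \<gamma> * (1 - 2 * \<epsilon>) * (B / c)"
    proof -
      have "17 * \<epsilon> \<le> (3 * c + 8) * \<epsilon>" using c3 \<epsilon> by (intro mult_right_mono) auto
      then have "2 * \<epsilon> \<le> 1" using \<epsilon> by linarith
      then show ?thesis using \<gamma> Bc by (intro mult_left_mono) auto
    qed
    also have "\<dots> \<le> R + 1" using topB Rtop by linarith
    finally have "\<gamma> * t / 2 - (c + 2) * \<epsilon> * t - 1 \<le> R" by linarith
    then show ?thesis using small(3) by (simp add: algebra_simps)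
  qed
  have tq: "real (t div q + q) \<le> 2 * \<epsilon> * t"
  proof -
    have "real t \<le> (\<epsilon> * q) * t" using small(2) c3 by (intro mult_right_mono[of 1 "\<epsilon> * q" t, simplified]) linarith+
    then have "real t / q \<le> \<epsilon> * t" using q1 by (simp add: field_simps)
    moreover have "real (t div q) \<le> real t / q" by (rule of_nat_div_le_of_nat)
    moreover have "real q \<le> \<epsilon> * t" using qQ small(1) unfolding Q_def by linarith
    ultimately show ?thesis by simp
  qed
  have low: "(\<gamma> / 2 - (c + 6) * \<epsilon>) * t \<le> R - real (t div q + q)" using R1 tq by (simp add: algebra_simps)
  have "0 \<le> (\<gamma> / 2 - (c + 6) * \<epsilon>) * t" using \<epsilon>(3) by (intro mult_nonneg_nonneg) (auto simp: \<gamma>_def)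
  then have "real (t div q + q) \<le> R" using low by linarith
  then show tqR: "t div q + q \<le> R" by linarith
  have Rt: "real (R - (t div q + q)) = R - real (t div q + q)" using tqR by (simp only: of_nat_diff)
  have "real t ^ 2 * ((real c - 2) / (c + 1) / 4 - (4 * c + 14) * \<epsilon>)
      \<le> ((1 / 2 - (3 * c + 8) * \<epsilon>) * t) * ((\<gamma> / 2 - (c + 6) * \<epsilon>) * t)"
  proof -
    have prod: "((1 / 2 - (3 * c + 8) * \<epsilon>) * t) * ((\<gamma> / 2 - (c + 6) * \<epsilon>) * t)
      = real t ^ 2 * (\<gamma> / 4 - ((3 * c + 8) * \<epsilon>) * (\<gamma> / 2) - (c + 6) * \<epsilon> / 2 + ((3 * c + 8) * \<epsilon>) * ((c + 6) * \<epsilon>))"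
      by (simp add: algebra_simps power2_eq_square)
    have "((3 * c + 8) * \<epsilon>) * (\<gamma> / 2) \<le> ((3 * c + 8) * \<epsilon>) * 1" using \<gamma> \<epsilon> by (intro mult_left_mono) auto
    moreover have "(c + 6) * \<epsilon> / 2 \<le> (c + 6) * \<epsilon>" using \<epsilon> by simp
    moreover have "0 \<le> ((3 * c + 8) * \<epsilon>) * ((c + 6) * \<epsilon>)" using \<epsilon> by simp
    moreover have "(3 * c + 8) * \<epsilon> * 1 + (c + 6) * \<epsilon> = (4 * c + 14) * \<epsilon>" by (simp add: algebra_simps)
    ultimately have "\<gamma> / 4 - (4 * c + 14) * \<epsilon> \<le> \<gamma> / 4 - ((3 * c + 8) * \<epsilon>) * (\<gamma> / 2) - (c + 6) * \<epsilon> / 2 + ((3 * c + 8) * \<epsilon>) * ((c + 6) * \<epsilon>)"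
      by linarith
    from mult_left_mono[OF this, of "real t ^ 2"] show ?thesis unfolding prod by (simp only: \<gamma>_def) simp
  qed
  also have "\<dots> \<le> real (t - C - q) * real (R - (t div q + q))"
    unfolding tC Rt using half low \<open>(1 / 2 - (3 * c + 8) * \<epsilon>) * t \<ge> 0\<close> \<open>0 \<le> (\<gamma> / 2 - (c + 6) * \<epsilon>) * t\<close>
    by (intro mult_mono) linarith+
  finally show "real t ^ 2 * ((real c - 2) / (c + 1) / 4 - (4 * c + 14) * \<epsilon>) \<le> real ((t - C - q) * (R - (t div q + q)))"
    by simp
qed

end

text \<open>The least \<open>e\<close> for which \<open>q ^ c\<close> with \<open>q = p ^ e\<close> exceeds a suitable multiple of \<open>t\<close>.  As \<open>p\<close> is
  fixed, \<open>q ^ c\<close> is then also bounded by a multiple of \<open>t\<close>, and \<open>q ^ (c - 1)\<close> is of smaller order.\<close>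

lemma choose_scale:
  fixes \<epsilon> :: real
  assumes p: "p > 1" and c: "c > 0" and \<epsilon>: "\<epsilon> > 0"
  shows "\<forall>\<^sub>F t in sequentially. \<exists>e. c * (t div 2) < (p ^ e - c) ^ c \<and>
    real (p ^ e) ^ (c - 1) \<le> \<epsilon> * t \<and> real c \<le> \<epsilon> * real (p ^ e) \<and> 1 \<le> \<epsilon> * t"
proof -
  define K where "K = real ((2 * p) ^ c * c)"
  define Q where "Q = nat \<lceil>max (K / \<epsilon>) (c / \<epsilon>)\<rceil> + 2 * c + 1"
  have Q: "K / \<epsilon> \<le> Q" "c / \<epsilon> \<le> Q" "2 * c \<le> Q" "1 \<le> Q"
  proof -
    have m: "max (K / \<epsilon>) (c / \<epsilon>) \<le> real (nat \<lceil>max (K / \<epsilon>) (c / \<epsilon>)\<rceil>)" by linarith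
    show "K / \<epsilon> \<le> Q" "c / \<epsilon> \<le> Q" using m by (auto simp: Q_def)
  qed (simp_all add: Q_def)
  have "\<forall>\<^sub>F t in sequentially. Q ^ c + nat \<lceil>1 / \<epsilon>\<rceil> + 1 \<le> t" by (rule eventually_ge_at_top)
  then show ?thesis
  proof (rule eventually_mono)
    fix t :: nat assume t: "Q ^ c + nat \<lceil>1 / \<epsilon>\<rceil> + 1 \<le> t"
    have t0: "t > 0" using t by simp
    let ?P = "\<lambda>e. 2 ^ c * c * t < (p ^ e) ^ c"
    have "?P (2 ^ c * c * t)"
    proof -
      have "2 ^ c * c * t < p ^ (2 ^ c * c * t)" using p by (intro power_gt_expt) simp
      also have "\<dots> \<le> (p ^ (2 ^ c * c * t)) ^ c" using p c by (intro self_le_power) auto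
      finally show ?thesis .
    qed
    define e where "e = (LEAST e. ?P e)"
    have e: "?P e" unfolding e_def by (rule LeastI) fact
    have e0: "e > 0"
    proof (rule ccontr)
      assume "\<not> e > 0"
      then have "2 ^ c * c * t < 1" using e by simp
      then show False using c t0 by simp
    qed
    then have "\<not> ?P (e - 1)" using not_less_Least[of "e - 1" ?P] by (simp add: e_def)
    then have le: "(p ^ (e - 1)) ^ c \<le> 2 ^ c * c * t" by simp
    let ?q = "p ^ e"
    have qe: "?q = p * p ^ (e - 1)" using e0 by (cases e) auto
    have "?q ^ c = p ^ c * (p ^ (e - 1)) ^ c" by (simp add: qe power_mult_distrib)
    also have "\<dots> \<le> p ^ c * (2 ^ c * c * t)" using le by (intro mult_le_mono2)
    also have "\<dots> = (2 * p) ^ c * c * t" by (simp add: power_mult_distrib)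
    finally have "real (?q ^ c) \<le> real ((2 * p) ^ c * c * t)" by (simp only: of_nat_le_iff)
    then have qK: "real ?q ^ c \<le> K * t" by (simp add: K_def)
    have "Q ^ c < ?q ^ c"
    proof -
      have "Q ^ c \<le> 2 ^ c * c * t" using t c by (metis One_nat_def Suc_leI add_leD1 le_trans mult_le_mono1 mult_1 nat_0_less_mult_iff zero_less_numeral zero_less_power)
      then show ?thesis using e by linarith
    qed
    then have Qq: "Q < ?q" using power_less_imp_less_base by blast
    have q0: "real ?q > 0" using p by simp
    have "c * (t div 2) < (?q - c) ^ c"
    proof -
      have "2 ^ c * (c * (t div 2)) \<le> 2 ^ c * (c * t)" by (intro mult_le_mono2) simp
      also have "\<dots> < ?q ^ c" using e by (simp add: mult.assoc)
      also have "\<dots> \<le> (2 * (?q - c)) ^ c" using Qq Q(3) by (intro power_mono) linarith+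
      also have "\<dots> = 2 ^ c * (?q - c) ^ c" by (simp add: power_mult_distrib)
      finally show ?thesis by simp
    qed
    moreover have "real ?q ^ (c - 1) \<le> \<epsilon> * t"
    proof -
      have "real ?q ^ (c - 1) * ?q \<le> K * t" using qK c by (cases c) (auto simp: mult.commute)
      also have "K \<le> \<epsilon> * ?q"
      proof -
        have "K / \<epsilon> \<le> ?q" using Q(1) Qq by linarith
        then show ?thesis using \<epsilon> by (simp add: field_simps)
      qed
      then have "K * t \<le> \<epsilon> * ?q * t" by (intro mult_right_mono) auto
      finally have "real ?q ^ (c - 1) * ?q \<le> (\<epsilon> * t) * ?q" by (simp add: mult_ac)
      then show ?thesis using q0 by (simp only: mult_le_cancel_right)
    qed
    moreover have "real c \<le> \<epsilon> * real ?q"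
    proof -
      have "c / \<epsilon> \<le> real ?q" using Q(2) Qq by linarith
      then show ?thesis using \<epsilon> by (simp add: field_simps)
    qed
    moreover have "1 \<le> \<epsilon> * t"
    proof -
      have "1 / \<epsilon> \<le> t" using t by linarith
      then show ?thesis using \<epsilon> by (simp add: field_simps)
    qed
    ultimately show "\<exists>e. c * (t div 2) < (p ^ e - c) ^ c \<and>
      real (p ^ e) ^ (c - 1) \<le> \<epsilon> * t \<and> real c \<le> \<epsilon> * real (p ^ e) \<and> 1 \<le> \<epsilon> * t"
      by blast
  qed
qed

text \<open>The best possible error term, capped at \<open>0\<close> because \<open>f\<close> may grow faster than the bound.\<close>

lemma lower_bound_from_limits:
  fixes f :: "nat \<Rightarrow> nat" and p :: nat
  assumes p: "p > 1"
    and f: "\<And>\<delta>. \<delta> > 0 \<Longrightarrow> \<forall>\<^sub>F t in sequentially. real (f t) \<ge> real p powr ((1 / 4 - \<delta>) * real t ^ 2)"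
  shows "\<exists>\<epsilon> :: nat \<Rightarrow> real. ((\<lambda>t. \<epsilon> t / real t ^ 2) \<longlonglongrightarrow> 0) \<and>
    (\<forall>\<^sub>F t in sequentially. real (f t) \<ge> real p powr (1 / 4 * real t ^ 2 + \<epsilon> t))"
proof -
  define \<epsilon> where "\<epsilon> t = min 0 (log p (f t) - 1 / 4 * real t ^ 2)" for t
  have low: "\<forall>\<^sub>F t in sequentially. f t > 0 \<and> - \<delta> * real t ^ 2 \<le> \<epsilon> t" if "\<delta> > 0" for \<delta>
  proof (rule eventually_mono[OF f[OF that]])
    fix t assume a: "real (f t) \<ge> real p powr ((1 / 4 - \<delta>) * real t ^ 2)"
    have pos: "real p powr ((1 / 4 - \<delta>) * real t ^ 2) > 0" using p by simp
    then have f0: "f t > 0" using a by (cases "f t") auto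
    have "(1 / 4 - \<delta>) * real t ^ 2 = log p (real p powr ((1 / 4 - \<delta>) * real t ^ 2))" using p by simp
    also have "\<dots> \<le> log p (f t)" using p a pos by (intro log_mono) auto
    finally have "- \<delta> * real t ^ 2 \<le> log p (f t) - 1 / 4 * real t ^ 2" by (simp add: algebra_simps)
    moreover have "- \<delta> * real t ^ 2 \<le> 0" using that by simp
    ultimately show "f t > 0 \<and> - \<delta> * real t ^ 2 \<le> \<epsilon> t" using f0 by (simp add: \<epsilon>_def)
  qed
  have "(\<lambda>t. \<epsilon> t / real t ^ 2) \<longlonglongrightarrow> 0"
  proof (rule tendstoI)
    fix \<delta> :: real assume d: "\<delta> > 0"
    then have "\<delta> / 2 > 0" by simp
    from low[OF this] eventually_gt_at_top[of 0]
    show "\<forall>\<^sub>F t in sequentially. dist (\<epsilon> t / real t ^ 2) 0 < \<delta>"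
    proof eventually_elim
      fix t :: nat assume a: "f t > 0 \<and> - (\<delta> / 2) * real t ^ 2 \<le> \<epsilon> t" "t > 0"
      have "\<epsilon> t \<le> 0" by (simp add: \<epsilon>_def)
      then have "\<bar>\<epsilon> t\<bar> \<le> \<delta> / 2 * real t ^ 2" using a by simp
      moreover have "real t ^ 2 > 0" using a by simp
      ultimately have "\<bar>\<epsilon> t\<bar> / real t ^ 2 \<le> \<delta> / 2" by (simp add: pos_divide_le_eq)
      then have "\<bar>\<epsilon> t\<bar> / real t ^ 2 < \<delta>" using d by linarith
      then show "dist (\<epsilon> t / real t ^ 2) 0 < \<delta>" by (simp add: dist_real_def)
    qed
  qed
  moreover have "\<forall>\<^sub>F t in sequentially. real (f t) \<ge> real p powr (1 / 4 * real t ^ 2 + \<epsilon> t)"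
  proof (rule eventually_mono[OF low[of 1]])
    fix t assume a: "f t > 0 \<and> - 1 * real t ^ 2 \<le> \<epsilon> t"
    have "real p powr (1 / 4 * real t ^ 2 + \<epsilon> t) \<le> real p powr (log p (f t))"
      using p by (intro powr_mono) (auto simp: \<epsilon>_def)
    also have "\<dots> = f t" using p a by simp
    finally show "real (f t) \<ge> real p powr (1 / 4 * real t ^ 2 + \<epsilon> t)" .
  qed simp
  ultimately show ?thesis by blast
qed

text \<open>Here \<open>c\<close> is large but fixed while \<open>t\<close> tends to infinity.  The functions \<open>a\<close> and \<open>b\<close> are the exponents
  of the orders of the cyclic factors; they stay so small that they do not influence the bound, and
  they are the only difference between the two applications.\<close>

lemma num_groups_asymptotics:
  fixes p :: nat and a b :: "nat \<Rightarrow> nat \<Rightarrow> nat"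
  assumes pp: "Factorial_Ring.prime p"
    and ab: "\<And>e c. a e c + b e c \<le> 2 * (e + c + 2)"
    and Q: "\<And>e c d m1 m2 q (H :: nat monoid) \<theta>.
      \<lbrakk>marked_group p e c m1 m2 q; m1 = p ^ a e c; m2 = p ^ b e c; group H; order H > 0;
        \<theta> \<in> hom (marked_group.gen_group p c d m1 m2 q) H;
        \<theta> ` carrier (marked_group.gen_group p c d m1 m2 q) = carrier H;
        kernel (marked_group.gen_group p c d m1 m2 q) H \<theta> \<subseteq> marked_group.top_layer p c d m1 m2 q\<rbrakk> \<Longrightarrow> Q H"
    and \<delta>: "\<delta> > 0"
  shows "\<forall>\<^sub>F t in sequentially. real (num_groups_up_to_iso Q (p ^ t)) \<ge> real p powr ((1 / 4 - \<delta>) * real t ^ 2)"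
proof -
  have p1: "p > 1" using pp by (rule prime_gt_1_nat)
  define c0 where "c0 = nat \<lceil>2 / \<delta>\<rceil> + 3"
  \<comment> \<open>One of two consecutive numbers is prime to \<open>p\<close>, as \<open>ex_leads\<close> requires of \<open>c + 1\<close>.\<close>
  have "\<exists>c \<ge> c0. \<not> p dvd Suc c"
  proof (cases "p dvd Suc c0")
    case True
    have "\<not> p dvd Suc (Suc c0)"
    proof
      assume "p dvd Suc (Suc c0)"
      then have "p dvd Suc (Suc c0) - Suc c0" using True by (rule dvd_diff_nat)
      then show False using p1 by simp
    qed
    then show ?thesis by (intro exI[of _ "Suc c0"]) simp
  qed blast
  then obtain c where cc: "c \<ge> c0" "\<not> p dvd Suc c" by blast
  have c3: "c \<ge> 3" using cc by (simp add: c0_def)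
  have c\<delta>: "2 / \<delta> \<le> c" using cc by (simp add: c0_def) linarith
  define \<gamma> where "\<gamma> = (real c - 2) / (c + 1)"
  have \<gamma>: "\<gamma> > 0" using c3 by (simp add: \<gamma>_def)
  have \<gamma>4: "\<gamma> / 4 \<ge> 1 / 4 - \<delta> / 2"
  proof -
    have "2 \<le> \<delta> * c" using c\<delta> \<delta> by (simp add: field_simps)
    then have "3 / (4 * (real c + 1)) \<le> \<delta> / 2" using \<delta> by (simp add: field_simps)
    moreover have "\<gamma> / 4 = 1 / 4 - 3 / (4 * (real c + 1))" by (simp add: \<gamma>_def field_simps)
    ultimately show ?thesis by linarith
  qed
  define \<epsilon> where "\<epsilon> = min (\<delta> / (2 * (4 * real c + 16))) (min (1 / (2 * (3 * real c + 8))) (\<gamma> / (2 * (real c + 6))))"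
  have \<epsilon>0: "\<epsilon> > 0" using \<delta> \<gamma> by (simp add: \<epsilon>_def)
  have \<epsilon>1: "(4 * real c + 16) * \<epsilon> \<le> \<delta> / 2"
  proof -
    have "\<epsilon> \<le> \<delta> / (2 * (4 * real c + 16))" by (simp add: \<epsilon>_def)
    then show ?thesis by (simp add: field_simps)
  qed
  have \<epsilon>2: "(3 * c + 8) * \<epsilon> \<le> 1 / 2"
  proof -
    have "\<epsilon> \<le> 1 / (2 * (3 * real c + 8))" by (simp add: \<epsilon>_def)
    then show ?thesis by (simp add: field_simps)
  qed
  have \<epsilon>3: "(c + 6) * \<epsilon> \<le> (real c - 2) / (c + 1) / 2"
  proof -
    have "\<epsilon> \<le> \<gamma> / (2 * (real c + 6))" by (simp add: \<epsilon>_def)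
    then have "(real c + 6) * \<epsilon> \<le> \<gamma> / 2" by (simp add: field_simps)
    then show ?thesis by (simp add: \<gamma>_def)
  qed
  have "c > 0" using c3 by simp
  from choose_scale[OF p1 this \<epsilon>0] show ?thesis
  proof (rule eventually_mono)
    fix t :: nat
    assume "\<exists>e. c * (t div 2) < (p ^ e - c) ^ c \<and>
      real (p ^ e) ^ (c - 1) \<le> \<epsilon> * t \<and> real c \<le> \<epsilon> * real (p ^ e) \<and> 1 \<le> \<epsilon> * t"
    then obtain e where e: "c * (t div 2) < (p ^ e - c) ^ c"
      "real (p ^ e) ^ (c - 1) \<le> \<epsilon> * t" "real c \<le> \<epsilon> * real (p ^ e)" "1 \<le> \<epsilon> * t" by blast
    define q where "q = p ^ e"
    define m1 where "m1 = p ^ a e c"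
    define m2 where "m2 = p ^ b e c"
    obtain n where n: "c = Suc (Suc n)" using c3 by (cases c; cases "c - 1") auto
    have "c * (t div 2) < (q - Suc (Suc n)) ^ Suc (Suc n)" using e(1) n by (simp only: q_def)
    from tune_marked_words[OF this] obtain d where
      d: "card (marked_words q d c) \<le> c * (t div 2)" "c * (t div 2) < card (marked_words q d c) + c\<^sup>2 * q ^ (c - 1)"
      unfolding n by auto
    have mg: "marked_group p e c m1 m2 q"
      by unfold_locales (use pp p1 c3 in \<open>auto simp: q_def m1_def m2_def\<close>)
    interpret marked_group p e c d m1 m2 q by (rule mg)
    define C where "C = e + a e c + b e c + card cost_words"
    define R where "R = card {w \<in> W. length w = Suc c} div (q * Suc c)"
    note small = e(2-4)[folded q_def]
    note EB = exponent_bound[OF c3 d ab small \<epsilon>0 \<epsilon>2 \<epsilon>3 C_def R_def]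
    define E where "E = (t - C - q) * (R - (t div q + q))"
    have cop: "coprime (Suc c) q"
      using prime_imp_coprime[OF pp cc(2)] by (simp add: q_def coprime_commute)
    have Rle: "q * (Suc c * R) \<le> card {w \<in> W. length w = Suc c}"
    proof -
      have "R * (q * Suc c) \<le> card {w \<in> W. length w = Suc c}" unfolding R_def by (rule div_times_less_eq_dividend)
      then show ?thesis by (simp only: mult.assoc mult.commute mult.left_commute)
    qed
    have "p ^ E \<le> num_groups_up_to_iso Q (p ^ t) * (p ^ t)\<^sup>2"
      unfolding E_def
    proof (rule num_groups_lower[OF m1_def m2_def cop _ EB(1) Rle EB(2)])
      show "e + a e c + b e c + card cost_words \<le> C" by (simp add: C_def)
      fix H :: "nat monoid" and \<theta>
      assume h: "group H" "order H > 0" "\<theta> \<in> hom gen_group H" "\<theta> ` carrier gen_group = carrier H" "kernel gen_group H \<theta> \<subseteq> top_layer"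
      show "Q H" by (rule Q[OF mg m1_def m2_def h])
    qed
    then have "real (p ^ E) \<le> real (num_groups_up_to_iso Q (p ^ t) * (p ^ t)\<^sup>2)" by (simp only: of_nat_le_iff)
    moreover have "real (p ^ E) = real p powr real E" using p1 by (simp add: powr_realpow)
    moreover have "real ((p ^ t)\<^sup>2) = real p powr (2 * real t)"
    proof -
      have "real p powr real (t * 2) = real p ^ (t * 2)" using p1 by (intro powr_realpow) simp
      then show ?thesis by (simp add: power_mult mult.commute)
    qed
    ultimately have num: "real p powr real E \<le> real (num_groups_up_to_iso Q (p ^ t)) * real p powr (2 * real t)"
      by (simp only: of_nat_mult)
    have "real p powr ((1 / 4 - \<delta>) * real t ^ 2) \<le> real p powr (real E - 2 * real t)"
    proof (rule powr_mono)
      have "real t \<le> (\<epsilon> * t) * t" using mult_right_mono[OF e(4), of "real t"] by simp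
      then have "2 * real t \<le> 2 * \<epsilon> * real t ^ 2" by (simp add: power2_eq_square)
      moreover have "real t ^ 2 * (\<gamma> / 4 - (4 * c + 14) * \<epsilon>) \<le> E"
        using EB(3) by (simp add: E_def \<gamma>_def)
      moreover have "real t ^ 2 * (1 / 4 - \<delta>) \<le> real t ^ 2 * (\<gamma> / 4 - (4 * c + 14) * \<epsilon> - 2 * \<epsilon>)"
      proof (rule mult_left_mono)
        have "(4 * real c + 16) * \<epsilon> = (4 * c + 14) * \<epsilon> + 2 * \<epsilon>" by (simp add: algebra_simps)
        then show "1 / 4 - \<delta> \<le> \<gamma> / 4 - (4 * c + 14) * \<epsilon> - 2 * \<epsilon>" using \<gamma>4 \<epsilon>1 by linarith
      qed simp
      ultimately show "(1 / 4 - \<delta>) * real t ^ 2 \<le> real E - 2 * real t" by (simp add: algebra_simps)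
    qed (use p1 in simp)
    also have "\<dots> = real p powr real E / real p powr (2 * real t)" using p1 by (simp add: powr_diff)
    also have "\<dots> \<le> real (num_groups_up_to_iso Q (p ^ t))"
      using num p1 by (simp add: divide_le_eq)
    finally show "real (num_groups_up_to_iso Q (p ^ t)) \<ge> real p powr ((1 / 4 - \<delta>) * real t ^ 2)" .
  qed
qed

theorem mainTheorem1:
  fixes p :: nat
  assumes "Factorial_Ring.prime p" and "p \<ge> 5"
  shows "(\<exists>\<epsilon> :: nat \<Rightarrow> real. ((\<lambda>t. \<epsilon> t / real t ^ 2) \<longlonglongrightarrow> 0) \<and>
            (\<forall>\<^sub>F t in sequentially.
               real (num_beauville (p ^ t)) \<ge> real p powr (1 / 4 * real t ^ 2 + \<epsilon> t)))
       \<and> (\<exists>\<epsilon> :: nat \<Rightarrow> real. ((\<lambda>t. \<epsilon> t / real t ^ 2) \<longlonglongrightarrow> 0) \<and>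
            (\<forall>\<^sub>F t in sequentially.
               real (num_non_beauville (p ^ t)) \<ge> real p powr (1 / 4 * real t ^ 2 + \<epsilon> t)))"
proof
  have p1: "p > 1" using assms(2) by simp
  show "\<exists>\<epsilon> :: nat \<Rightarrow> real. ((\<lambda>t. \<epsilon> t / real t ^ 2) \<longlonglongrightarrow> 0) \<and>
            (\<forall>\<^sub>F t in sequentially.
               real (num_beauville (p ^ t)) \<ge> real p powr (1 / 4 * real t ^ 2 + \<epsilon> t))"
  proof (rule lower_bound_from_limits[OF p1])
    fix \<delta> :: real assume \<delta>: "\<delta> > 0"
    show "\<forall>\<^sub>F t in sequentially. real (num_beauville (p ^ t)) \<ge> real p powr ((1 / 4 - \<delta>) * real t ^ 2)"
      unfolding num_beauville_def
    proof (rule num_groups_asymptotics[OF assms(1) _ _ \<delta>, where a = "\<lambda>e c. e + Suc c" and b = "\<lambda>e c. e + Suc c"])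
      fix e c d m1 m2 q and H :: "nat monoid" and \<theta>
      assume mg: "marked_group p e c m1 m2 q" and m: "m1 = p ^ (e + Suc c)" "m2 = p ^ (e + Suc c)"
        and H: "group H" "order H > 0" "\<theta> \<in> hom (marked_group.gen_group p c d m1 m2 q) H"
        "\<theta> ` carrier (marked_group.gen_group p c d m1 m2 q) = carrier H"
        "kernel (marked_group.gen_group p c d m1 m2 q) H \<theta> \<subseteq> marked_group.top_layer p c d m1 m2 q"
      have "m1 = q * p ^ Suc c" "m2 = q * p ^ Suc c"
        using m marked_group.q_def[OF mg] by (simp_all only: power_add)
      then show "beauville_group H"
        by (rule marked_group.quotient_is_beauville[OF mg assms(2) _ _ H])
    qed simp
  qed
  show "\<exists>\<epsilon> :: nat \<Rightarrow> real. ((\<lambda>t. \<epsilon> t / real t ^ 2) \<longlonglongrightarrow> 0) \<and>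
            (\<forall>\<^sub>F t in sequentially.
               real (num_non_beauville (p ^ t)) \<ge> real p powr (1 / 4 * real t ^ 2 + \<epsilon> t))"
  proof (rule lower_bound_from_limits[OF p1])
    fix \<delta> :: real assume \<delta>: "\<delta> > 0"
    show "\<forall>\<^sub>F t in sequentially. real (num_non_beauville (p ^ t)) \<ge> real p powr ((1 / 4 - \<delta>) * real t ^ 2)"
      unfolding num_non_beauville_def
    proof (rule num_groups_asymptotics[OF assms(1) _ _ \<delta>, where a = "\<lambda>e c. Suc (e + Suc c)" and b = "\<lambda>e c. 0"])
      fix e c d m1 m2 q and H :: "nat monoid" and \<theta>
      assume mg: "marked_group p e c m1 m2 q" and m: "m1 = p ^ Suc (e + Suc c)" "m2 = p ^ 0"
        and H: "group H" "order H > 0" "\<theta> \<in> hom (marked_group.gen_group p c d m1 m2 q) H"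
        "\<theta> ` carrier (marked_group.gen_group p c d m1 m2 q) = carrier H"
        "kernel (marked_group.gen_group p c d m1 m2 q) H \<theta> \<subseteq> marked_group.top_layer p c d m1 m2 q"
      have "m1 = p * (q * p ^ Suc c)" "m2 = 1"
        using m marked_group.q_def[OF mg] by (simp_all only: power_Suc[of p "e + Suc c"] power_add power_0)
      then show "two_generated H \<and> \<not> beauville_group H"
        by (rule marked_group.quotient_is_not_beauville[OF mg _ _ H(1,3,4,5)])
    qed simp
  qed
qed

end
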